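(* Let $\mathcal F$ be an equidistant foliation of $\mathbb R^{k+n}$ whose leaves are the orbits of a connected Lie group $G\subset\operatorname{Isom}(\mathbb R^{k+n})$ acting effectively on $\mathbb R^{k+n}$, with $F_0=\mathbb R^k\times\{0\}$ being its most singular orbit. Suppose that $\mathcal F$ is irreducible in the sense that it does not split off a Euclidean factor. Let $G_0$ be the isotropy group of the origin and $\tilde G_0\subset\operatorname{SO}(n)$ its image under the projection $P_2$. Then there exists a Lie group homomorphism $\Phi\colon\mathbb R^k\to\operatorname{Centr}(\tilde G_0)$ into the centralizer of $\tilde G_0$ relative to $\operatorname{SO}(n)$ such that the orbits of $G$ are of the form $$G.(x,y)=\{(x+v,\ \Phi(v).\tilde G_0.y)\mid v\in\mathbb R^k\}\qquad\text{for all }(x,y)\in\mathbb R^k\times\mathbb R^n .$$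
   Context: An equidistant foliation of $\mathbb R^m$ is a partition $\mathcal F$ of $\mathbb R^m$ into complete, smooth, connected, properly embedded submanifolds (leaves, possibly of different dimensions) such that for any two leaves $F,G\in\mathcal F$ and $p\in F$ the distance $\operatorname{dist}(p,G)$ does not depend on the choice of $p\in F$, and such that any vector tangent to a leaf can be locally extended to a smooth vector field everywhere tangent to the leaves. Most singular means of smallest dimension. Since $G$ leaves $F_0$ invariant, it is a subgroup of $\operatorname{Isom}(\mathbb R^k)\times\operatorname{SO}(n)$, where an element with components $(A,a)\in\operatorname{Isom}(\mathbb R^k)$ ($A$ the linear part, $a\in\mathbb R^k$ the translation part) and $B\in\operatorname{SO}(n)$ acts by $(x,y)\mapsto(Ax+a,By)$; $P_2\colon G\to\operatorname{SO}(n)$ denotes the projection to the component $B$. $\mathcal F$ splits off a Euclidean factor if there are an orthogonal vector space decomposition $\mathbb R^{k+n}=V\oplus W$ with $W\neq\{0\}$ and an equidistant foliation $\mathcal F'$ of $V$ such that $\mathcal F=\{F'\times W\mid F'\in\mathcal F'\}$. *)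

theory Defs
  imports "HOL-Analysis.Analysis" "HOL-Algebra.Group" "HOL-Library.Disjoint_Sets"
begin

section \<open>Smooth maps and submanifolds of Euclidean space\<close>

primrec C_k_on :: "nat \<Rightarrow> 'a::euclidean_space set \<Rightarrow> ('a \<Rightarrow> 'b::euclidean_space) \<Rightarrow> bool" where
  "C_k_on 0 U f \<longleftrightarrow> continuous_on U f"
| "C_k_on (Suc n) U f \<longleftrightarrow>
     (\<forall>x\<in>U. f differentiable (at x)) \<and>
     (\<forall>v. C_k_on n U (\<lambda>x. frechet_derivative f (at x) v))"

text \<open>Smoothness on an arbitrary subset of Euclidean space: locally the map extends to a
  \<open>C\<^sup>\<infinity>\<close> map on an open set. If \<open>S\<close> is open, or relatively open in a linear subspace, this is the
  usual notion.\<close>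

definition smooth_on :: "'a::euclidean_space set \<Rightarrow> ('a \<Rightarrow> 'b::euclidean_space) \<Rightarrow> bool" where
  "smooth_on S f \<longleftrightarrow>
     (\<forall>x\<in>S. \<exists>U g. open U \<and> x \<in> U \<and> (\<forall>n. C_k_on n U g) \<and> (\<forall>y\<in>S \<inter> U. g y = f y))"

text \<open>Embedded submanifolds of dimension \<open>d\<close>: locally diffeomorphic to open subsets of a
  \<open>d\<close>-dimensional vector space, realised here as a linear subspace \<open>L\<close> of the ambient space.\<close>

definition embedded_submanifold :: "nat \<Rightarrow> 'a::euclidean_space set \<Rightarrow> bool" where
  "embedded_submanifold d M \<longleftrightarrow>
     (\<forall>p\<in>M. \<exists>U (L :: 'a set) W \<phi> \<psi>. openin (top_of_set M) U \<and> p \<in> U \<and>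
        subspace L \<and> dim L = d \<and> openin (top_of_set L) W \<and>
        homeomorphism U W \<phi> \<psi> \<and> smooth_on U \<phi> \<and> smooth_on W \<psi>)"

definition tangent_space :: "'a::euclidean_space set \<Rightarrow> 'a \<Rightarrow> 'a set" where
  "tangent_space M p =
     {w. \<exists>\<gamma> e. e > 0 \<and> smooth_on {-e<..<e} \<gamma> \<and> \<gamma> ` {-e<..<e} \<subseteq> M \<and> \<gamma> (0::real) = p \<and>
         (\<gamma> has_vector_derivative w) (at 0)}"


section \<open>Equidistant foliations\<close>

text \<open>Completeness is stated for the distance of the ambient space. Like completeness for the
  induced Riemannian distance it follows from proper embeddedness, so that the choice of the
  distance is immaterial.\<close>

definition foliation_leaf :: "'a::euclidean_space set \<Rightarrow> bool" where
  "foliation_leaf L \<longleftrightarrow>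
     complete L \<and> connected L \<and> (\<exists>d. embedded_submanifold d L) \<and>
     proper_map (top_of_set L) euclidean id"

text \<open>Foliations of a linear subspace \<open>V\<close>, as they are needed for the splitting below; a foliation
  of the whole space is the case \<open>V = UNIV\<close>.\<close>

definition equidistant_foliation :: "'a::euclidean_space set \<Rightarrow> 'a set set \<Rightarrow> bool" where
  "equidistant_foliation V \<F> \<longleftrightarrow>
     partition_on V \<F> \<and>
     (\<forall>L\<in>\<F>. foliation_leaf L) \<and>
     (\<forall>L\<in>\<F>. \<forall>L'\<in>\<F>. \<forall>p\<in>L. \<forall>q\<in>L. infdist p L' = infdist q L') \<and>
     (\<forall>L\<in>\<F>. \<forall>p\<in>L. \<forall>w\<in>tangent_space L p.
        \<exists>U X. openin (top_of_set V) U \<and> p \<in> U \<and> smooth_on U X \<and> X p = w \<and>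
              (\<forall>L'\<in>\<F>. \<forall>q\<in>L' \<inter> U. X q \<in> tangent_space L' q))"

definition most_singular_leaf :: "'a::euclidean_space set set \<Rightarrow> 'a set \<Rightarrow> bool" where
  "most_singular_leaf \<F> F\<^sub>0 \<longleftrightarrow>
     F\<^sub>0 \<in> \<F> \<and>
     (\<exists>d\<^sub>0. embedded_submanifold d\<^sub>0 F\<^sub>0 \<and>
        (\<forall>L\<in>\<F>. \<forall>d. embedded_submanifold d L \<longrightarrow> d\<^sub>0 \<le> d))"

definition splits_off_Euclidean_factor :: "'a::euclidean_space set set \<Rightarrow> bool" where
  "splits_off_Euclidean_factor \<F> \<longleftrightarrow>
     (\<exists>V W \<F>'. subspace V \<and> subspace W \<and> (\<forall>v\<in>V. \<forall>w\<in>W. orthogonal v w) \<and>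
        {v + w | v w. v \<in> V \<and> w \<in> W} = UNIV \<and> W \<noteq> {0} \<and>
        equidistant_foliation V \<F>' \<and>
        \<F> = (\<lambda>L. {x + w | x w. x \<in> L \<and> w \<in> W}) ` \<F>')"


section \<open>Lie groups\<close>

text \<open>A smooth structure on a topological space \<open>T\<close>, modelled on the vector space \<open>L\<close>, is given by an
  atlas \<open>C\<close> of pairs \<open>(U, \<phi>)\<close> of a chart domain and a chart map.\<close>

type_synonym ('g, 'b) atlas = "('g set \<times> ('g \<Rightarrow> 'b)) set"

definition smooth_manifold ::
    "'g topology \<Rightarrow> 'b::euclidean_space set \<Rightarrow> ('g, 'b) atlas \<Rightarrow> bool" where
  "smooth_manifold T L C \<longleftrightarrow>
     Hausdorff_space T \<and> second_countable T \<and> subspace L \<and>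
     (\<Union>(U, \<phi>)\<in>C. U) = topspace T \<and>
     (\<forall>(U, \<phi>)\<in>C. openin T U \<and> openin (top_of_set L) (\<phi> ` U) \<and>
        homeomorphic_map (subtopology T U) (top_of_set (\<phi> ` U)) \<phi>) \<and>
     (\<forall>(U, \<phi>)\<in>C. \<forall>(V, \<theta>)\<in>C. smooth_on (\<phi> ` (U \<inter> V)) (\<theta> \<circ> inv_into U \<phi>))"

definition smooth_map ::
    "'g topology \<Rightarrow> ('g, 'b::euclidean_space) atlas \<Rightarrow>
     'h topology \<Rightarrow> ('h, 'c::euclidean_space) atlas \<Rightarrow> ('g \<Rightarrow> 'h) \<Rightarrow> bool" where
  "smooth_map T C T' C' f \<longleftrightarrow>
     continuous_map T T' f \<and>
     (\<forall>(U, \<phi>)\<in>C. \<forall>(V, \<theta>)\<in>C'. smooth_on (\<phi> ` (U \<inter> f -` V)) (\<theta> \<circ> f \<circ> inv_into U \<phi>))"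

definition prod_atlas :: "('g, 'b) atlas \<Rightarrow> ('h, 'c) atlas \<Rightarrow> ('g \<times> 'h, 'b \<times> 'c) atlas" where
  "prod_atlas C D = {(U \<times> V, map_prod \<phi> \<theta>) | U \<phi> V \<theta>. (U, \<phi>) \<in> C \<and> (V, \<theta>) \<in> D}"

definition Lie_group ::
    "'g monoid \<Rightarrow> 'g topology \<Rightarrow> 'b::euclidean_space set \<Rightarrow> ('g, 'b) atlas \<Rightarrow> bool" where
  "Lie_group H T L C \<longleftrightarrow>
     group H \<and> topspace T = carrier H \<and> smooth_manifold T L C \<and>
     smooth_map (prod_topology T T) (prod_atlas C C) T C (\<lambda>(g, h). g \<otimes>\<^bsub>H\<^esub> h) \<and>
     smooth_map T C T C (\<lambda>g. m_inv H g)"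


section \<open>Groups of isometries\<close>

text \<open>The pair \<open>(A, a)\<close> stands for the isometry \<open>z \<mapsto> A z + a\<close>.\<close>

type_synonym 'm motion = "(real^'m^'m) \<times> (real^'m)"

fun act :: "'m::finite motion \<Rightarrow> real^'m \<Rightarrow> real^'m" where
  "act (A, a) z = A *v z + a"

definition Isom :: "'m::finite motion monoid" where
  "Isom = \<lparr>carrier = {(A, a). orthogonal_matrix A},
           mult = (\<lambda>(A, a) (B, b). (A ** B, A *v b + a)),
           one = (mat 1, 0)\<rparr>"

lemma act_mult: "act (g \<otimes>\<^bsub>Isom\<^esub> h) z = act g (act h z)"
  by (cases g; cases h)
     (simp add: Isom_def matrix_vector_mul_assoc matrix_vector_right_distrib add.assoc)

text \<open>The action is effective, and hence so is that of every subgroup.\<close>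

lemma inj_act: "inj act"
proof (rule injI)
  fix g h :: "'m::finite motion"
  assume eq: "act g = act h"
  obtain A a B b where gh: "g = (A, a)" "h = (B, b)"
    by (cases g, cases h)
  have "a = b"
    using fun_cong[OF eq, of 0] gh by simp
  then have "A *v z = B *v z" for z
    using fun_cong[OF eq, of z] gh by simp
  then show "g = h"
    using gh \<open>a = b\<close> by (simp add: matrix_eq)
qed

lemma act_Isom: "act ` carrier Isom = {f. \<forall>x y. dist (f x) (f y) = dist x y}"
proof (intro equalityI subsetI)
  fix f :: "real^'m \<Rightarrow> real^'m"
  assume "f \<in> act ` carrier Isom"
  then obtain A a where A: "orthogonal_matrix A" and f: "f = act (A, a)"
    by (auto simp: Isom_def)
  have "orthogonal_transformation ((*v) A)"
    using A by (simp add: orthogonal_transformation_matrix matrix_vector_mul_linear)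
  then show "f \<in> {f. \<forall>x y. dist (f x) (f y) = dist x y}"
    by (simp add: f orthogonal_transformation_isometry)
next
  fix f :: "real^'m \<Rightarrow> real^'m"
  assume f: "f \<in> {f. \<forall>x y. dist (f x) (f y) = dist x y}"
  define h where "h x = f x - f 0" for x
  have "orthogonal_transformation h"
    using f by (simp add: orthogonal_transformation_isometry h_def dist_norm)
  then have h: "orthogonal_matrix (matrix h)" "\<And>x. matrix h *v x = h x"
    by (simp_all add: orthogonal_transformation_matrix)
  have "f = act (matrix h, f 0)"
    by (rule ext) (simp add: h(2), simp add: h_def)
  then show "f \<in> act ` carrier Isom"
    using h(1) by (auto simp: Isom_def)
qed

definition orbit :: "'m::finite motion set \<Rightarrow> real^'m \<Rightarrow> (real^'m) set" where
  "orbit G z = (\<lambda>g. act g z) ` G"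

definition isotropy_group :: "'m::finite motion set \<Rightarrow> real^'m \<Rightarrow> 'm motion set" where
  "isotropy_group G z = {g \<in> G. act g z = z}"

text \<open>A subgroup of the isometry group which carries the structure of a connected Lie group that
  makes the inclusion into the isometry group (a submanifold of the space of pairs) smooth. The
  inclusion is then an immersion, but \<open>G\<close> need not be closed. As the dimension of \<open>G\<close> is at most
  that of the isometry group, it is no restriction to take the model space \<open>L\<close> inside the space
  of pairs.\<close>

definition connected_Lie_group_of_isometries :: "'m::finite motion set \<Rightarrow> bool" where
  "connected_Lie_group_of_isometries G \<longleftrightarrow>
     subgroup G Isom \<and>
     (\<exists>T (L :: 'm motion set) C.
        Lie_group (Isom\<lparr>carrier := G\<rparr>) T L C \<and> connected_space T \<and>
        (\<forall>(U, \<phi>)\<in>C. smooth_on (\<phi> ` U) (inv_into U \<phi>)))"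


section \<open>The decomposition of the space\<close>

text \<open>\<open>\<real>\<^sup>k \<times> \<real>\<^sup>n\<close> is represented as \<open>real^'m\<close> together with a set \<open>K\<close> of \<open>k\<close> coordinates and its
  complement of \<open>n\<close> coordinates; the factors are \<open>coord_space K\<close> and \<open>coord_space (- K)\<close>, and the
  pair \<open>(x, y)\<close> is the vector \<open>x + y\<close>. Unlike a product of vector types this includes the cases
  \<open>k = 0\<close> and \<open>n = 0\<close>.\<close>

definition coord_space :: "'m::finite set \<Rightarrow> (real^'m) set" where
  "coord_space K = {x. \<forall>i. i \<notin> K \<longrightarrow> x $ i = 0}"

definition vector_group :: "'m::finite set \<Rightarrow> (real^'m) monoid" where
  "vector_group K = \<lparr>carrier = coord_space K, mult = (+), one = 0\<rparr>"

text \<open>For a set \<open>N\<close> of \<open>n\<close> coordinates, \<open>SO N\<close> is \<open>SO(n)\<close>, acting on \<open>coord_space N\<close>; its elements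
  are extended by the identity on the remaining coordinates.\<close>

definition SO :: "'m::finite set \<Rightarrow> (real^'m^'m) monoid" where
  "SO N = \<lparr>carrier = {B. orthogonal_matrix B \<and> det B = 1 \<and> (\<forall>x\<in>coord_space (- N). B *v x = x)},
           mult = (**), one = mat 1\<rparr>"

definition centralizer :: "('g, 'c) monoid_scheme \<Rightarrow> 'g set \<Rightarrow> 'g set" where
  "centralizer H S = {h \<in> carrier H. \<forall>s\<in>S. h \<otimes>\<^bsub>H\<^esub> s = s \<otimes>\<^bsub>H\<^esub> h}"

text \<open>The diagonal block of the linear part belonging to the coordinates outside \<open>K\<close>. A connected
  group of isometries that leaves \<open>coord_space K\<close> invariant lies in
  \<open>Isom(\<real>\<^sup>k) \<times> SO(n)\<close>, and on it \<open>P2 K\<close> is the projection to \<open>SO(n)\<close>.\<close>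

fun P2 :: "'m::finite set \<Rightarrow> 'm motion \<Rightarrow> real^'m^'m" where
  "P2 K (A, a) = (\<chi> i j. if i \<in> - K \<and> j \<in> - K then A $ i $ j else mat 1 $ i $ j)"

end

theory Submission
  imports Defs
begin

text \<open>
  The isometries that map every leaf to itself form a closed group \<open>H \<supseteq> G\<close> with the same orbits as
  \<open>G\<close>, because the leaves are closed. The whole argument takes place in the Lie algebra of \<open>H\<close>, the
  set of all \<open>(Y, b)\<close>, standing for the Killing field \<open>x \<mapsto> Y x + b\<close>, whose flow lies in \<open>H\<close>.
  Write \<open>V = \<real>\<^sup>k\<close> for the leaf through the origin; \<open>H\<close> acts transitively on \<open>V\<close>.

  Irreducibility enters through \<open>translation_invariant_imp_splits_off\<close>: were a pure translation field
  \<open>(0, b)\<close> with \<open>b \<noteq> 0\<close> in the Lie algebra, all leaves would be invariant under the line of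
  translations along \<open>b\<close>, and the hyperplane sections \<open>L \<inter> b\<^sup>\<bottom>\<close> would be the leaves of an equidistant
  foliation that splits off this line. So \<open>(Y, b) \<mapsto> Y\<close> is injective on the Lie algebra, and
  \<open>\<bar>b\<bar> \<le> C \<bar>Y\<bar>\<close> for a constant \<open>C\<close>. Conjugation with a motion that takes the origin to \<open>x \<in> V\<close>
  preserves the Lie algebra and \<open>\<bar>Y\<bar>\<close>, whence \<open>\<bar>Y x + b\<bar> \<le> C \<bar>Y\<bar>\<close> for all \<open>x \<in> V\<close>. A bounded affine
  map is constant, so \<open>Y\<close> vanishes on \<open>V\<close> (\<open>lie_fst_zero\<close>): infinitesimally \<open>H\<close> acts on \<open>V\<close> by
  translations. Therefore elements of \<open>H\<close> near the identity have a linear part that is trivial on \<open>V\<close>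
  (\<open>near_identity\<close>), and so do all elements of the connected group \<open>G\<close>.

  By transitivity every \<open>v \<in> V\<close> is the translation part of some element of the Lie algebra
  (\<open>snd_lie_onto\<close>), and exactly one of these is orthogonal to the isotropy algebra \<open>{(Y, 0)}\<close> for the
  inner product \<open>Y \<bullet> Y'\<close>, the horizontal lift of \<open>v\<close>. Conjugation with an element of \<open>H\<close> that is
  linearly trivial on \<open>V\<close> respects the translation part, the isotropy algebra and the inner product,
  hence fixes horizontal lifts (\<open>Ad_lift\<close>). So horizontal lifts commute with each other and with \<open>G\<close>,
  and the linear part \<open>\<Phi> v\<close> of the exponential of the lift of \<open>v\<close> is a smooth homomorphism into the
  centralizer (\<open>transvection_homomorphism\<close>). Since \<open>z \<mapsto> \<Phi> v z + v\<close> preserves the leaves, moving a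
  point \<open>x + y\<close> to the fibre over the origin and back expresses its orbit through the isotropy group.

  The link between a closed group and its Lie algebra rests on two facts. Every limit of
  difference quotients \<open>(g\<^sub>j - 1) / s\<^sub>j\<close> with \<open>s\<^sub>j \<rightarrow> 0\<close> of a closed group lies in its Lie algebra, as
  \<open>(1 + s\<^sub>j X\<^sub>j)\<^bsup>k\<^sub>j\<^esup>\<close> tends to \<open>exp (t X)\<close> if \<open>k\<^sub>j s\<^sub>j\<close> tends to \<open>t\<close> (\<open>lie_of_sequence\<close>). And if
  \<open>g\<^sub>j\<close> tends to \<open>1\<close> outside a closed subgroup \<open>M\<close>, then the elements closest to \<open>1\<close> in the cosets
  \<open>g\<^sub>j M\<close> yield such a limit that is nonzero and orthogonal to the Lie algebra of \<open>M\<close>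
  (\<open>normal_direction\<close>).
\<close>

section \<open>Smooth maps of Euclidean spaces\<close>

lemma C_k_on_SucD:
  assumes "C_k_on (Suc n) U f" "x \<in> U"
  shows "(f has_derivative frechet_derivative f (at x)) (at x)"
  using assms frechet_derivative_works by auto

text \<open>Openness of \<open>U\<close> matters: \<open>C_k_on\<close> uses the derivative at a point, not within \<open>U\<close>.\<close>

lemma C_k_on_cong:
  assumes "open U" "\<And>x. x \<in> U \<Longrightarrow> f x = g x"
  shows "C_k_on n U f \<longleftrightarrow> C_k_on n U g"
  using assms(2)
proof (induction n arbitrary: f g)
  case 0
  then show ?case by (auto intro: continuous_on_cong[THEN iffD1])
next
  case (Suc n)
  have der: "(f has_derivative D) (at x) \<longleftrightarrow> (g has_derivative D) (at x)" if "x \<in> U" for x D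
    using has_derivative_transform_within_open[OF _ assms(1) that] Suc.prems by metis
  have "f differentiable (at x) \<longleftrightarrow> g differentiable (at x)" if "x \<in> U" for x
    using der[OF that] by (simp add: differentiable_def)
  moreover have "frechet_derivative f (at x) = frechet_derivative g (at x)" if "x \<in> U" for x
    using der[OF that] by (simp add: frechet_derivative_def)
  ultimately show ?case
    using Suc.IH[of "\<lambda>x. frechet_derivative f (at x) _" "\<lambda>x. frechet_derivative g (at x) _"] by simp
qed

lemma C_k_on_subset: "C_k_on n U f \<Longrightarrow> V \<subseteq> U \<Longrightarrow> C_k_on n V f"
  by (induction n arbitrary: f) (auto intro: continuous_on_subset)

lemma C_k_on_Suc_imp: "C_k_on (Suc n) U f \<Longrightarrow> C_k_on n U f"
proof (induction n arbitrary: f)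
  case 0
  then show ?case
    by (auto intro!: continuous_at_imp_continuous_on differentiable_imp_continuous_within)
qed auto

text \<open>Induction over the order of differentiability with an explicit derivative instead of
  \<open>frechet_derivative\<close>. All closure properties below are proved in this way.\<close>

lemma C_k_on_SucI:
  assumes "open U" "\<And>x. x \<in> U \<Longrightarrow> (f has_derivative D x) (at x)" "\<And>v. C_k_on n U (\<lambda>x. D x v)"
  shows "C_k_on (Suc n) U f"
proof -
  have eq: "frechet_derivative f (at x) = D x" if "x \<in> U" for x
    using frechet_derivative_at[OF assms(2)[OF that]] by simp
  have "C_k_on n U (\<lambda>x. frechet_derivative f (at x) v)" for v
    using C_k_on_cong[OF assms(1), of "\<lambda>x. frechet_derivative f (at x) v" "\<lambda>x. D x v"] eq assms(3) by simp
  then show ?thesis using assms(2) by (auto simp: differentiable_def)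
qed

lemma C_k_on_const: "C_k_on n U (\<lambda>x. c)"
  by (induction n arbitrary: c) auto

lemma C_k_on_add:
  assumes "open U" "C_k_on n U f" "C_k_on n U g"
  shows "C_k_on n U (\<lambda>x. f x + g x)"
  using assms(2,3)
proof (induction n arbitrary: f g)
  case 0
  then show ?case by (auto intro: continuous_on_add)
next
  case (Suc n)
  show ?case
  proof (rule C_k_on_SucI[OF assms(1)])
    fix x assume "x \<in> U"
    then show "((\<lambda>x. f x + g x) has_derivative (\<lambda>v. frechet_derivative f (at x) v + frechet_derivative g (at x) v)) (at x)"
      using C_k_on_SucD[OF Suc.prems(1)] C_k_on_SucD[OF Suc.prems(2)] by (intro has_derivative_add)
  next
    fix v show "C_k_on n U (\<lambda>x. frechet_derivative f (at x) v + frechet_derivative g (at x) v)"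
      using Suc.prems by (intro Suc.IH) auto
  qed
qed

lemma C_k_on_sum:
  assumes "open U" "finite I" "\<And>i. i \<in> I \<Longrightarrow> C_k_on n U (f i)"
  shows "C_k_on n U (\<lambda>x. \<Sum>i\<in>I. f i x)"
  using assms(2,3) by (induction I) (auto simp: C_k_on_const intro: C_k_on_add[OF assms(1)])

lemma C_k_on_linear_compose:
  assumes "open U" "linear h" "C_k_on n U f"
  shows "C_k_on n U (\<lambda>x. h (f x))"
  using assms(3)
proof (induction n arbitrary: f)
  case 0
  then show ?case using assms(2) by (auto intro: linear_continuous_on_compose)
next
  case (Suc n)
  have h: "bounded_linear h" using assms(2) linear_conv_bounded_linear by blast
  show ?case
  proof (rule C_k_on_SucI[OF assms(1)])
    fix x assume "x \<in> U"
    then show "((\<lambda>x. h (f x)) has_derivative (\<lambda>v. h (frechet_derivative f (at x) v))) (at x)"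
      by (intro bounded_linear.has_derivative[OF h] C_k_on_SucD[OF Suc.prems])
  next
    fix v show "C_k_on n U (\<lambda>x. h (frechet_derivative f (at x) v))"
      using Suc.prems by (intro Suc.IH) auto
  qed
qed

lemma C_k_on_id: "open U \<Longrightarrow> C_k_on n U (\<lambda>x. x)"
proof (induction n)
  case (Suc n)
  show ?case
    by (rule C_k_on_SucI[where D = "\<lambda>x v. v"]) (auto simp: Suc C_k_on_const)
qed auto

lemma C_k_on_linear: "open U \<Longrightarrow> linear h \<Longrightarrow> C_k_on n U h"
  using C_k_on_linear_compose[OF _ _ C_k_on_id] by blast

lemma C_k_on_bilinear:
  assumes "open U" and p: "bounded_bilinear p" and "C_k_on n U f" "C_k_on n U g"
  shows "C_k_on n U (\<lambda>x. p (f x) (g x))"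
  using assms(3,4)
proof (induction n arbitrary: f g)
  case 0
  then show ?case using bounded_bilinear.continuous_on[OF p] by simp
next
  case (Suc n)
  show ?case
  proof (rule C_k_on_SucI[OF assms(1)])
    fix x assume "x \<in> U"
    then show "((\<lambda>x. p (f x) (g x)) has_derivative
       (\<lambda>v. p (f x) (frechet_derivative g (at x) v) + p (frechet_derivative f (at x) v) (g x))) (at x)"
      by (intro bounded_bilinear.FDERIV[OF p] C_k_on_SucD[OF Suc.prems(1)] C_k_on_SucD[OF Suc.prems(2)])
  next
    fix v show "C_k_on n U (\<lambda>x. p (f x) (frechet_derivative g (at x) v) + p (frechet_derivative f (at x) v) (g x))"
      using Suc.prems C_k_on_Suc_imp[OF Suc.prems(1)] C_k_on_Suc_imp[OF Suc.prems(2)]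
      by (intro C_k_on_add[OF assms(1)] Suc.IH) auto
  qed
qed

lemma C_k_on_inverse:
  fixes f :: "'a::euclidean_space \<Rightarrow> real"
  assumes "open U" "C_k_on n U f" "\<And>x. x \<in> U \<Longrightarrow> f x \<noteq> 0"
  shows "C_k_on n U (\<lambda>x. inverse (f x))"
  using assms(2)
proof (induction n)
  case 0
  then show ?case using assms(3) by (auto intro: continuous_on_inverse)
next
  case (Suc n)
  note IH = Suc.IH[OF C_k_on_Suc_imp[OF Suc.prems]]
  show ?case
  proof (rule C_k_on_SucI[OF assms(1)])
    fix x assume x: "x \<in> U"
    show "((\<lambda>x. inverse (f x)) has_derivative
       (\<lambda>v. - (inverse (f x) * frechet_derivative f (at x) v * inverse (f x)))) (at x)"
      by (rule Deriv.has_derivative_inverse[OF assms(3)[OF x] C_k_on_SucD[OF Suc.prems x]])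
  next
    fix v
    have "C_k_on n U (\<lambda>x. inverse (f x) * frechet_derivative f (at x) v * inverse (f x))"
      using Suc.prems by (intro C_k_on_bilinear[OF assms(1) bounded_bilinear_mult] IH) auto
    then show "C_k_on n U (\<lambda>x. - (inverse (f x) * frechet_derivative f (at x) v * inverse (f x)))"
      by (intro C_k_on_linear_compose[OF assms(1) linear_uminus])
  qed
qed

text \<open>The derivative \<open>Dg (f x) (Df x v)\<close> depends on \<open>x\<close> in two places; expanding \<open>Df x v\<close> in the
  standard basis separates them, and the induction hypothesis applies to each \<open>x \<mapsto> Dg (f x) i\<close>.\<close>

lemma C_k_on_compose:
  assumes "open U" "open V" "C_k_on n U f" "C_k_on n V g" "f ` U \<subseteq> V"
  shows "C_k_on n U (\<lambda>x. g (f x))"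
  using assms(3,4)
proof (induction n arbitrary: g)
  case 0
  then show ?case using assms(5) by (auto intro: continuous_on_compose2)
next
  case (Suc n)
  let ?Df = "\<lambda>x. frechet_derivative f (at x)" and ?Dg = "\<lambda>y. frechet_derivative g (at y)"
  have fV: "f x \<in> V" if "x \<in> U" for x using assms(5) that by blast
  show ?case
  proof (rule C_k_on_SucI[OF assms(1)])
    fix x assume x: "x \<in> U"
    have "((\<lambda>x. g (f x)) has_derivative (\<lambda>v. ?Dg (f x) (?Df x v))) (at x)"
      by (rule has_derivative_compose[OF C_k_on_SucD[OF Suc.prems(1) x] C_k_on_SucD[OF Suc.prems(2) fV[OF x]]])
    moreover have "?Dg (f x) (?Df x v) = (\<Sum>i\<in>Basis. (?Df x v \<bullet> i) *\<^sub>R ?Dg (f x) i)" for v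
    proof -
      have lin: "linear (?Dg (f x))"
        using C_k_on_SucD[OF Suc.prems(2) fV[OF x]] has_derivative_linear by blast
      have "?Dg (f x) (?Df x v) = ?Dg (f x) (\<Sum>i\<in>Basis. (?Df x v \<bullet> i) *\<^sub>R i)"
        by (simp add: euclidean_representation)
      also have "\<dots> = (\<Sum>i\<in>Basis. (?Df x v \<bullet> i) *\<^sub>R ?Dg (f x) i)"
        by (simp add: linear_sum[OF lin] linear_scale[OF lin])
      finally show ?thesis .
    qed
    ultimately show "((\<lambda>x. g (f x)) has_derivative (\<lambda>v. \<Sum>i\<in>Basis. (?Df x v \<bullet> i) *\<^sub>R ?Dg (f x) i)) (at x)"
      by simp
  next
    fix v
    have Df: "C_k_on n U (\<lambda>x. ?Df x v)" using Suc.prems(1) by simp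
    have "C_k_on n U (\<lambda>x. ?Dg (f x) i)" for i
      using Suc.IH[OF C_k_on_Suc_imp[OF Suc.prems(1)], of "\<lambda>y. ?Dg y i"] Suc.prems(2) by simp
    then show "C_k_on n U (\<lambda>x. \<Sum>i\<in>Basis. (?Df x v \<bullet> i) *\<^sub>R ?Dg (f x) i)"
      by (intro C_k_on_sum[OF assms(1)] C_k_on_bilinear[OF assms(1) bounded_bilinear_scaleR]
          C_k_on_bilinear[OF assms(1) bounded_bilinear_inner] C_k_on_const Df) auto
  qed
qed

lemma C_k_on_imp_continuous_on: "C_k_on n U f \<Longrightarrow> continuous_on U f"
  by (induction n) (use C_k_on_Suc_imp in auto)

lemma smooth_on_compose:
  assumes f: "smooth_on S f" and g: "smooth_on T g" and "f ` S \<subseteq> T"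
  shows "smooth_on S (g \<circ> f)"
  unfolding smooth_on_def
proof
  fix x assume x: "x \<in> S"
  then obtain U F where U: "open U" "x \<in> U" "\<And>n. C_k_on n U F" "\<And>y. y \<in> S \<inter> U \<Longrightarrow> F y = f y"
    using f unfolding smooth_on_def by meson
  have "f x \<in> T" using x assms(3) by blast
  then have "\<exists>V G. open V \<and> f x \<in> V \<and> (\<forall>n. C_k_on n V G) \<and> (\<forall>y\<in>T \<inter> V. G y = g y)"
    using g unfolding smooth_on_def by blast
  then obtain V G where V: "open V" "f x \<in> V" "\<And>n. C_k_on n V G" "\<And>y. y \<in> T \<inter> V \<Longrightarrow> G y = g y"
    by blast
  let ?W = "F -` V \<inter> U"
  have W: "open ?W"
    using continuous_open_preimage[OF C_k_on_imp_continuous_on[OF U(3)] U(1) V(1)] by (simp add: Int_commute)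
  have "C_k_on n ?W (\<lambda>y. G (F y))" for n
    by (rule C_k_on_compose[OF W V(1) C_k_on_subset[OF U(3)] V(3)]) auto
  moreover have "x \<in> ?W" using x U V by auto
  moreover have "\<forall>y\<in>S \<inter> ?W. G (F y) = (g \<circ> f) y"
    using U(4) V(4) assms(3) by auto
  ultimately show "\<exists>U h. open U \<and> x \<in> U \<and> (\<forall>n. C_k_on n U h) \<and> (\<forall>y\<in>S \<inter> U. h y = (g \<circ> f) y)"
    using W by blast
qed

lemma smooth_on_subset:
  assumes "smooth_on S f" "T \<subseteq> S"
  shows "smooth_on T f"
  unfolding smooth_on_def
proof
  fix x assume "x \<in> T"
  then have "\<exists>U g. open U \<and> x \<in> U \<and> (\<forall>n. C_k_on n U g) \<and> (\<forall>y\<in>S \<inter> U. g y = f y)"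
    using assms unfolding smooth_on_def by blast
  then show "\<exists>U g. open U \<and> x \<in> U \<and> (\<forall>n. C_k_on n U g) \<and> (\<forall>y\<in>T \<inter> U. g y = f y)"
    using assms(2) by blast
qed

lemma smooth_on_C_k: "open U \<Longrightarrow> (\<And>n. C_k_on n U f) \<Longrightarrow> S \<subseteq> U \<Longrightarrow> smooth_on S f"
  unfolding smooth_on_def by blast

lemma smooth_on_linear: "linear h \<Longrightarrow> smooth_on S h"
  by (rule smooth_on_C_k[OF open_UNIV]) (auto intro: C_k_on_linear)

lemma derivative_in_subspace:
  fixes f :: "real \<Rightarrow> 'a::euclidean_space"
  assumes S: "subspace S" and f: "(f has_vector_derivative w) (at 0)"
    and e: "e > 0" "\<And>t. \<bar>t\<bar> < e \<Longrightarrow> f t \<in> S"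
  shows "w \<in> S"
proof -
  obtain y z where yz: "y \<in> span S" "\<And>v. v \<in> span S \<Longrightarrow> orthogonal z v" "w = y + z"
    using orthogonal_subspace_decomp_exists[of S w] by blast
  have span: "span S = S" using S by simp
  have "((\<lambda>t. f t \<bullet> z) has_vector_derivative (w \<bullet> z)) (at 0)"
    by (rule bounded_linear.has_vector_derivative[OF bounded_linear_inner_left f])
  then have "((\<lambda>t. 0) has_vector_derivative (w \<bullet> z)) (at 0)"
  proof (rule has_vector_derivative_transform_within_open)
    show "open {-e<..<e}" "0 \<in> {-e<..<e}" using e by auto
    fix t assume "t \<in> {-e<..<e}"
    then have "f t \<in> S" using e(2)[of t] by auto
    then show "f t \<bullet> z = 0" using yz(2)[of "f t"] span by (simp add: orthogonal_def inner_commute[of z])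
  qed
  then have "w \<bullet> z = 0"
    using vector_derivative_unique_at[OF _ has_vector_derivative_const[of 0]] by blast
  then have "z \<bullet> z = 0"
    using yz(2)[OF yz(1)] inner_commute[of y z] unfolding yz(3) orthogonal_def by (simp add: inner_add_left)
  then show ?thesis using yz span by simp
qed

text \<open>The implicit function theorem for a scalar function \<open>\<tau>\<close>, in the form of a change of coordinates
  along one direction. Replacing the \<open>e\<close>-coordinate of \<open>x\<close> by \<open>\<tau> x\<close> is a local diffeomorphism \<open>F\<close>.
  As \<open>F\<close> moves points only along \<open>e\<close>, its inverse derivative is explicit, \<open>G\<close> below, and involves
  no inverse but that of the number \<open>D\<tau> e\<close>; so smoothness of the inverse function follows by
  induction.\<close>

lemma straightening:
  fixes \<tau> :: "'a::euclidean_space \<Rightarrow> real"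
  assumes U: "open U" "x0 \<in> U" and \<tau>: "\<And>n. C_k_on n U \<tau>"
    and e: "frechet_derivative \<tau> (at x0) e \<noteq> 0"
  defines "F \<equiv> \<lambda>x. x + (\<tau> x - (x \<bullet> e) / (e \<bullet> e)) *\<^sub>R e"
  obtains U' V s where "open U'" "U' \<subseteq> U" "x0 \<in> U'" "open V" "homeomorphism U' V F s"
    "\<And>n. C_k_on n V s" "\<And>n. C_k_on n U F"
proof -
  define T where "T x = frechet_derivative \<tau> (at x)" for x
  define l where "l x = (x \<bullet> e) / (e \<bullet> e)" for x
  have T: "(\<tau> has_derivative T x) (at x)" if "x \<in> U" for x
    unfolding T_def using C_k_on_SucD[OF \<tau>[of "Suc 0"] that] .
  have T_smooth: "C_k_on n U (\<lambda>x. T x v)" for n v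
    using \<tau>[of "Suc n"] by (simp add: T_def)
  have linT: "linear (T x)" if "x \<in> U" for x using T[OF that] has_derivative_linear by blast
  have e0: "e \<noteq> 0" using e linT[OF U(2)] linear_0 unfolding T_def by blast
  have linl: "linear l" unfolding l_def by (rule linearI) (auto simp: inner_add_left add_divide_distrib)
  have le: "l e = 1" using e0 by (simp add: l_def)
  define U1 where "U1 = (\<lambda>x. T x e) -` (- {0}) \<inter> U"
  have U1: "open U1"
    unfolding U1_def using continuous_open_preimage[OF C_k_on_imp_continuous_on[OF T_smooth[of 0 e]] U(1), of "- {0}"]
    by (simp add: Int_commute open_Compl)
  have xU1: "x0 \<in> U1" using e U by (simp add: U1_def T_def)
  have U1U: "U1 \<subseteq> U" by (auto simp: U1_def)
  have Te: "T x e \<noteq> 0" if "x \<in> U1" for x using that by (simp add: U1_def)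
  define DF where "DF x = (\<lambda>w. w + (T x w - l w) *\<^sub>R e)" for x
  define G where "G x = (\<lambda>w. w + ((l w - T x w) * inverse (T x e)) *\<^sub>R e)" for x
  have F: "F = (\<lambda>x. x + (\<tau> x - l x) *\<^sub>R e)" by (simp add: F_def l_def)
  have bl: "bounded_linear l" using linl linear_conv_bounded_linear by blast
  have F_der: "(F has_derivative DF x) (at x)" if "x \<in> U" for x
    unfolding F DF_def
    by (intro has_derivative_add has_derivative_ident bounded_linear.has_derivative[OF bounded_linear_scaleR_left]
        has_derivative_diff T that bounded_linear.has_derivative[OF bl])
  have linDF: "linear (DF x)" if "x \<in> U" for x
    using F_der[OF that] has_derivative_linear by blast
  have l_shift: "l (w + c *\<^sub>R e) = l w + c" for w c
    by (simp add: linear_add[OF linl] linear_scale[OF linl] le)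
  have T_shift: "T x (w + c *\<^sub>R e) = T x w + c * T x e" if "x \<in> U" for x w c
    by (simp add: linear_add[OF linT[OF that]] linear_scale[OF linT[OF that]])
  have GDF: "G x (DF x w) = w" if "x \<in> U1" for x w
  proof -
    have x: "x \<in> U" using that U1U by blast
    have "l (DF x w) - T x (DF x w) = - (T x w - l w) * T x e"
      unfolding DF_def l_shift T_shift[OF x] by (simp add: algebra_simps)
    then have "(l (DF x w) - T x (DF x w)) * inverse (T x e) = - (T x w - l w)"
      using Te[OF that] by simp
    then have "G x (DF x w) = DF x w + (- (T x w - l w)) *\<^sub>R e" unfolding G_def by simp
    then show ?thesis by (simp add: DF_def flip: scaleR_add_left)
  qed
  have DFG: "DF x (G x w) = w" if "x \<in> U1" for x w
  proof -
    have x: "x \<in> U" using that U1U by blast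
    let ?r = "(l w - T x w) * inverse (T x e)"
    have "T x (G x w) - l (G x w) = T x w + ?r * T x e - l w - ?r"
      unfolding G_def l_shift T_shift[OF x] by simp
    also have "\<dots> = - ?r" using Te[OF that] by (simp add: mult.assoc)
    finally have "DF x (G x w) = G x w + (- ?r) *\<^sub>R e" unfolding DF_def by simp
    then show ?thesis by (simp add: G_def)
  qed
  have linG: "linear (G x0)"
    unfolding G_def
    by (intro linearI)
       (auto simp: linear_add[OF linl] linear_scale[OF linl] linear_add[OF linT[OF U(2)]]
         linear_scale[OF linT[OF U(2)]] algebra_simps)
  have contT: "continuous_on U1 (\<lambda>x. T x w)" for w
    by (rule continuous_on_subset[OF C_k_on_imp_continuous_on[OF T_smooth] U1U])
  have DFapp: "blinfun_apply (Blinfun (DF x)) = DF x" if "x \<in> U" for x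
    using linDF[OF that] by (simp add: bounded_linear_Blinfun_apply linear_conv_bounded_linear)
  have Gapp: "blinfun_apply (Blinfun (G x0)) = G x0"
    using linG by (simp add: bounded_linear_Blinfun_apply linear_conv_bounded_linear)
  have cont: "continuous_on U1 (\<lambda>x. Blinfun (DF x))"
  proof (rule continuous_on_blinfun_componentwise)
    fix i :: 'a
    have "continuous_on U1 (\<lambda>x. DF x i)" unfolding DF_def by (intro continuous_intros contT)
    then show "continuous_on U1 (\<lambda>x. blinfun_apply (Blinfun (DF x)) i)"
      by (rule continuous_on_eq) (use DFapp U1U in auto)
  qed
  have inv: "Blinfun (G x0) o\<^sub>L Blinfun (DF x0) = id_blinfun"
    by (rule blinfun_eqI) (simp add: Gapp DFapp[OF U(2)] GDF[OF xU1])
  have der: "(F has_derivative blinfun_apply (Blinfun (DF x))) (at x)" if "x \<in> U1" for x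
    using F_der DFapp that U1U by auto
  obtain U' V s s' where *: "open U'" "U' \<subseteq> U1" "x0 \<in> U'" "open V" "homeomorphism U' V F s"
    "\<And>y. y \<in> V \<Longrightarrow> (s has_derivative (s' y)) (at y)"
    "\<And>y. y \<in> V \<Longrightarrow> s' y = inv_into UNIV (blinfun_apply (Blinfun (DF (s y))))"
    using inverse_function_theorem[OF U1 der cont xU1 inv] by metis
  have sU: "s y \<in> U1" if "y \<in> V" for y
    using *(2,5) that unfolding homeomorphism_def by blast
  have s': "s' y = G (s y)" if y: "y \<in> V" for y
  proof -
    have "inv_into UNIV (DF (s y)) = G (s y)"
      by (rule inv_unique_comp) (auto simp: fun_eq_iff GDF DFG sU[OF y])
    then show ?thesis using *(7)[OF y] DFapp sU[OF y] U1U by auto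
  qed
  have "C_k_on n V s" for n
  proof (induction n)
    case 0
    then show ?case using *(5) by (simp add: homeomorphism_def)
  next
    case (Suc n)
    show ?case
    proof (rule C_k_on_SucI[OF *(4)])
      fix y assume "y \<in> V"
      then show "(s has_derivative G (s y)) (at y)" using *(6) s' by auto
    next
      fix v
      have T_s: "C_k_on n V (\<lambda>y. T (s y) w)" for w
        by (rule C_k_on_compose[OF *(4) U1 Suc C_k_on_subset[OF T_smooth U1U]]) (use sU in auto)
      have "C_k_on n V (\<lambda>y. l v + (- T (s y) v))"
        by (intro C_k_on_add[OF *(4)] C_k_on_const C_k_on_linear_compose[OF *(4) linear_uminus] T_s)
      then have "C_k_on n V (\<lambda>y. l v - T (s y) v)" by simp
      then show "C_k_on n V (\<lambda>y. G (s y) v)"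
        unfolding G_def
        by (intro C_k_on_add[OF *(4)] C_k_on_const C_k_on_bilinear[OF *(4) bounded_bilinear_scaleR]
          C_k_on_bilinear[OF *(4) bounded_bilinear_mult] C_k_on_inverse[OF *(4)] T_s Te sU) auto
    qed
  qed
  moreover have "C_k_on n U F" for n
  proof -
    have "C_k_on n U (\<lambda>x. x + (\<tau> x + (- l x)) *\<^sub>R e)"
      by (intro C_k_on_add[OF U(1)] C_k_on_id[OF U(1)] C_k_on_bilinear[OF U(1) bounded_bilinear_scaleR]
          C_k_on_const \<tau> C_k_on_linear_compose[OF U(1) linear_uminus] C_k_on_linear[OF U(1) linl])
    then show ?thesis by (simp add: F)
  qed
  ultimately show ?thesis using that[of U' V s] * U1U by blast
qed

lemma smooth_on_imp_continuous_on:
  assumes "smooth_on S f"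
  shows "continuous_on S f"
  unfolding continuous_on_def
proof
  fix x assume "x \<in> S"
  then obtain U g where U: "open U" "x \<in> U" "\<And>n. C_k_on n U g" "\<And>y. y \<in> S \<inter> U \<Longrightarrow> g y = f y"
    using assms unfolding smooth_on_def by meson
  have "isCont g x"
    using C_k_on_imp_continuous_on[OF U(3)] U(1,2) continuous_on_eq_continuous_at by blast
  then have "(g \<longlongrightarrow> g x) (at x within S)"
    by (simp add: continuous_within tendsto_within_subset[of _ _ _ UNIV] isCont_def)
  moreover have "\<forall>\<^sub>F y in at x within S. g y = f y"
    unfolding eventually_at_topological using U by blast
  moreover have "g x = f x" using U(4) \<open>x \<in> S\<close> U(2) by blast
  ultimately show "(f \<longlongrightarrow> f x) (at x within S)"
    using Lim_transform_eventually by fastforce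
qed


section \<open>Foliations invariant under a line of translations\<close>

text \<open>A hyperplane section of a submanifold that is invariant under the translations along the normal
  \<open>b\<close>. In a chart \<open>\<psi>\<close> of \<open>L\<close> the section is the zero set of \<open>\<tau> = \<psi> \<bullet> b\<close>. The curve \<open>t \<mapsto> p + t b\<close> runs
  in \<open>L\<close>, so its image under the chart has a tangent \<open>e\<close> with \<open>D\<tau> e = b \<bullet> b \<noteq> 0\<close>; straightening
  \<open>\<tau>\<close> along \<open>e\<close> gives a chart with values in the hyperplane orthogonal to \<open>e\<close>.\<close>

lemma embedded_slice:
  fixes L :: "'a::euclidean_space set"
  assumes L: "embedded_submanifold d L" and b: "b \<noteq> 0"
    and invL: "\<And>q t. q \<in> L \<Longrightarrow> q + t *\<^sub>R b \<in> L"
  shows "embedded_submanifold (d - 1) (L \<inter> {x. x \<bullet> b = 0})"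
  unfolding embedded_submanifold_def
proof
  let ?V = "{x. x \<bullet> b = 0}"
  fix p assume p: "p \<in> L \<inter> ?V"
  then have "p \<in> L" by blast
  from bspec[OF L[unfolded embedded_submanifold_def] this] obtain U and E :: "'a set" and W \<phi> \<psi> where U: "openin (top_of_set L) U" "p \<in> U"
    and E: "subspace E" "dim E = d" and W: "openin (top_of_set E) W"
    and hom: "homeomorphism U W \<phi> \<psi>" and sm: "smooth_on U \<phi>" "smooth_on W \<psi>"
    by blast
  define e0 where "e0 = \<phi> p"
  have \<phi>W: "\<phi> q \<in> W" and \<psi>\<phi>: "\<psi> (\<phi> q) = q" if "q \<in> U" for q
    using hom that by (auto simp: homeomorphism_def)
  have \<psi>U: "\<psi> x \<in> U" and \<phi>\<psi>: "\<phi> (\<psi> x) = x" if "x \<in> W" for x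
    using hom that by (auto simp: homeomorphism_def)
  have e0: "e0 \<in> W" using \<phi>W U by (simp add: e0_def)
  obtain U0 where U0: "open U0" "U = L \<inter> U0" using U by (auto simp: openin_open)
  obtain W0 where W0: "open W0" "W = E \<inter> W0" using W by (auto simp: openin_open)
  obtain N \<phi>' where N: "open N" "p \<in> N" "\<And>n. C_k_on n N \<phi>'" "\<And>y. y \<in> U \<inter> N \<Longrightarrow> \<phi>' y = \<phi> y"
    using sm(1) U(2) unfolding smooth_on_def by meson
  obtain P \<psi>' where P: "open P" "e0 \<in> P" "\<And>n. C_k_on n P \<psi>'" "\<And>y. y \<in> W \<inter> P \<Longrightarrow> \<psi>' y = \<psi> y"
    using sm(2) e0 unfolding smooth_on_def by meson
  \<comment> \<open>On \<open>E \<inter> Q\<close>, which lies in the range \<open>W\<close> of the chart, the extension \<open>\<psi>'\<close> agrees with \<open>\<psi>\<close>.\<close>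
  define Q where "Q = P \<inter> W0"
  have Q: "open Q" "e0 \<in> Q" "E \<inter> Q \<subseteq> W \<inter> P" using P W0 e0 by (auto simp: Q_def)
  have \<psi>'Q: "C_k_on n Q \<psi>'" for n by (rule C_k_on_subset[OF P(3)]) (simp add: Q_def)
  \<comment> \<open>A neighbourhood of \<open>p\<close> that the extension \<open>\<phi>'\<close> maps into \<open>Q\<close>.\<close>
  define A where "A = U0 \<inter> (N \<inter> \<phi>' -` Q)"
  have A: "open A" "p \<in> A"
    using U0 continuous_open_preimage[OF C_k_on_imp_continuous_on[OF N(3)[of 0]] N(1) Q(1)] U N e0 Q
    by (auto simp: A_def e0_def)
  have "open ((\<lambda>t. p + t *\<^sub>R b) -` A)"
    by (intro open_vimage A continuous_intros)
  moreover have "0 \<in> (\<lambda>t. p + t *\<^sub>R b) -` A"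
    using A(2) by simp
  ultimately obtain \<epsilon> where ball: "\<epsilon> > 0" "ball 0 \<epsilon> \<subseteq> (\<lambda>t. p + t *\<^sub>R b) -` A"
    by (rule openE)
  then have \<epsilon>: "\<epsilon> > 0" "\<And>t. \<bar>t\<bar> < \<epsilon> \<Longrightarrow> p + t *\<^sub>R b \<in> A"
    by auto
  define c where "c t = \<phi>' (p + t *\<^sub>R b)" for t
  have c: "c t \<in> E \<inter> Q" "\<psi>' (c t) = p + t *\<^sub>R b" if "\<bar>t\<bar> < \<epsilon>" for t
  proof -
    have "p + t *\<^sub>R b \<in> U \<inter> N" "\<phi>' (p + t *\<^sub>R b) \<in> Q"
      using \<epsilon>(2)[OF that] invL[of p t] p U0 by (auto simp: A_def)
    then have "c t = \<phi> (p + t *\<^sub>R b)" "p + t *\<^sub>R b \<in> U" "c t \<in> Q" using N(4) by (auto simp: c_def)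
    then show "c t \<in> E \<inter> Q" "\<psi>' (c t) = p + t *\<^sub>R b"
      using \<phi>W \<psi>\<phi> P(4)[of "c t"] Q(3) W0 by auto
  qed
  define e where "e = frechet_derivative \<phi>' (at p) b"
  have "((\<lambda>t. p + t *\<^sub>R b) has_derivative (\<lambda>t. t *\<^sub>R b)) (at 0)"
    by (auto intro!: derivative_eq_intros)
  from has_derivative_compose[OF this, of \<phi>' "frechet_derivative \<phi>' (at p)"]
  have "(c has_derivative (\<lambda>t. frechet_derivative \<phi>' (at p) (t *\<^sub>R b))) (at 0)"
    using C_k_on_SucD[OF N(3)[of "Suc 0"] N(2)] by (simp add: c_def[abs_def])
  moreover have "linear (frechet_derivative \<phi>' (at p))"
    using C_k_on_SucD[OF N(3)[of "Suc 0"] N(2)] has_derivative_linear by blast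
  ultimately have c_der: "(c has_vector_derivative e) (at 0)"
    by (simp add: has_vector_derivative_def e_def linear_scale)
  have eE: "e \<in> E"
    by (rule derivative_in_subspace[OF E(1) c_der \<epsilon>(1)]) (use c in blast)
  have c0: "c 0 = e0" using N(4)[of p] U N by (simp add: c_def e0_def)
  have \<psi>'_der: "(\<psi>' has_derivative frechet_derivative \<psi>' (at e0)) (at e0)"
    by (rule C_k_on_SucD[OF P(3)[of "Suc 0"] P(2)])
  have "((\<lambda>t. \<psi>' (c t)) has_vector_derivative frechet_derivative \<psi>' (at e0) e) (at 0)"
  proof -
    have "((\<lambda>t. \<psi>' (c t)) has_derivative (\<lambda>t. frechet_derivative \<psi>' (at e0) (t *\<^sub>R e))) (at 0)"
      using has_derivative_compose[OF c_der[unfolded has_vector_derivative_def], of \<psi>'] \<psi>'_der c0 by simp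
    then show ?thesis
      using linear_scale[OF has_derivative_linear[OF \<psi>'_der]] by (simp add: has_vector_derivative_def)
  qed
  then have "((\<lambda>t. p + t *\<^sub>R b) has_vector_derivative frechet_derivative \<psi>' (at e0) e) (at 0)"
  proof (rule has_vector_derivative_transform_within_open)
    show "open {-\<epsilon><..<\<epsilon>}" "0 \<in> {-\<epsilon><..<\<epsilon>}" using \<epsilon> by auto
  qed (use c in auto)
  moreover have "((\<lambda>t. p + t *\<^sub>R b) has_vector_derivative b) (at 0)"
    by (auto intro!: derivative_eq_intros simp: has_vector_derivative_def)
  ultimately have \<psi>'e: "frechet_derivative \<psi>' (at e0) e = b"
    by (rule vector_derivative_unique_at)
  define \<tau> where "\<tau> x = \<psi>' x \<bullet> b" for x
  have lin_b: "linear (\<lambda>x. x \<bullet> b)" by (simp add: bounded_linear.linear bounded_linear_inner_left)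
  have \<tau>: "C_k_on n Q \<tau>" for n
    unfolding \<tau>_def by (rule C_k_on_linear_compose[OF Q(1) lin_b \<psi>'Q])
  have "(\<tau> has_derivative (\<lambda>v. frechet_derivative \<psi>' (at e0) v \<bullet> b)) (at e0)"
    unfolding \<tau>_def by (rule bounded_linear.has_derivative[OF bounded_linear_inner_left \<psi>'_der])
  then have \<tau>e: "frechet_derivative \<tau> (at e0) e \<noteq> 0"
    using frechet_derivative_at[of \<tau> _ e0] \<psi>'e b by (metis inner_eq_zero_iff)
  have e_nz: "e \<noteq> 0"
    using \<psi>'e b linear_0[OF has_derivative_linear[OF \<psi>'_der]] by metis
  define F where "F = (\<lambda>x. x + (\<tau> x - (x \<bullet> e) / (e \<bullet> e)) *\<^sub>R e)"
  obtain U' V' s where S: "open U'" "U' \<subseteq> Q" "e0 \<in> U'" "open V'" "homeomorphism U' V' F s"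
    "\<And>n. C_k_on n V' s" "\<And>n. C_k_on n Q F"
    using straightening[OF Q(1,2) \<tau> \<tau>e] unfolding F_def by metis
  define E' where "E' = {x \<in> E. x \<bullet> e = 0}"
  have E': "subspace E'" using E(1) by (auto simp: E'_def subspace_def inner_add_left)
  have "dim E' = d - 1"
  proof -
    have "dim {y \<in> E. \<forall>x \<in> span {e}. orthogonal x y} + dim (span {e}) = dim E"
      by (rule dim_subspace_orthogonal_to_vectors) (use E eE in \<open>auto simp: span_minimal\<close>)
    moreover have "{y \<in> E. \<forall>x \<in> span {e}. orthogonal x y} = E'"
      by (auto simp: E'_def span_singleton orthogonal_def inner_commute)
    ultimately show ?thesis using E(2) e_nz by simp
  qed
  have FE: "F x \<in> E" if "x \<in> E" for x
    unfolding F_def using E(1) that eE by (intro subspace_add subspace_scale)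
  \<comment> \<open>For \<open>x \<in> E\<close>, this says that \<open>F x \<in> E'\<close> if and only if \<open>\<tau> x = 0\<close>.\<close>
  have Fe: "F x \<bullet> e = \<tau> x * (e \<bullet> e)" for x
    unfolding F_def using e_nz by (simp add: inner_add_left left_diff_distrib)
  have F_s: "F (s y) = y" "s y \<in> U'" if "y \<in> V'" for y
    using S(5) that by (auto simp: homeomorphism_def)
  have s_F: "s (F x) = x" "F x \<in> V'" if "x \<in> U'" for x
    using S(5) that by (auto simp: homeomorphism_def)
  have sE: "s y \<in> E" if "y \<in> V'" "y \<in> E" for y
  proof -
    have "s y = y - (\<tau> (s y) - (s y \<bullet> e) / (e \<bullet> e)) *\<^sub>R e"
      using F_s(1)[OF that(1)] unfolding F_def by (metis add_diff_cancel_right')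
    then show ?thesis using E(1) that(2) eE by (metis subspace_diff subspace_scale)
  qed
  have \<tau>_eq: "\<tau> x = \<psi> x \<bullet> b" if "x \<in> E \<inter> Q" for x
    using P(4)[OF subsetD[OF Q(3) that]] by (simp add: \<tau>_def)
  define U2 where "U2 = {q \<in> U \<inter> ?V. \<phi> q \<in> U'}"
  define W2 where "W2 = E' \<inter> V'"
  have "openin (top_of_set (L \<inter> ?V)) U2"
  proof -
    have "openin (top_of_set U) (U \<inter> \<phi> -` U')"
      using hom S(1) by (intro continuous_openin_preimage_gen) (auto simp: homeomorphism_def)
    then have "openin (top_of_set L) (U \<inter> \<phi> -` U')" using U(1) openin_trans by blast
    then obtain O2 where "open O2" "U \<inter> \<phi> -` U' = L \<inter> O2" by (auto simp: openin_open)
    moreover from this have "U2 = (L \<inter> ?V) \<inter> O2" by (auto simp: U2_def)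
    ultimately show ?thesis by (auto simp: openin_open)
  qed
  moreover have "p \<in> U2" using U p S(3) by (simp add: U2_def e0_def)
  moreover have "openin (top_of_set E') W2" using S(4) by (auto simp: W2_def openin_open)
  moreover have U2: "\<phi> q \<in> E \<inter> U'" "F (\<phi> q) \<in> W2" if "q \<in> U2" for q
  proof -
    have q: "q \<in> U" "q \<bullet> b = 0" "\<phi> q \<in> U'" using that by (auto simp: U2_def)
    then show 1: "\<phi> q \<in> E \<inter> U'" using \<phi>W W0 by auto
    then have "\<tau> (\<phi> q) = 0" using \<tau>_eq[of "\<phi> q"] S(2) \<psi>\<phi>[OF q(1)] q by auto
    then show "F (\<phi> q) \<in> W2" using FE Fe s_F 1 by (auto simp: W2_def E'_def)
  qed
  have W2: "s y \<in> W" "\<psi> (s y) \<in> U2" if "y \<in> W2" for y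
  proof -
    have y: "y \<in> E" "y \<bullet> e = 0" "y \<in> V'" using that by (auto simp: W2_def E'_def)
    have sy: "s y \<in> E \<inter> Q" using sE y F_s S(2) by blast
    then show "s y \<in> W" using Q(3) by blast
    have "\<tau> (s y) = 0" using Fe[of "s y"] F_s[OF y(3)] y e_nz by auto
    then have "\<psi> (s y) \<bullet> b = 0" using \<tau>_eq[OF sy] by simp
    then show "\<psi> (s y) \<in> U2" using \<psi>U \<phi>\<psi> \<open>s y \<in> W\<close> F_s[OF y(3)] by (simp add: U2_def)
  qed
  have "homeomorphism U2 W2 (F \<circ> \<phi>) (\<psi> \<circ> s)"
  proof (rule homeomorphismI)
    have "continuous_on U2 \<phi>" "continuous_on U' F" "continuous_on W2 s" "continuous_on W \<psi>"
      using hom S(5) by (auto simp: homeomorphism_def U2_def W2_def intro: continuous_on_subset)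
    then show "continuous_on U2 (F \<circ> \<phi>)" "continuous_on W2 (\<psi> \<circ> s)"
      unfolding o_def using U2(1) W2(1)
      by (blast intro: continuous_on_compose2)+
    show "(F \<circ> \<phi>) ` U2 \<subseteq> W2" "(\<psi> \<circ> s) ` W2 \<subseteq> U2" using U2 W2 by auto
    show "(\<psi> \<circ> s) ((F \<circ> \<phi>) q) = q" if "q \<in> U2" for q
      using s_F U2[OF that] \<psi>\<phi> that by (auto simp: U2_def)
    show "(F \<circ> \<phi>) ((\<psi> \<circ> s) y) = y" if "y \<in> W2" for y
      using \<phi>\<psi>[OF W2(1)[OF that]] F_s that by (auto simp: W2_def)
  qed
  moreover have "smooth_on U2 (F \<circ> \<phi>)"
  proof (rule smooth_on_compose)
    show "smooth_on U2 \<phi>" by (rule smooth_on_subset[OF sm(1)]) (auto simp: U2_def)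
    show "smooth_on U' F" by (rule smooth_on_C_k[OF Q(1) S(7,2)])
  qed (use U2 in auto)
  moreover have "smooth_on W2 (\<psi> \<circ> s)"
  proof (rule smooth_on_compose[OF _ sm(2)])
    show "smooth_on W2 s" by (rule smooth_on_C_k[OF S(4,6)]) (simp add: W2_def)
  qed (use W2 in auto)
  ultimately show "\<exists>U (L' :: 'a set) W \<phi> \<psi>. openin (top_of_set (L \<inter> ?V)) U \<and> p \<in> U \<and> subspace L' \<and> dim L' = d - 1 \<and>
      openin (top_of_set L') W \<and> homeomorphism U W \<phi> \<psi> \<and> smooth_on U \<phi> \<and> smooth_on W \<psi>"
    using E' \<open>dim E' = d - 1\<close>
    by (intro exI[of _ U2] exI[of _ E'] exI[of _ W2] exI[of _ "F \<circ> \<phi>"] exI[of _ "\<psi> \<circ> s"]) simp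
qed

text \<open>The leaves of the foliation of the hyperplane \<open>V\<close> are the sections \<open>L \<inter> V\<close>, which are at the
  same time the images of the leaves under the orthogonal projection \<open>\<pi>\<close>. Connectedness and tangent
  fields are transported by \<open>\<pi>\<close>; distances agree because \<open>\<pi>\<close> does not increase distances to points
  of \<open>V\<close>.\<close>

lemma translation_invariant_imp_splits_off:
  fixes \<F> :: "'a::euclidean_space set set"
  assumes fol: "equidistant_foliation UNIV \<F>" and b: "b \<noteq> 0"
    and inv\<F>: "\<And>L q t. L \<in> \<F> \<Longrightarrow> q \<in> L \<Longrightarrow> q + t *\<^sub>R b \<in> L"
  shows "splits_off_Euclidean_factor \<F>"
proof -
  define V where "V = {x. x \<bullet> b = 0}"
  define W where "W = span {b}"
  define \<pi> where "\<pi> x = x - ((x \<bullet> b) / (b \<bullet> b)) *\<^sub>R b" for x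
  have lin: "linear \<pi>"
    unfolding \<pi>_def by (rule linearI) (auto simp: inner_add_left add_divide_distrib algebra_simps)
  have \<pi>V: "\<pi> x \<in> V" for x using b by (simp add: V_def \<pi>_def inner_diff_left)
  have \<pi>id: "\<pi> x = x" if "x \<in> V" for x using that by (simp add: V_def \<pi>_def)
  have \<pi>L: "\<pi> x \<in> L \<inter> V" if "x \<in> L" "L \<in> \<F>" for x L
    using inv\<F>[OF that(2,1), of "- ((x \<bullet> b) / (b \<bullet> b))"] \<pi>V[of x] by (simp add: \<pi>_def)
  have \<pi>image: "\<pi> ` L = L \<inter> V" if "L \<in> \<F>" for L
    using \<pi>L[OF _ that] \<pi>id by force
  note fol_parts = fol[unfolded equidistant_foliation_def]
  have part: "partition_on UNIV \<F>" using fol_parts by (rule conjunct1)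
  have leaf: "foliation_leaf L" if "L \<in> \<F>" for L
    using bspec[OF conjunct1[OF conjunct2[OF fol_parts]] that] .
  have eqd: "infdist p L' = infdist q L'" if "L \<in> \<F>" "L' \<in> \<F>" "p \<in> L" "q \<in> L" for L L' p q
    using bspec[OF bspec[OF bspec[OF bspec[OF conjunct1[OF conjunct2[OF conjunct2[OF fol_parts]]]]]], OF that] .
  have tan: "\<exists>U X. openin (top_of_set UNIV) U \<and> p \<in> U \<and> smooth_on U X \<and> X p = w \<and>
              (\<forall>L'\<in>\<F>. \<forall>q\<in>L' \<inter> U. X q \<in> tangent_space L' q)"
    if "L \<in> \<F>" "p \<in> L" "w \<in> tangent_space L p" for L p w
    using bspec[OF bspec[OF bspec[OF conjunct2[OF conjunct2[OF conjunct2[OF fol_parts]]]]], OF that] .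
  have ne: "L \<noteq> {}" if "L \<in> \<F>" for L using partition_onD3[OF part] that by auto
  have dist_\<pi>: "dist p (\<pi> q) \<le> dist p q" if "p \<in> V" for p q
  proof -
    have "dist p (\<pi> q) = norm (\<pi> (p - q))"
      by (simp add: dist_norm linear_diff[OF lin] \<pi>id[OF that])
    also have "\<dots> \<le> norm (p - q)"
    proof -
      define x where "x = p - q"
      define r where "r = (x \<bullet> b) / (b \<bullet> b)"
      have x: "x = \<pi> x + r *\<^sub>R b" by (simp add: \<pi>_def r_def)
      have "\<pi> x \<bullet> b = 0" using \<pi>V[of x] by (simp add: V_def)
      then have "x \<bullet> x = \<pi> x \<bullet> \<pi> x + (r *\<^sub>R b) \<bullet> (r *\<^sub>R b)"
        by (subst (1 2) x) (simp add: inner_add_left inner_add_right inner_commute)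
      then have "\<pi> x \<bullet> \<pi> x \<le> x \<bullet> x" by (metis inner_ge_zero le_add_same_cancel1)
      then show ?thesis by (simp add: norm_le x_def)
    qed
    finally show ?thesis by (simp add: dist_norm)
  qed
  have infdist_slice: "infdist p (L \<inter> V) = infdist p L" if p: "p \<in> V" and L: "L \<in> \<F>" for p L
  proof (rule antisym)
    show "infdist p L \<le> infdist p (L \<inter> V)"
      by (rule infdist_mono) (use \<pi>image[OF L] ne[OF L] in auto)
    have "infdist p (L \<inter> V) \<le> dist p q" if "q \<in> L" for q
      by (rule infdist_le2[OF \<pi>L[OF that L] dist_\<pi>[OF p]])
    then show "infdist p (L \<inter> V) \<le> infdist p L"
      unfolding infdist_notempty[OF ne[OF L]] by (intro cINF_greatest ne[OF L])
  qed
  have tan_\<pi>: "\<pi> w \<in> tangent_space (L \<inter> V) p" if p: "p \<in> L \<inter> V" and w: "w \<in> tangent_space L p" and L: "L \<in> \<F>" for L p w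
  proof -
    obtain \<gamma> e where \<gamma>: "e > 0" "smooth_on {-e<..<e} \<gamma>" "\<gamma> ` {-e<..<e} \<subseteq> L" "\<gamma> (0::real) = p"
      "(\<gamma> has_vector_derivative w) (at 0)"
      using w unfolding tangent_space_def by blast
    have "smooth_on {-e<..<e} (\<pi> \<circ> \<gamma>)"
      by (rule smooth_on_compose[OF \<gamma>(2) smooth_on_linear[OF lin, of UNIV]]) simp
    moreover have "(\<pi> \<circ> \<gamma>) ` {-e<..<e} \<subseteq> L \<inter> V" using \<gamma>(3) \<pi>L[OF _ L] by auto
    moreover have "((\<pi> \<circ> \<gamma>) has_vector_derivative \<pi> w) (at 0)"
      using bounded_linear.has_vector_derivative[OF _ \<gamma>(5), of \<pi>] lin linear_conv_bounded_linear
      by (auto simp: o_def)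
    moreover have "(\<pi> \<circ> \<gamma>) 0 = p" using \<gamma>(4) \<pi>id p by simp
    ultimately show ?thesis using \<gamma>(1) unfolding tangent_space_def by blast
  qed
  have tan_sub: "w \<in> tangent_space L p \<and> \<pi> w = w" if w: "w \<in> tangent_space (L \<inter> V) p" for L p w
  proof -
    obtain \<gamma> e where \<gamma>: "e > 0" "smooth_on {-e<..<e} \<gamma>" "\<gamma> ` {-e<..<e} \<subseteq> L \<inter> V" "\<gamma> (0::real) = p"
      "(\<gamma> has_vector_derivative w) (at 0)"
      using w unfolding tangent_space_def by blast
    have "subspace V" by (auto simp: V_def subspace_def inner_add_left)
    then have "w \<in> V"
      by (rule derivative_in_subspace[OF _ \<gamma>(5,1)]) (use \<gamma>(3) in \<open>auto simp: image_subset_iff abs_less_iff\<close>)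
    then show ?thesis using \<gamma> \<pi>id unfolding tangent_space_def by blast
  qed
  let ?\<F>' = "(\<lambda>L. L \<inter> V) ` \<F>"
  have "equidistant_foliation V ?\<F>'"
    unfolding equidistant_foliation_def
  proof (intro conjI ballI)
    show "partition_on V ?\<F>'"
    proof (rule partition_onI)
      show "\<Union>?\<F>' = V" using partition_onD1[OF part] by auto
      show "{} \<notin> ?\<F>'" using \<pi>image ne by force
      fix A B assume "A \<in> ?\<F>'" "B \<in> ?\<F>'" "A \<noteq> B"
      then obtain L M where "L \<in> \<F>" "M \<in> \<F>" "A = L \<inter> V" "B = M \<inter> V" "L \<noteq> M" by blast
      then show "disjnt A B"
        using partition_onD2[OF part] by (auto simp: disjnt_def disjoint_def)
    qed
  next
    fix A assume "A \<in> ?\<F>'"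
    then obtain L where L: "L \<in> \<F>" "A = L \<inter> V" by blast
    have leafL: "foliation_leaf L" using leaf[OF L(1)] .
    have "closed V" unfolding V_def by (intro closed_Collect_eq continuous_intros)
    then have closed: "closed A" using leafL L(2) by (auto simp: foliation_leaf_def complete_eq_closed)
    have "continuous_on L \<pi>" by (rule linear_continuous_on) (use lin linear_conv_bounded_linear in blast)
    then have "connected A"
      using connected_continuous_image[of L \<pi>] leafL \<pi>image[OF L(1)] L(2) by (simp add: foliation_leaf_def)
    moreover have "\<exists>d. embedded_submanifold d A"
      using leafL embedded_slice[OF _ b] inv\<F>[OF L(1)] unfolding foliation_leaf_def L(2) V_def by blast
    moreover have "proper_map (top_of_set A) euclidean id"
      using closed by (subst proper_map_inclusion) (auto simp: closed_Int_compact)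
    ultimately show "foliation_leaf A"
      using closed by (simp add: foliation_leaf_def complete_eq_closed)
  next
    fix A B p q assume "A \<in> ?\<F>'" "B \<in> ?\<F>'" and pq: "p \<in> A" "q \<in> A"
    then obtain L M where LM: "L \<in> \<F>" "M \<in> \<F>" "A = L \<inter> V" "B = M \<inter> V" by blast
    then show "infdist p B = infdist q B"
      using infdist_slice[of _ M] eqd[of L M p q] pq by simp
  next
    fix A p w assume "A \<in> ?\<F>'" and p: "p \<in> A" and w: "w \<in> tangent_space A p"
    then obtain L where L: "L \<in> \<F>" "A = L \<inter> V" by blast
    have w': "w \<in> tangent_space L p" "\<pi> w = w" using tan_sub w L(2) by auto
    obtain U X where UX: "openin (top_of_set UNIV) U" "p \<in> U" "smooth_on U X" "X p = w"
              "\<And>L' q. L'\<in>\<F> \<Longrightarrow> q\<in>L' \<inter> U \<Longrightarrow> X q \<in> tangent_space L' q"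
      using tan[OF L(1) _ w'(1)] p L(2) by blast
    show "\<exists>U X. openin (top_of_set V) U \<and> p \<in> U \<and> smooth_on U X \<and> X p = w \<and>
              (\<forall>L'\<in>?\<F>'. \<forall>q\<in>L' \<inter> U. X q \<in> tangent_space L' q)"
    proof (intro exI conjI)
      show "openin (top_of_set V) (V \<inter> U)" using UX(1) by (auto simp: openin_open)
      show "p \<in> V \<inter> U" using UX(2) p L(2) by blast
      have "smooth_on (V \<inter> U) X" by (rule smooth_on_subset[OF UX(3)]) blast
      then show "smooth_on (V \<inter> U) (\<pi> \<circ> X)"
        by (rule smooth_on_compose[OF _ smooth_on_linear[OF lin, of UNIV]]) simp
      show "(\<pi> \<circ> X) p = w" using UX(4) w' by simp
      show "\<forall>L'\<in>?\<F>'. \<forall>q\<in>L' \<inter> (V \<inter> U). (\<pi> \<circ> X) q \<in> tangent_space L' q"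
        using UX(5) tan_\<pi> by auto
    qed
  qed
  moreover have "\<F> = (\<lambda>L. {x + w | x w. x \<in> L \<and> w \<in> W}) ` ?\<F>'"
  proof -
    have "{x + w | x w. x \<in> L \<inter> V \<and> w \<in> W} = L" if L: "L \<in> \<F>" for L
    proof (intro equalityI subsetI)
      fix z assume "z \<in> L"
      then have "z = \<pi> z + ((z \<bullet> b) / (b \<bullet> b)) *\<^sub>R b" "\<pi> z \<in> L \<inter> V" using \<pi>L L by (auto simp: \<pi>_def)
      then show "z \<in> {x + w | x w. x \<in> L \<inter> V \<and> w \<in> W}"
        unfolding W_def by (auto intro: span_base span_scale)
    qed (use inv\<F>[OF L] in \<open>auto simp: W_def span_singleton\<close>)
    then show ?thesis by (simp add: image_image)
  qed
  moreover have "{v + w | v w. v \<in> V \<and> w \<in> W} = UNIV"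
  proof -
    have "z = \<pi> z + ((z \<bullet> b) / (b \<bullet> b)) *\<^sub>R b" for z by (simp add: \<pi>_def)
    then show ?thesis using \<pi>V unfolding W_def by (fastforce intro: span_base span_scale)
  qed
  moreover have "subspace V" "subspace W" by (auto simp: V_def W_def subspace_def[of "{x. x \<bullet> b = 0}"] inner_add_left)
  moreover have "\<forall>v\<in>V. \<forall>w\<in>W. orthogonal v w"
    by (auto simp: V_def W_def span_singleton orthogonal_def)
  moreover have "W \<noteq> {0}" using b unfolding W_def by (metis insertI1 singletonD span_base)
  ultimately show ?thesis unfolding splits_off_Euclidean_factor_def by blast
qed


section \<open>The Banach algebra of endomorphisms and its exponential\<close>

text \<open>A copy of \<open>'a \<Rightarrow>\<^sub>L 'a\<close> on which composition can be declared as the multiplication of a Banach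
  algebra, so that \<open>exp\<close> and its theory become available.\<close>

typedef (overloaded) 'a endo = "UNIV :: ('a::euclidean_space \<Rightarrow>\<^sub>L 'a) set"
  morphisms rep_endo Endo ..

setup_lifting type_definition_endo

lift_definition app :: "'a::euclidean_space endo \<Rightarrow> 'a \<Rightarrow> 'a" is blinfun_apply .

instantiation endo :: (euclidean_space) real_normed_algebra_1
begin

lift_definition zero_endo :: "'a endo" is 0 .
lift_definition one_endo :: "'a endo" is id_blinfun .
lift_definition plus_endo :: "'a endo \<Rightarrow> 'a endo \<Rightarrow> 'a endo" is "(+)" .
lift_definition minus_endo :: "'a endo \<Rightarrow> 'a endo \<Rightarrow> 'a endo" is "(-)" .
lift_definition uminus_endo :: "'a endo \<Rightarrow> 'a endo" is "uminus" .
lift_definition times_endo :: "'a endo \<Rightarrow> 'a endo \<Rightarrow> 'a endo" is "(o\<^sub>L)" .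
lift_definition scaleR_endo :: "real \<Rightarrow> 'a endo \<Rightarrow> 'a endo" is "(*\<^sub>R)" .
lift_definition norm_endo :: "'a endo \<Rightarrow> real" is norm .

definition dist_endo :: "'a endo \<Rightarrow> 'a endo \<Rightarrow> real"
  where "dist_endo f g = norm (f - g)"
definition sgn_endo :: "'a endo \<Rightarrow> 'a endo"
  where "sgn_endo f = scaleR (inverse (norm f)) f"
definition [code del]:
  "(uniformity :: ('a endo \<times> 'a endo) filter) = (INF e\<in>{0<..}. principal {(x, y). dist x y < e})"
definition open_endo :: "'a endo set \<Rightarrow> bool"
  where [code del]:
    "open_endo S = (\<forall>x\<in>S. \<forall>\<^sub>F (x', y) in uniformity. x' = x \<longrightarrow> y \<in> S)"

instance
proof
  fix f g h :: "'a endo" and a b :: real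
  show "f * g * h = f * (g * h)"
    by transfer (rule blinfun_eqI, simp)
  show "1 * f = f" "f * 1 = f"
    by (transfer, rule blinfun_eqI, simp)+
  show "(f + g) * h = f * h + g * h" "f * (g + h) = f * g + f * h"
    by (transfer, rule blinfun_eqI, simp add: blinfun.bilinear_simps)+
  show "a *\<^sub>R f * g = a *\<^sub>R (f * g)" "f * a *\<^sub>R g = a *\<^sub>R (f * g)"
    by (transfer, rule blinfun_eqI, simp add: blinfun.bilinear_simps)+
  show "norm (f * g) \<le> norm f * norm g"
    by transfer (rule norm_blinfun_compose)
  show "norm (1 :: 'a endo) = 1"
    by transfer (rule norm_blinfun_id)
  show "(0 :: 'a endo) \<noteq> 1"
    by transfer (metis norm_blinfun_id norm_zero zero_neq_one)
  show "norm (a *\<^sub>R f) = \<bar>a\<bar> * norm f" by transfer simp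
  show "norm (f + g) \<le> norm f + norm g" by transfer (rule norm_triangle_ineq)
  show "norm f = 0 \<longleftrightarrow> f = 0" by transfer simp
qed (simp_all only: dist_endo_def sgn_endo_def uniformity_endo_def open_endo_def,
     (transfer, simp add: algebra_simps)+)

end

lemma norm_app_le: "norm (app f x) \<le> norm f * norm x"
  by transfer (rule norm_blinfun)

instance endo :: (euclidean_space) banach
proof
  fix X :: "nat \<Rightarrow> 'a endo"
  assume X: "Cauchy X"
  have norm_rep: "norm (rep_endo (f - g)) = norm (f - g)" "rep_endo (f - g) = rep_endo f - rep_endo g"
    for f g :: "'a endo"
    by (transfer, simp)+
  have "Cauchy (\<lambda>n. rep_endo (X n))"
    using X unfolding Cauchy_def dist_norm by (simp flip: norm_rep)
  then obtain L where L: "(\<lambda>n. rep_endo (X n)) \<longlonglongrightarrow> L"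
    using convergent_def real_Cauchy_convergent Cauchy_convergent_iff by blast
  have "X \<longlonglongrightarrow> Endo L"
    using L unfolding LIMSEQ_def dist_norm by (simp add: norm_rep(2) Endo_inverse flip: norm_rep(1))
  then show "convergent X"
    by (rule convergentI)
qed

lemma app_linear [simp]:
  "app 0 x = 0" "app 1 x = x" "app (f * g) x = app f (app g x)"
  "app (f + g) x = app f x + app g x" "app (f - g) x = app f x - app g x"
  "app (r *\<^sub>R f) x = r *\<^sub>R app f x"
  by (transfer, simp add: blinfun.bilinear_simps)+

lemma bounded_linear_app: "bounded_linear (\<lambda>f. app f x)"
  by (rule bounded_linear_intro[where K="norm x"]) (auto simp: norm_app_le)

lemma endo_eqI: "(\<And>x. app f x = app g x) \<Longrightarrow> f = g"
  by transfer (rule blinfun_eqI)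

lemma app_Endo: "linear h \<Longrightarrow> app (Endo (Blinfun h)) x = h x"
  by (simp add: app.abs_eq bounded_linear_Blinfun_apply linear_conv_bounded_linear)

lemma norm_power_diff_le:
  fixes a b :: "'a::real_normed_algebra_1"
  assumes "norm a \<le> M" "norm b \<le> M" "1 \<le> M"
  shows "norm (a ^ k - b ^ k) \<le> real k * M ^ k * norm (a - b)"
proof (induction k)
  case (Suc k)
  have M: "norm (b ^ k) \<le> M ^ k"
    using assms by (meson norm_power_ineq order_trans power_mono norm_ge_zero)
  have "a ^ Suc k - b ^ Suc k = a * (a ^ k - b ^ k) + (a - b) * b ^ k"
    by (simp add: algebra_simps)
  also have "norm \<dots> \<le> norm a * norm (a ^ k - b ^ k) + norm (a - b) * norm (b ^ k)"
    by (meson add_mono norm_mult_ineq norm_triangle_ineq order_trans)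
  also have "\<dots> \<le> M * (real k * M ^ k * norm (a - b)) + norm (a - b) * (M * M ^ k)"
  proof (intro add_mono mult_mono Suc)
    show "norm (b ^ k) \<le> M * M ^ k"
      using M power_increasing[of k "Suc k" M] assms(3) by (metis order_trans lessI less_imp_le power_Suc)
  qed (use assms in auto)
  also have "\<dots> = real (Suc k) * M ^ Suc k * norm (a - b)"
    by (simp add: algebra_simps)
  finally show ?case .
qed simp

lemma norm_exp_minus_linear_le:
  fixes x :: "'a::{real_normed_algebra_1,banach}"
  shows "norm (exp x - 1 - x) \<le> (norm x)\<^sup>2 * exp (norm x)"
proof -
  have *: "exp x - 1 - x = (\<Sum>n. inverse (fact (n + 2)) *\<^sub>R (x ^ (n + 2)))"
    using exp_first_two_terms[of x] by simp
  have le: "norm (inverse (fact (n + 2)) *\<^sub>R (x ^ (n + 2))) \<le> (norm x)\<^sup>2 * (norm x ^ n /\<^sub>R fact n)" for n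
  proof -
    have "norm (x ^ (n + 2)) \<le> (norm x)\<^sup>2 * norm x ^ n"
      using norm_power_ineq[of x "n + 2"] by (simp only: power_add mult.commute)
    moreover have "inverse (fact (n + 2)) \<le> inverse (fact n :: real)"
      by (intro le_imp_inverse_le fact_mono) auto
    ultimately have "inverse (fact (n + 2)) * norm (x ^ (n + 2)) \<le> inverse (fact n) * ((norm x)\<^sup>2 * norm x ^ n)"
      by (intro mult_mono) auto
    then show ?thesis by (simp add: mult_ac)
  qed
  have sm: "(\<lambda>n. (norm x)\<^sup>2 * (norm x ^ n /\<^sub>R fact n)) sums ((norm x)\<^sup>2 * exp (norm x))"
    by (intro sums_mult exp_converges)
  show ?thesis
    unfolding * using norm_suminf_le[OF le sums_summable[OF sm]] sums_unique[OF sm] by simp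
qed

lemma exp_scaleR_of_nat:
  fixes x :: "'a::{real_normed_algebra_1,banach}"
  shows "exp (real k *\<^sub>R x) = exp x ^ k"
proof (induction k)
  case (Suc k)
  have "exp (real (Suc k) *\<^sub>R x) = exp (x + real k *\<^sub>R x)"
    by (simp add: algebra_simps)
  also have "\<dots> = exp x * exp (real k *\<^sub>R x)"
    by (rule exp_add_commuting) simp
  finally show ?case
    using Suc by simp
qed simp

text \<open>Compare \<open>1 + s\<^sub>j X\<^sub>j\<close> with \<open>exp (s\<^sub>j L)\<close>: they differ by \<open>o(s\<^sub>j)\<close>, and both have norm at most
  \<open>exp (s\<^sub>j C)\<close>, so the \<open>k\<^sub>j\<close>-th powers differ by at most \<open>k\<^sub>j o(s\<^sub>j) exp (k\<^sub>j s\<^sub>j C)\<close>, which tends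
  to \<open>0\<close>.\<close>

lemma power_tendsto_exp:
  fixes X :: "nat \<Rightarrow> 'a::{real_normed_algebra_1,banach}"
  assumes X: "X \<longlonglongrightarrow> L" and s: "s \<longlonglongrightarrow> 0" "\<And>j. s j > 0"
    and k: "(\<lambda>j. real (k j) * s j) \<longlonglongrightarrow> t"
  shows "(\<lambda>j. (1 + s j *\<^sub>R X j) ^ k j) \<longlonglongrightarrow> exp (t *\<^sub>R L)"
proof -
  obtain C0 where C0: "\<And>j. norm (X j) \<le> C0"
    using convergent_imp_Bseq[OF convergentI[OF X]] by (auto simp: Bseq_def)
  define C where "C = max C0 (norm L)"
  have C: "norm (X j) \<le> C" "norm L \<le> C" for j
    using C0[of j] by (auto simp: C_def)
  have C_nonneg: "0 \<le> C" using C(2) norm_ge_zero order_trans by blast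
  define M where "M j = exp (s j * C)" for j
  have M1: "1 \<le> M j" for j
    using C_nonneg s(2)[of j] by (simp add: M_def)
  have n1: "norm (1 + s j *\<^sub>R X j) \<le> M j" for j
  proof -
    have "norm (1 + s j *\<^sub>R X j) \<le> 1 + s j * norm (X j)"
      using norm_triangle_ineq[of 1 "s j *\<^sub>R X j"] s(2)[of j] by simp
    also have "\<dots> \<le> 1 + s j * C" using C(1)[of j] s(2)[of j] by simp
    also have "\<dots> \<le> M j" unfolding M_def by (rule exp_ge_add_one_self)
    finally show ?thesis .
  qed
  have n2: "norm (exp (s j *\<^sub>R L)) \<le> M j" for j
  proof -
    have "norm (exp (s j *\<^sub>R L)) \<le> exp (norm (s j *\<^sub>R L))" by (rule norm_exp)
    also have "\<dots> \<le> M j" using C(2) s(2)[of j] by (simp add: M_def)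
    finally show ?thesis .
  qed
  have lim0: "(\<lambda>j. (exp (s j *\<^sub>R L) - 1) /\<^sub>R s j) \<longlonglongrightarrow> L"
  proof (rule Lim_transform)
    have le: "norm ((exp (s j *\<^sub>R L) - 1) /\<^sub>R s j - L) \<le> s j * (norm L)\<^sup>2 * exp (s j * norm L)" for j
    proof -
      have "s j *\<^sub>R ((exp (s j *\<^sub>R L) - 1) /\<^sub>R s j - L) = exp (s j *\<^sub>R L) - 1 - s j *\<^sub>R L"
        using s(2)[of j] by (simp add: scaleR_diff_right)
      then have "s j * norm ((exp (s j *\<^sub>R L) - 1) /\<^sub>R s j - L) \<le> s j * (s j * (norm L)\<^sup>2 * exp (s j * norm L))"
        using norm_exp_minus_linear_le[of "s j *\<^sub>R L"] s(2)[of j]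
        by (metis (no_types, lifting) abs_of_pos mult.assoc norm_scaleR power2_eq_square power_mult_distrib)
      then show ?thesis using s(2)[of j] by simp
    qed
    have "(\<lambda>j. s j * (norm L)\<^sup>2 * exp (s j * norm L)) \<longlonglongrightarrow> 0 * (norm L)\<^sup>2 * exp (0 * norm L)"
      by (intro tendsto_intros s)
    then have 0: "(\<lambda>j. s j * (norm L)\<^sup>2 * exp (s j * norm L)) \<longlonglongrightarrow> 0" by simp
    show "(\<lambda>j. (exp (s j *\<^sub>R L) - 1) /\<^sub>R s j - L) \<longlonglongrightarrow> 0"
      by (rule Lim_null_comparison[OF always_eventually 0]) (use le in auto)
  qed simp
  have "(\<lambda>j. (real (k j) * s j) * exp ((real (k j) * s j) * C) * norm (X j - (exp (s j *\<^sub>R L) - 1) /\<^sub>R s j))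
     \<longlonglongrightarrow> t * exp (t * C) * norm (L - L)"
    by (intro tendsto_intros k X lim0)
  then have lim1: "(\<lambda>j. (real (k j) * s j) * exp ((real (k j) * s j) * C) * norm (X j - (exp (s j *\<^sub>R L) - 1) /\<^sub>R s j))
     \<longlonglongrightarrow> 0" by simp
  have diff: "norm ((1 + s j *\<^sub>R X j) ^ k j - exp ((real (k j) * s j) *\<^sub>R L)) \<le>
    (real (k j) * s j) * exp ((real (k j) * s j) * C) * norm (X j - (exp (s j *\<^sub>R L) - 1) /\<^sub>R s j)" for j
  proof -
    have e: "exp ((real (k j) * s j) *\<^sub>R L) = exp (s j *\<^sub>R L) ^ k j"
      using exp_scaleR_of_nat[of "k j" "s j *\<^sub>R L"] by simp
    have M: "M j ^ k j = exp ((real (k j) * s j) * C)"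
      by (simp add: M_def mult.assoc flip: exp_of_nat_mult)
    have "1 + s j *\<^sub>R X j - exp (s j *\<^sub>R L) = s j *\<^sub>R (X j - (exp (s j *\<^sub>R L) - 1) /\<^sub>R s j)"
      using s(2)[of j] by (simp add: scaleR_diff_right)
    then have "norm (1 + s j *\<^sub>R X j - exp (s j *\<^sub>R L)) = s j * norm (X j - (exp (s j *\<^sub>R L) - 1) /\<^sub>R s j)"
      using s(2)[of j] by simp
    then show ?thesis
      using norm_power_diff_le[OF n1[of j] n2[of j] M1[of j], of "k j"] unfolding e M by (simp add: mult_ac)
  qed
  have "(\<lambda>j. (1 + s j *\<^sub>R X j) ^ k j - exp ((real (k j) * s j) *\<^sub>R L)) \<longlonglongrightarrow> 0"
    by (rule Lim_null_comparison[OF always_eventually lim1]) (use diff in auto)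
  moreover have "(\<lambda>j. exp ((real (k j) * s j) *\<^sub>R L)) \<longlonglongrightarrow> exp (t *\<^sub>R L)"
  proof (rule isCont_tendsto_compose[OF _ k])
    show "isCont (\<lambda>t. exp (t *\<^sub>R L)) t"
      using exp_scaleR_has_vector_derivative_right[of L t UNIV] has_vector_derivative_continuous by blast
  qed
  ultimately have "(\<lambda>j. ((1 + s j *\<^sub>R X j) ^ k j - exp ((real (k j) * s j) *\<^sub>R L)) + exp ((real (k j) * s j) *\<^sub>R L)) \<longlonglongrightarrow> 0 + exp (t *\<^sub>R L)"
    by (rule tendsto_add)
  then show ?thesis by simp
qed

lemma app_zero [simp]: "app f 0 = 0"
  by transfer (rule blinfun.zero_right)

lemma app_exp_fixed:
  assumes "app A w = 0"
  shows "app (exp (t *\<^sub>R A)) w = w"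
proof -
  have "((\<lambda>t. app (exp (t *\<^sub>R A)) w) has_vector_derivative 0) (at t)" for t
    using bounded_linear.has_vector_derivative[OF bounded_linear_app
        exp_scaleR_has_vector_derivative_right[of A t UNIV], of w] assms
    by simp
  then have "app (exp (t *\<^sub>R A)) w = app (exp (0 *\<^sub>R A)) w"
    by (intro has_derivative_zero_unique[of UNIV "\<lambda>t. app (exp (t *\<^sub>R A)) w"])
       (auto simp: has_vector_derivative_def)
  then show ?thesis by simp
qed

text \<open>If \<open>A\<close> is nilpotent of order two on \<open>v\<close>, then \<open>v\<close> moves uniformly along a line. In homogeneous
  coordinates this computes the flow of a field at a point where it does not turn.\<close>

lemma app_exp_line:
  assumes "app A v = w" "app A w = 0"
  shows "app (exp (t *\<^sub>R A)) v = v + t *\<^sub>R w"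
proof -
  have "((\<lambda>t. app (exp (t *\<^sub>R A)) v - t *\<^sub>R w) has_vector_derivative 0) (at t)" for t
    using has_vector_derivative_diff[OF bounded_linear.has_vector_derivative[OF bounded_linear_app
        exp_scaleR_has_vector_derivative_right[of A t UNIV], of v]
        bounded_linear.has_vector_derivative[OF bounded_linear_scaleR_left has_vector_derivative_id, of w]]
      app_exp_fixed[OF assms(2), of t] assms(1)
    by simp
  then have "app (exp (t *\<^sub>R A)) v - t *\<^sub>R w = app (exp (0 *\<^sub>R A)) v - 0 *\<^sub>R w"
    by (intro has_derivative_zero_unique[of UNIV "\<lambda>t. app (exp (t *\<^sub>R A)) v - t *\<^sub>R w"])
       (auto simp: has_vector_derivative_def)
  then show ?thesis by (simp add: algebra_simps)
qed

lemma exp_commute: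
  fixes a b :: "'a::{real_normed_algebra_1,banach}"
  assumes "a * b = b * a"
  shows "a * exp b = exp b * a"
proof -
  have "a * b ^ n = b ^ n * a" for n
    by (induction n) (simp_all add: assms flip: mult.assoc, simp add: assms mult.assoc)
  then show ?thesis
    unfolding exp_def by (simp add: suminf_mult[symmetric] suminf_mult2 summable_exp_generic)
qed

lemma exp_linear_has_derivative:
  fixes Z :: "'a::real_normed_vector \<Rightarrow> 'b::{real_normed_algebra_1,banach}"
  assumes Z: "bounded_linear Z" and comm: "\<And>v w. Z v * Z w = Z w * Z v"
  shows "((\<lambda>v. exp (Z v)) has_derivative (\<lambda>h. exp (Z v) * Z h)) (at v)"
proof -
  interpret Z: bounded_linear Z by fact
  obtain K where K: "K > 0" "\<And>x. norm (Z x) \<le> norm x * K" using Z.pos_bounded by blast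
  have "((\<lambda>h. norm (exp (Z h) - 1 - Z h) / norm h) \<longlongrightarrow> 0) (at 0)"
  proof (rule Lim_null_comparison)
    show "\<forall>\<^sub>F h in at 0. norm (norm (exp (Z h) - 1 - Z h) / norm h) \<le> norm h * K\<^sup>2 * exp (norm h * K)"
    proof (rule always_eventually, rule allI)
      fix h
      have "norm (exp (Z h) - 1 - Z h) \<le> (norm (Z h))\<^sup>2 * exp (norm (Z h))"
        by (rule norm_exp_minus_linear_le)
      also have "\<dots> \<le> (norm h * K)\<^sup>2 * exp (norm h * K)"
        using K(2)[of h] by (intro mult_mono power_mono) auto
      finally show "norm (norm (exp (Z h) - 1 - Z h) / norm h) \<le> norm h * K\<^sup>2 * exp (norm h * K)"
        by (cases "h = 0") (simp_all add: divide_simps power_mult_distrib power2_eq_square mult_ac)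
    qed
    have "((\<lambda>h::'a. norm h * K\<^sup>2 * exp (norm h * K)) \<longlongrightarrow> norm (0::'a) * K\<^sup>2 * exp (norm (0::'a) * K)) (at 0)"
      by (intro tendsto_intros)
    then show "((\<lambda>h::'a. norm h * K\<^sup>2 * exp (norm h * K)) \<longlongrightarrow> 0) (at 0)" by simp
  qed
  then have 0: "((\<lambda>h. exp (Z h)) has_derivative Z) (at 0)"
    by (simp add: has_derivative_at Z Z.zero)
  have "((\<lambda>w. w - v) has_derivative (\<lambda>h. h)) (at v)"
    by (auto intro!: derivative_eq_intros)
  from has_derivative_compose[OF this, of "\<lambda>h. exp (Z h)" Z]
  have "((\<lambda>w. exp (Z (w - v))) has_derivative Z) (at v)" using 0 by simp
  from bounded_linear.has_derivative[OF bounded_linear_mult_right this, of "exp (Z v)"]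
  have "((\<lambda>w. exp (Z v) * exp (Z (w - v))) has_derivative (\<lambda>h. exp (Z v) * Z h)) (at v)" .
  moreover have "exp (Z v) * exp (Z (w - v)) = exp (Z w)" for w
    using exp_add_commuting[OF comm, of v "w - v"] by (simp flip: Z.add)
  ultimately show ?thesis by simp
qed


section \<open>Motions in homogeneous coordinates\<close>

lemma tendsto_matrix_mult [tendsto_intros]:
  fixes A :: "'a \<Rightarrow> real^'m^'n"
  assumes "(A \<longlongrightarrow> A') F" "(B \<longlongrightarrow> B') F"
  shows "((\<lambda>x. A x ** B x) \<longlongrightarrow> A' ** B') F"
  unfolding matrix_matrix_mult_def by (intro tendsto_intros assms)

lemma tendsto_matrix_vector_mult [tendsto_intros]:
  fixes A :: "'a \<Rightarrow> real^'m^'n"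
  assumes "(A \<longlongrightarrow> A') F" "(x \<longlongrightarrow> x') F"
  shows "((\<lambda>i. A i *v x i) \<longlongrightarrow> A' *v x') F"
  unfolding matrix_vector_mult_def by (intro tendsto_intros assms)

text \<open>Homogeneous coordinates: the motion \<open>z \<mapsto> A z + a\<close> becomes the linear map
  \<open>(x, t) \<mapsto> (A x + t a, t)\<close>, called \<open>emb (A, a)\<close>, so that composition of motions is multiplication of
  endomorphisms. A tangent vector \<open>(Y, b)\<close> becomes \<open>tang (Y, b)\<close>, and \<open>untang\<close> is a left inverse of
  \<open>tang\<close> that reads off the coefficients.\<close>

definition tang :: "'m::finite motion \<Rightarrow> ((real^'m) \<times> real) endo" where
  "tang X = Endo (Blinfun (\<lambda>(x, t). (fst X *v x + t *\<^sub>R snd X, 0)))"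

definition emb :: "'m::finite motion \<Rightarrow> ((real^'m) \<times> real) endo" where
  "emb g = 1 + tang (g - (mat 1, 0))"

definition untang :: "((real^'m::finite) \<times> real) endo \<Rightarrow> 'm motion" where
  "untang f = ((\<Sum>i\<in>UNIV. \<Sum>j\<in>UNIV. (fst (app f (axis j 1, 0)) $ i) *\<^sub>R axis i (axis j 1)), fst (app f (0, 1)))"

lemma app_tang [simp]: "app (tang X) z = (fst X *v fst z + snd z *\<^sub>R snd X, 0)"
proof -
  have "linear (\<lambda>(x, t). (fst X *v x + t *\<^sub>R snd X, 0::real))"
    by (rule linearI)
       (auto simp: matrix_vector_right_distrib matrix_vector_mult_scaleR algebra_simps)
  then show ?thesis
    by (simp add: tang_def app_Endo split_beta)
qed

lemma app_emb [simp]: "app (emb g) z = (fst g *v fst z + snd z *\<^sub>R snd g, snd z)"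
  by (simp add: emb_def matrix_vector_mult_diff_rdistrib prod_eq_iff)

lemma linear_tang: "linear tang"
  by (rule linearI; rule endo_eqI)
     (auto simp: matrix_vector_mult_add_rdistrib scaleR_matrix_vector_assoc algebra_simps)

lemmas tang_simps = linear_add[OF linear_tang] linear_diff[OF linear_tang] linear_scale[OF linear_tang] linear_0[OF linear_tang]

lemma bounded_linear_tang: "bounded_linear tang"
  using linear_tang linear_conv_bounded_linear by blast

lemma bounded_linear_untang: "bounded_linear untang"
  unfolding untang_def
  by (intro bounded_linear_Pair bounded_linear_sum bounded_linear_scaleR_const
      bounded_linear_compose[OF bounded_linear_vec_nth] bounded_linear_compose[OF bounded_linear_fst] bounded_linear_app)

lemma untang_tang [simp]: "untang (tang X) = X"
proof -
  define c where "c i j = fst X $ i $ j" for i j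
  have c: "fst (app (tang X) (axis j 1, 0)) $ i = c i j" for i j
    by (simp add: c_def matrix_vector_mult_basis column_def)
  have 1: "(c i j *\<^sub>R axis i (axis j 1)) $ a $ b = (if j = b then (if i = a then c i j else 0) else 0)" for i j a b
    by (simp add: axis_def)
  have "(\<Sum>i\<in>UNIV. \<Sum>j\<in>UNIV. c i j *\<^sub>R axis i (axis j 1)) $ a $ b = c a b" for a b
    unfolding sum_component 1 by simp
  then have "(\<Sum>i\<in>UNIV. \<Sum>j\<in>UNIV. c i j *\<^sub>R axis i (axis j 1)) = fst X"
    by (simp add: vec_eq_iff c_def)
  then show ?thesis
    unfolding untang_def c by (simp add: prod_eq_iff)
qed

lemma emb_untang: "g = (mat 1, 0) + untang (emb g - 1)"
  by (simp add: emb_def)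

lemma emb_inject [simp]: "emb g = emb h \<longleftrightarrow> g = h"
  using emb_untang by metis

lemma emb_one [simp]: "emb (mat 1, 0) = 1"
  by (simp add: emb_def tang_simps)

lemma tendsto_emb [tendsto_intros]: "(f \<longlongrightarrow> g) F \<Longrightarrow> ((\<lambda>x. emb (f x)) \<longlongrightarrow> emb g) F"
  unfolding emb_def by (intro tendsto_intros bounded_linear.tendsto[OF bounded_linear_tang])

lemma Isom_mult: "g \<otimes>\<^bsub>Isom\<^esub> h = (fst g ** fst h, fst g *v snd h + snd g)"
  by (cases g; cases h) (simp add: Isom_def)

lemma Isom_one [simp]: "\<one>\<^bsub>Isom\<^esub> = (mat 1, 0)"
  by (simp add: Isom_def)

lemma emb_mult: "emb (g \<otimes>\<^bsub>Isom\<^esub> h) = emb g * emb h"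
  by (rule endo_eqI) (simp add: Isom_mult matrix_vector_mul_assoc matrix_vector_right_distrib
      matrix_vector_mult_scaleR algebra_simps)

lemma act_eq: "act g z = fst g *v z + snd g"
  by (cases g) simp

lemma carrier_Isom: "g \<in> carrier Isom \<longleftrightarrow> orthogonal_matrix (fst g)"
  by (cases g) (simp add: Isom_def)

lemma group_Isom: "group (Isom :: 'm::finite motion monoid)"
proof (rule groupI)
  fix x y z :: "'m motion"
  show "x \<otimes>\<^bsub>Isom\<^esub> y \<otimes>\<^bsub>Isom\<^esub> z = x \<otimes>\<^bsub>Isom\<^esub> (y \<otimes>\<^bsub>Isom\<^esub> z)"
    by (simp add: emb_mult mult.assoc flip: emb_inject)
  show "\<one>\<^bsub>Isom\<^esub> \<otimes>\<^bsub>Isom\<^esub> x = x"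
    by (simp add: emb_mult flip: emb_inject)
  assume x: "x \<in> carrier Isom"
  then have "(transpose (fst x), - (transpose (fst x) *v snd x)) \<otimes>\<^bsub>Isom\<^esub> x = \<one>\<^bsub>Isom\<^esub>"
    by (simp add: carrier_Isom Isom_mult orthogonal_matrix)
  with x show "\<exists>y\<in>carrier Isom. y \<otimes>\<^bsub>Isom\<^esub> x = \<one>\<^bsub>Isom\<^esub>"
    by (auto simp: carrier_Isom intro!: bexI[of _ "(transpose (fst x), - (transpose (fst x) *v snd x))"])
  assume "y \<in> carrier Isom"
  with x show "x \<otimes>\<^bsub>Isom\<^esub> y \<in> carrier Isom"
    by (simp add: carrier_Isom Isom_mult orthogonal_matrix_mul)
qed (simp add: carrier_Isom orthogonal_matrix_id)

lemma inv_Isom: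
  assumes "g \<in> carrier Isom"
  shows "inv\<^bsub>Isom\<^esub> g = (transpose (fst g), - (transpose (fst g) *v snd g))"
proof -
  have "(transpose (fst g), - (transpose (fst g) *v snd g)) \<otimes>\<^bsub>Isom\<^esub> g = \<one>\<^bsub>Isom\<^esub>"
    using assms by (simp add: carrier_Isom Isom_mult orthogonal_matrix)
  then show ?thesis
    using assms by (intro group.inv_equality[OF group_Isom]) (auto simp: carrier_Isom)
qed

lemma emb_inv:
  assumes "g \<in> carrier Isom"
  shows "emb (inv\<^bsub>Isom\<^esub> g) * emb g = 1" "emb g * emb (inv\<^bsub>Isom\<^esub> g) = 1"
  using assms group.l_inv[OF group_Isom assms] group.r_inv[OF group_Isom assms]
  by (simp_all flip: emb_mult)

lemma emb_power:
  assumes "subgroup H Isom" "g \<in> H"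
  shows "\<exists>h\<in>H. emb h = emb g ^ k"
proof (induction k)
  case 0
  show ?case using subgroup.one_closed[OF assms(1)] by (intro bexI[of _ "(mat 1, 0)"]) auto
next
  case (Suc k)
  then show ?case
    using subgroup.m_closed[OF assms(1,2)] by (metis emb_mult power_Suc)
qed

lemma emb_closed:
  assumes "closed H" "\<And>j::nat. g j \<in> H" "(\<lambda>j. emb (g j)) \<longlonglongrightarrow> Z"
  shows "\<exists>h\<in>H. emb h = Z"
proof -
  let ?h = "(mat 1, 0) + untang (Z - 1)"
  have "(\<lambda>j. (mat 1, 0) + untang (emb (g j) - 1)) \<longlonglongrightarrow> ?h"
    by (intro tendsto_intros bounded_linear.tendsto[OF bounded_linear_untang] assms)
  then have lim: "g \<longlonglongrightarrow> ?h"
    by (simp flip: emb_untang)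
  then have "?h \<in> H"
    using assms(1,2) closed_sequentially by blast
  moreover have "emb ?h = Z"
    using tendsto_emb[OF lim] assms(3) LIMSEQ_unique by blast
  ultimately show ?thesis by blast
qed

section \<open>The Lie algebra of a closed group of motions\<close>

text \<open>The velocities of the one-parameter groups contained in \<open>H\<close>.\<close>

definition lie :: "'m::finite motion set \<Rightarrow> 'm motion set" where
  "lie H = {X. \<forall>t. \<exists>g\<in>H. emb g = exp (t *\<^sub>R tang X)}"

text \<open>For \<open>t \<ge> 0\<close> the elements \<open>g\<^sub>j ^ \<lfloor>t / s\<^sub>j\<rfloor>\<close> of \<open>H\<close> converge to \<open>exp (t X)\<close>; negative \<open>t\<close> are
  reached by inversion.\<close>

lemma lie_of_sequence:
  assumes H: "subgroup H Isom" "closed H"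
    and g: "\<And>j::nat. g j \<in> H" and s: "\<And>j. s j > 0" "s \<longlonglongrightarrow> 0"
    and X: "(\<lambda>j. (g j - (mat 1, 0)) /\<^sub>R s j) \<longlonglongrightarrow> X"
  shows "X \<in> lie H"
proof -
  have pos: "\<exists>g\<in>H. emb g = exp (t *\<^sub>R tang X)" if "t \<ge> 0" for t
  proof -
    define k where "k j = nat \<lfloor>t / s j\<rfloor>" for j
    have k: "\<bar>real (k j) * s j - t\<bar> \<le> s j" for j
    proof -
      have "0 \<le> t / s j" using that s(1)[of j] by simp
      then have "real (k j) \<le> t / s j" "t / s j < real (k j) + 1"
        unfolding k_def by linarith+
      then have "real (k j) * s j \<le> t" "t < (real (k j) + 1) * s j"
        using s(1)[of j] by (simp_all add: pos_le_divide_eq pos_divide_less_eq)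
      then show ?thesis by (simp add: algebra_simps)
    qed
    have kt: "(\<lambda>j. real (k j) * s j) \<longlonglongrightarrow> t"
      by (rule Lim_transform[OF tendsto_const])
         (rule Lim_null_comparison[OF always_eventually s(2)], use k in auto)
    have "(\<lambda>j. (1 + s j *\<^sub>R tang ((g j - (mat 1, 0)) /\<^sub>R s j)) ^ k j) \<longlonglongrightarrow> exp (t *\<^sub>R tang X)"
      by (intro power_tendsto_exp bounded_linear.tendsto[OF bounded_linear_tang] X s kt)
    moreover have "1 + s j *\<^sub>R tang ((g j - (mat 1, 0)) /\<^sub>R s j) = emb (g j)" for j
      using s(1)[of j] by (simp add: emb_def flip: tang_simps)
    ultimately have lim: "(\<lambda>j. emb (g j) ^ k j) \<longlonglongrightarrow> exp (t *\<^sub>R tang X)" by simp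
    have "\<forall>j. \<exists>h. h \<in> H \<and> emb h = emb (g j) ^ k j"
      using emb_power[OF H(1) g] by blast
    then obtain h where h: "\<And>j. h j \<in> H \<and> emb (h j) = emb (g j) ^ k j"
      by metis
    then have "(\<lambda>j. emb (h j)) \<longlonglongrightarrow> exp (t *\<^sub>R tang X)" using lim by simp
    then show ?thesis using emb_closed[OF H(2)] h by blast
  qed
  have "\<exists>g\<in>H. emb g = exp (t *\<^sub>R tang X)" if t: "t < 0" for t
  proof -
    obtain h where h: "h \<in> H" "emb h = exp (- t *\<^sub>R tang X)" using pos[of "-t"] t by auto
    have hI: "h \<in> carrier Isom" using h H subgroup.subset by blast
    have "emb (inv\<^bsub>Isom\<^esub> h) = emb (inv\<^bsub>Isom\<^esub> h) * (emb h * exp (t *\<^sub>R tang X))"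
      using exp_minus_inverse[of "- t *\<^sub>R tang X"] h by simp
    also have "\<dots> = exp (t *\<^sub>R tang X)"
      using emb_inv(1)[OF hI] by (simp flip: mult.assoc)
    finally show ?thesis using subgroup.m_inv_closed[OF H(1) h(1)] by blast
  qed
  then have "\<exists>g\<in>H. emb g = exp (t *\<^sub>R tang X)" for t
    using pos[of t] by (cases "t < 0") auto
  then show ?thesis unfolding lie_def by blast
qed

text \<open>Closure of the Lie algebra under sums and conjugation follows from this by differentiating a
  product of curves.\<close>

lemma lie_of_curve:
  assumes H: "subgroup H Isom" "closed H"
    and F: "(F has_vector_derivative tang X) (at 0)" "F 0 = 1"
    and FH: "\<And>t::real. \<exists>g\<in>H. emb g = F t"
  shows "X \<in> lie H"
proof -
  define s where "s j = inverse (real (Suc j))" for j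
  obtain g where g: "\<And>t. g t \<in> H \<and> emb (g t) = F t" using FH by metis
  have s: "s j > 0" "s \<longlonglongrightarrow> 0" for j
    unfolding s_def by (simp, rule LIMSEQ_inverse_real_of_nat)
  have "((\<lambda>t. (mat 1, 0) + untang (F t - 1)) has_vector_derivative untang (tang X)) (at 0)"
    using bounded_linear.has_vector_derivative[OF bounded_linear_untang
        has_vector_derivative_diff[OF F(1) has_vector_derivative_const[of 1]]]
    by (simp add: has_vector_derivative_add_const add.commute[of "(mat 1, 0)"])
  moreover have gF: "(mat 1, 0) + untang (F t - 1) = g t" for t
    using g[of t] emb_untang[of "g t"] by simp
  ultimately have der: "(g has_vector_derivative X) (at 0)" by simp
  have g0: "g 0 = (mat 1, 0)"
    using g[of 0] F by (metis emb_inject emb_one)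
  have "((\<lambda>h. (g h - g 0) /\<^sub>R h) \<longlongrightarrow> X) (at 0)"
  proof -
    have eq: "norm (g h - g 0 - h *\<^sub>R X) / norm h = norm ((g h - g 0) /\<^sub>R h - X)" if "h \<noteq> 0" for h
    proof -
      have "(g h - g 0) /\<^sub>R h - X = (g h - g 0 - h *\<^sub>R X) /\<^sub>R h"
        using that by (simp add: scaleR_diff_right)
      then show ?thesis by (simp add: divide_inverse_commute)
    qed
    have "((\<lambda>h. norm (g h - g 0 - h *\<^sub>R X) / norm h) \<longlongrightarrow> 0) (at 0)"
      using der unfolding has_vector_derivative_def has_derivative_at by simp
    then have "((\<lambda>h. norm ((g h - g 0) /\<^sub>R h - X)) \<longlongrightarrow> 0) (at 0)"
      by (rule Lim_transform_eventually) (use eq in \<open>auto simp: eventually_at_filter simp del: real_norm_def intro!: always_eventually\<close>)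
    then show ?thesis
      by (simp add: LIM_zero_iff tendsto_norm_zero_iff)
  qed
  moreover have "filterlim s (at 0) sequentially"
    using s by (simp add: filterlim_at less_imp_neq[symmetric] order_less_imp_not_eq2)
  ultimately have "(\<lambda>j. (g (s j) - g 0) /\<^sub>R s j) \<longlonglongrightarrow> X"
    by (rule filterlim_compose)
  then show ?thesis
    using lie_of_sequence[OF H, of "\<lambda>j. g (s j)" s X] g g0 s by simp
qed

lemma exp_curve_derivative: "((\<lambda>t. exp (t *\<^sub>R A)) has_vector_derivative A) (at 0)"
  using exp_scaleR_has_vector_derivative_right[of A 0 UNIV] by simp

lemma subspace_lie:
  assumes H: "subgroup H Isom" "closed H"
  shows "subspace (lie H)"
proof (rule subspaceI)
  show "0 \<in> lie H"
    using subgroup.one_closed[OF H(1)] by (auto simp: lie_def tang_simps intro!: bexI[of _ "(mat 1, 0)"])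
next
  fix X Y assume X: "X \<in> lie H" and Y: "Y \<in> lie H"
  have "((\<lambda>t. exp (t *\<^sub>R tang X) * exp (t *\<^sub>R tang Y)) has_vector_derivative (tang (X + Y))) (at 0)"
    using has_vector_derivative_mult[OF exp_curve_derivative exp_curve_derivative, of "tang X" "tang Y"]
    by (simp add: tang_simps add.commute)
  then show "X + Y \<in> lie H"
  proof (rule lie_of_curve[OF H])
    fix t
    obtain g h where "g \<in> H" "emb g = exp (t *\<^sub>R tang X)" "h \<in> H" "emb h = exp (t *\<^sub>R tang Y)"
      using X Y unfolding lie_def by blast
    then show "\<exists>g\<in>H. emb g = exp (t *\<^sub>R tang X) * exp (t *\<^sub>R tang Y)"
      using subgroup.m_closed[OF H(1)] emb_mult by metis
  qed simp
next
  fix c X assume X: "X \<in> lie H"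
  then show "c *\<^sub>R X \<in> lie H"
    by (auto simp: lie_def tang_simps)
qed

text \<open>The adjoint action, in the coordinates of \<open>'m motion\<close>; for orthogonal \<open>fst g\<close> it is conjugation
  by \<open>g\<close>, see \<open>tang_Ad\<close>.\<close>

definition Ad :: "'m::finite motion \<Rightarrow> 'm motion \<Rightarrow> 'm motion" where
  "Ad g X = (fst g ** fst X ** transpose (fst g),
             fst g *v snd X - (fst g ** fst X ** transpose (fst g)) *v snd g)"

lemma tang_Ad:
  assumes "g \<in> carrier Isom"
  shows "tang (Ad g X) = emb g * tang X * emb (inv\<^bsub>Isom\<^esub> g)"
proof -
  define T where "T = transpose (fst g)"
  have minus: "A *v (- x) = - (A *v x)" for A :: "real^'m^'m" and x
    by (rule linear_neg[OF matrix_vector_mul_linear])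
  show ?thesis
    unfolding Ad_def inv_Isom[OF assms] T_def[symmetric]
    by (rule endo_eqI)
       (simp add: minus matrix_vector_right_distrib matrix_vector_mult_scaleR scaleR_diff_right
          matrix_vector_mult_diff_distrib
          flip: matrix_vector_mul_assoc)
qed

lemma Ad_lie:
  assumes H: "subgroup H Isom" "closed H" and g: "g \<in> H" and X: "X \<in> lie H"
  shows "Ad g X \<in> lie H"
proof -
  have gI: "g \<in> carrier Isom" using g H subgroup.subset by blast
  have "((\<lambda>t. emb g * exp (t *\<^sub>R tang X) * emb (inv\<^bsub>Isom\<^esub> g)) has_vector_derivative tang (Ad g X)) (at 0)"
    unfolding tang_Ad[OF gI]
    by (auto intro!: derivative_eq_intros exp_curve_derivative)
  then show ?thesis
  proof (rule lie_of_curve[OF H])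
    fix t
    obtain h where "h \<in> H" "emb h = exp (t *\<^sub>R tang X)"
      using X unfolding lie_def by blast
    then show "\<exists>h\<in>H. emb h = emb g * exp (t *\<^sub>R tang X) * emb (inv\<^bsub>Isom\<^esub> g)"
      using subgroup.m_closed[OF H(1)] subgroup.m_inv_closed[OF H(1) g] g emb_mult by metis
  qed (simp add: emb_inv[OF gI])
qed


lemma lie_curve:
  assumes X: "X \<in> lie H"
  obtains c where "\<And>t. c t \<in> H" "\<And>t. emb (c t) = exp (t *\<^sub>R tang X)" "c 0 = (mat 1, 0)"
    "(c has_vector_derivative X) (at 0)"
proof -
  have "\<forall>t. \<exists>g. g \<in> H \<and> emb g = exp (t *\<^sub>R tang X)"
    using X unfolding lie_def by blast
  then obtain c where c: "\<And>t. c t \<in> H" "\<And>t. emb (c t) = exp (t *\<^sub>R tang X)"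
    by metis
  have "((\<lambda>t. (mat 1, 0) + untang (exp (t *\<^sub>R tang X) - 1)) has_vector_derivative untang (tang X)) (at 0)"
    using bounded_linear.has_vector_derivative[OF bounded_linear_untang
        has_vector_derivative_diff[OF exp_curve_derivative[of "tang X"] has_vector_derivative_const[of 1]]]
    by (simp add: has_vector_derivative_add_const add.commute[of "(mat 1, 0)"])
  moreover have "(mat 1, 0) + untang (exp (t *\<^sub>R tang X) - 1) = c t" for t
    using c(2)[of t] emb_untang[of "c t"] by simp
  ultimately have "(c has_vector_derivative X) (at 0)" by simp
  moreover have "c 0 = (mat 1, 0)"
    using c(2)[of 0] by (metis emb_inject emb_one exp_zero scale_zero_left)
  ultimately show ?thesis using c that by blast
qed

lemma matrix_add_mult_bounded: "bounded_linear (\<lambda>X :: 'm::finite motion. (A ** fst X, A *v snd X))"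
proof -
  have "linear (\<lambda>X :: 'm motion. (A ** fst X, A *v snd X))"
    by (rule linearI) (auto simp: matrix_add_ldistrib matrix_vector_right_distrib matrix_vector_mult_scaleR
        matrix_scalar_ac scalar_matrix_assoc)
  then show ?thesis using linear_conv_bounded_linear by blast
qed

lemma closest_in_coset:
  assumes M: "subgroup M Isom" "closed M" and g: "g \<in> carrier Isom"
  obtains m where "m \<in> M" "\<And>m'. m' \<in> M \<Longrightarrow> norm (g \<otimes>\<^bsub>Isom\<^esub> m - (mat 1, 0)) \<le> norm (g \<otimes>\<^bsub>Isom\<^esub> m' - (mat 1, 0))"
proof -
  let ?S = "{h. inv\<^bsub>Isom\<^esub> g \<otimes>\<^bsub>Isom\<^esub> h \<in> M}"
  have cancel: "g \<otimes>\<^bsub>Isom\<^esub> (inv\<^bsub>Isom\<^esub> g \<otimes>\<^bsub>Isom\<^esub> h) = h" "inv\<^bsub>Isom\<^esub> g \<otimes>\<^bsub>Isom\<^esub> (g \<otimes>\<^bsub>Isom\<^esub> h) = h" for h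
    using emb_inv[OF g] by (simp_all add: emb_mult mult.assoc[symmetric] flip: emb_inject)
  have "continuous_on UNIV (\<lambda>h. inv\<^bsub>Isom\<^esub> g \<otimes>\<^bsub>Isom\<^esub> h)"
    unfolding Isom_mult continuous_on_def by (intro ballI tendsto_intros)
  then have "closed ?S"
    using closed_vimage[OF M(2)] by (simp add: vimage_def)
  moreover have "?S \<noteq> {}"
    using cancel(2)[of "\<one>\<^bsub>Isom\<^esub>"] subgroup.one_closed[OF M(1)] by (metis (mono_tags, lifting) empty_iff mem_Collect_eq)
  ultimately obtain h where h: "h \<in> ?S" "\<And>y. y \<in> ?S \<Longrightarrow> dist (mat 1, 0) h \<le> dist (mat 1, 0) y"
    using distance_attains_inf[of ?S "(mat 1, 0)"] by blast
  show ?thesis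
  proof
    show "inv\<^bsub>Isom\<^esub> g \<otimes>\<^bsub>Isom\<^esub> h \<in> M" using h(1) by simp
    fix m' assume "m' \<in> M"
    then show "norm (g \<otimes>\<^bsub>Isom\<^esub> (inv\<^bsub>Isom\<^esub> g \<otimes>\<^bsub>Isom\<^esub> h) - (mat 1, 0)) \<le> norm (g \<otimes>\<^bsub>Isom\<^esub> m' - (mat 1, 0))"
      using h(2)[of "g \<otimes>\<^bsub>Isom\<^esub> m'"] cancel by (simp add: dist_norm norm_minus_commute)
  qed
qed

text \<open>The first-order condition for \<open>1\<close> to be a minimum of \<open>m \<mapsto> \<bar>g m - 1\<bar>\<close> on \<open>M\<close>, evaluated along the
  one-parameter group of \<open>Z\<close>.\<close>

lemma closest_orthogonal:
  assumes closest: "\<And>m'. m' \<in> M \<Longrightarrow> norm (g - (mat 1, 0)) \<le> norm (g \<otimes>\<^bsub>Isom\<^esub> m' - (mat 1, 0))"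
    and Z: "Z \<in> lie M"
  shows "(g - (mat 1, 0)) \<bullet> (fst g ** fst Z, fst g *v snd Z) = 0"
proof -
  obtain c where c: "\<And>t. c t \<in> M" "c 0 = (mat 1, 0)" "(c has_vector_derivative Z) (at 0)"
    using lie_curve[OF Z] by metis
  define D where "D = (fst g ** fst Z, fst g *v snd Z)"
  define f where "f t = g \<otimes>\<^bsub>Isom\<^esub> c t - (mat 1, 0)" for t
  have f: "f t = (fst g ** fst (c t), fst g *v snd (c t)) + ((0, snd g) - (mat 1, 0))" for t
    by (simp add: f_def Isom_mult)
  have "(f has_vector_derivative D) (at 0)"
    unfolding f D_def
    using bounded_linear.has_vector_derivative[OF matrix_add_mult_bounded c(3)]
    by (simp only: has_vector_derivative_add_const)
  then have "(f has_derivative (\<lambda>h. h *\<^sub>R D)) (at 0)"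
    by (simp add: has_vector_derivative_def)
  from has_derivative_inner[OF this this]
  have "((\<lambda>t. f t \<bullet> f t) has_real_derivative 2 * (f 0 \<bullet> D)) (at 0)"
    unfolding has_field_derivative_def
    by (rule has_derivative_eq_rhs) (auto simp: fun_eq_iff inner_commute)
  moreover have "\<forall>y. \<bar>0 - y\<bar> < 1 \<longrightarrow> f 0 \<bullet> f 0 \<le> f y \<bullet> f y"
  proof (intro allI impI)
    fix y :: real
    have "f 0 = g - (mat 1, 0)" by (simp add: f_def c Isom_mult)
    then have "norm (f 0) \<le> norm (f y)"
      using closest[OF c(1)] by (simp add: f_def)
    then show "f 0 \<bullet> f 0 \<le> f y \<bullet> f y"
      by (simp add: dot_square_norm)
  qed
  ultimately have "2 * (f 0 \<bullet> D) = 0"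
    by (rule DERIV_local_min[of "\<lambda>t. f t \<bullet> f t" _ 0 1, OF _ zero_less_one])
  then show ?thesis
    by (simp add: f_def D_def c Isom_mult)
qed

text \<open>Modify \<open>g\<^sub>j\<close> within its coset of \<open>M\<close> to be as close to \<open>1\<close> as possible and normalise the
  difference from \<open>1\<close>; by compactness of the sphere a subsequence converges. In the limit the
  first-order condition says that the direction is orthogonal to the Lie algebra of \<open>M\<close>.\<close>

lemma normal_direction:
  assumes H: "subgroup H Isom" "closed H" and M: "subgroup M Isom" "closed M" "M \<subseteq> H"
    and g: "\<And>j::nat. g j \<in> H" "\<And>j. g j \<notin> M" "g \<longlonglongrightarrow> (mat 1, 0)"
  obtains X r s m where "X \<in> lie H" "norm X = 1" "\<And>Z. Z \<in> lie M \<Longrightarrow> X \<bullet> Z = 0"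
    "strict_mono (r :: nat \<Rightarrow> nat)" "\<And>j. m j \<in> M" "\<And>j. s j > 0"
    "(\<lambda>j. (g (r j) \<otimes>\<^bsub>Isom\<^esub> m j - (mat 1, 0)) /\<^sub>R s j) \<longlonglongrightarrow> X"
proof -
  have gI: "g j \<in> carrier Isom" for j using g(1) H(1) subgroup.subset by blast
  have "\<forall>j. \<exists>m. m \<in> M \<and> (\<forall>m'\<in>M. norm (g j \<otimes>\<^bsub>Isom\<^esub> m - (mat 1, 0)) \<le> norm (g j \<otimes>\<^bsub>Isom\<^esub> m' - (mat 1, 0)))"
    using closest_in_coset[OF M(1,2) gI] by metis
  then obtain m where m: "\<And>j. m j \<in> M"
    "\<And>j m'. m' \<in> M \<Longrightarrow> norm (g j \<otimes>\<^bsub>Isom\<^esub> m j - (mat 1, 0)) \<le> norm (g j \<otimes>\<^bsub>Isom\<^esub> m' - (mat 1, 0))"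
    by metis
  define h where "h j = g j \<otimes>\<^bsub>Isom\<^esub> m j" for j
  define s where "s j = norm (h j - (mat 1, 0))" for j
  have hH: "h j \<in> H" for j
    unfolding h_def using subgroup.m_closed[OF H(1) g(1)] m(1) M(3) by blast
  have s_pos: "s j > 0" for j
  proof -
    have "h j \<noteq> \<one>\<^bsub>Isom\<^esub>"
    proof
      assume "h j = \<one>\<^bsub>Isom\<^esub>"
      then have "g j = inv\<^bsub>Isom\<^esub> m j"
        using group.inv_equality[OF group_Isom, of "g j" "m j"] gI m(1) M(1) subgroup.subset
        unfolding h_def by fastforce
      then show False using g(2) subgroup.m_inv_closed[OF M(1) m(1)] by metis
    qed
    then show ?thesis by (simp add: s_def)
  qed
  have "s j \<le> norm (g j - (mat 1, 0))" for j
    using m(2)[OF subgroup.one_closed[OF M(1)], of j] by (simp add: s_def h_def Isom_mult)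
  moreover have "(\<lambda>j. norm (g j - (mat 1, 0))) \<longlonglongrightarrow> 0"
    using g(3) by (simp add: LIM_zero tendsto_norm_zero)
  ultimately have s_0: "s \<longlonglongrightarrow> 0"
    using s_pos by (intro Lim_null_comparison[of s]) (auto simp: less_imp_le)
  define Y where "Y j = (h j - (mat 1, 0)) /\<^sub>R s j" for j
  have "Y j \<in> sphere 0 1" for j
    using s_pos[of j] by (simp add: Y_def s_def)
  then obtain X r where X: "X \<in> sphere 0 1" "strict_mono (r :: nat \<Rightarrow> nat)" "(Y \<circ> r) \<longlonglongrightarrow> X"
    using compact_sphere[of "0 :: 'a motion" 1] unfolding compact_def by metis
  have sr: "(s \<circ> r) \<longlonglongrightarrow> 0"
    using LIMSEQ_subseq_LIMSEQ[OF s_0 X(2)] .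
  have h_1: "h \<longlonglongrightarrow> (mat 1, 0)"
    using s_0 unfolding s_def by (simp add: LIM_zero_iff tendsto_norm_zero_iff)
  have hr: "(h \<circ> r) \<longlonglongrightarrow> (mat 1, 0)"
    using LIMSEQ_subseq_LIMSEQ[OF h_1 X(2)] .
  have "X \<in> lie H"
    using lie_of_sequence[OF H, of "h \<circ> r" "s \<circ> r" X] hH s_pos sr X(3)
    by (simp add: Y_def o_def)
  moreover have "X \<bullet> Z = 0" if Z: "Z \<in> lie M" for Z
  proof -
    have 0: "Y j \<bullet> (fst (h j) ** fst Z, fst (h j) *v snd Z) = 0" for j
    proof -
      have "norm (h j - (mat 1, 0)) \<le> norm (h j \<otimes>\<^bsub>Isom\<^esub> m' - (mat 1, 0))" if "m' \<in> M" for m'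
      proof -
        have "h j \<otimes>\<^bsub>Isom\<^esub> m' = g j \<otimes>\<^bsub>Isom\<^esub> (m j \<otimes>\<^bsub>Isom\<^esub> m')"
          by (simp add: h_def emb_mult mult.assoc flip: emb_inject)
        then show ?thesis
          using m(2)[OF subgroup.m_closed[OF M(1) m(1) that], of j] by (simp add: h_def)
      qed
      then show ?thesis
        using closest_orthogonal[OF _ Z, of "h j"] by (simp add: Y_def)
    qed
    have "(\<lambda>j. Y (r j) \<bullet> (fst (h (r j)) ** fst Z, fst (h (r j)) *v snd Z)) \<longlonglongrightarrow> X \<bullet> (fst (mat 1, 0 :: real^'a) ** fst Z, fst (mat 1, 0 :: real^'a) *v snd Z)"
      using X(3) hr by (intro tendsto_intros) (auto simp: o_def)
    then show ?thesis
      unfolding 0 by (simp add: LIMSEQ_const_iff)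
  qed
  ultimately show ?thesis
    using that[of X r "m \<circ> r" "s \<circ> r"] X m(1) s_pos by (simp add: Y_def h_def o_def)
qed


section \<open>Groups of motions that act transitively on a subspace\<close>

lemma inner_matrix: "A \<bullet> B = (\<Sum>i\<in>UNIV. \<Sum>j\<in>UNIV. A $ i $ j * B $ i $ j)"
  for A :: "real^'n^'m"
  by (simp add: inner_vec_def)

lemma inner_transpose: "transpose A \<bullet> transpose B = A \<bullet> B" for A :: "real^'n^'m"
  unfolding inner_matrix by (subst sum.swap) (simp add: transpose_def)

lemma inner_mult_orthogonal_right:
  fixes L A B :: "real^'m^'m"
  assumes "orthogonal_matrix L"
  shows "(A ** transpose L) \<bullet> (B ** transpose L) = A \<bullet> B"
proof -
  have row: "(C ** transpose L) $ i = L *v (C $ i)" for C :: "real^'m^'m" and i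
    by (simp add: matrix_matrix_mult_def matrix_vector_mult_def transpose_def vec_eq_iff mult.commute)
  have "orthogonal_transformation ((*v) L)"
    using assms by (simp add: orthogonal_transformation_matrix matrix_vector_mul_linear)
  then show ?thesis
    by (simp add: inner_vec_def[of "A ** transpose L"] row orthogonal_transformation_def
        inner_vec_def[of A])
qed

text \<open>The inner product of matrices as vectors of vectors is the Frobenius inner product, which is
  invariant under the adjoint action of orthogonal matrices.\<close>

lemma inner_conj:
  fixes L :: "real^'m^'m"
  assumes "orthogonal_matrix L"
  shows "(L ** A ** transpose L) \<bullet> (L ** B ** transpose L) = A \<bullet> B"
proof -
  have "(L ** A ** transpose L) \<bullet> (L ** B ** transpose L) = (L ** A) \<bullet> (L ** B)"
    by (rule inner_mult_orthogonal_right[OF assms])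
  also have "\<dots> = transpose (L ** A) \<bullet> transpose (L ** B)"
    by (rule inner_transpose[symmetric])
  also have "\<dots> = transpose A \<bullet> transpose B"
    by (simp add: matrix_transpose_mul inner_mult_orthogonal_right[OF assms])
  also have "\<dots> = A \<bullet> B"
    by (rule inner_transpose)
  finally show ?thesis .
qed

lemma norm_conj:
  fixes L :: "real^'m^'m"
  assumes "orthogonal_matrix L"
  shows "norm (L ** A ** transpose L) = norm A"
  by (simp add: norm_eq_sqrt_inner inner_conj[OF assms])

text \<open>The last assumption says that \<open>H\<close> contains no one-parameter group of translations.\<close>

locale transitive_motions =
  fixes H :: "'m::finite motion set" and V :: "(real^'m) set"
  assumes subgroup_H: "subgroup H Isom" and closed_H: "closed H"
    and subspace_V: "subspace V"
    and maps_V: "g \<in> H \<Longrightarrow> x \<in> V \<Longrightarrow> act g x \<in> V"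
    and transitive: "v \<in> V \<Longrightarrow> \<exists>g\<in>H. act g 0 = v"
    and translation_free: "(0, b) \<in> lie H \<Longrightarrow> b = 0"
begin

lemma H_Isom: "g \<in> H \<Longrightarrow> g \<in> carrier Isom"
  using subgroup.subset[OF subgroup_H] by blast

lemma orthogonal_H: "g \<in> H \<Longrightarrow> orthogonal_matrix (fst g)"
  using H_Isom carrier_Isom by blast

lemma subspace_lie_H: "subspace (lie H)"
  by (rule subspace_lie[OF subgroup_H closed_H])

lemma snd_in: "g \<in> H \<Longrightarrow> snd g \<in> V"
  using maps_V[of g 0] subspace_0[OF subspace_V] by (simp add: act_eq)

lemma transitive_snd: "v \<in> V \<Longrightarrow> \<exists>g\<in>H. snd g = v"
  using transitive[of v] by (simp add: act_eq)

lemma lie_snd_in: 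
  assumes "X \<in> lie H"
  shows "snd X \<in> V"
proof -
  obtain c where c: "\<And>t. c t \<in> H" "(c has_vector_derivative X) (at 0)"
    using lie_curve[OF assms] by metis
  have "((\<lambda>t. snd (c t)) has_vector_derivative snd X) (at 0)"
    by (rule bounded_linear.has_vector_derivative[OF bounded_linear_snd c(2)])
  then show ?thesis
    using derivative_in_subspace[OF subspace_V, of "\<lambda>t. snd (c t)" "snd X" 1] snd_in[OF c(1)] by simp
qed

lemma lie_bound: "\<exists>C. \<forall>X\<in>lie H. norm (snd X) \<le> C * norm (fst X)"
proof -
  have "\<exists>e>0. \<forall>X\<in>lie H. norm (fst X) \<ge> e * norm X"
  proof (rule injective_imp_isometric[OF _ subspace_lie_H])
    show "\<forall>X\<in>lie H. fst X = 0 \<longrightarrow> X = 0"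
      using translation_free by (auto simp: prod_eq_iff)
  qed (simp_all add: closed_subspace subspace_lie_H bounded_linear_fst)
  then obtain e where e: "e > 0" "\<And>X. X \<in> lie H \<Longrightarrow> e * norm X \<le> norm (fst X)" by blast
  have "norm (snd X) \<le> inverse e * norm (fst X)" if "X \<in> lie H" for X
  proof -
    have "norm (snd X) \<le> norm X"
      by (metis norm_snd_le prod.collapse)
    also have "\<dots> \<le> inverse e * norm (fst X)"
      using e(1) e(2)[OF that] by (simp add: field_simps)
    finally show ?thesis .
  qed
  then show ?thesis by blast
qed

text \<open>The bound on the translation part of \<open>X\<close> at the origin holds at every point \<open>y\<close> of \<open>V\<close>: the
  element \<open>Ad (inv g) X\<close>, for \<open>g\<close> taking the origin to \<open>y\<close>, has a linear part of the same norm and a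
  translation part of norm \<open>\<bar>Y y + b\<bar>\<close>. The affine map \<open>y \<mapsto> Y y + b\<close> is thus bounded on \<open>V\<close>.\<close>

lemma lie_fst_zero:
  assumes X: "X \<in> lie H" and x: "x \<in> V"
  shows "fst X *v x = 0"
proof -
  obtain C where C: "\<And>X. X \<in> lie H \<Longrightarrow> norm (snd X) \<le> C * norm (fst X)"
    using lie_bound by blast
  \<comment> \<open>The norm of the field at \<open>y\<close> is that of its conjugate at the origin.\<close>
  have bound: "norm (fst X *v y + snd X) \<le> C * norm (fst X)" if y: "y \<in> V" for y
  proof -
    obtain g where g: "g \<in> H" "snd g = y" using transitive_snd[OF y] by blast
    define L where "L = transpose (fst g)"
    have L: "orthogonal_matrix L"
      using orthogonal_H[OF g(1)] by (simp add: L_def orthogonal_matrix_transpose)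
    have ig: "inv\<^bsub>Isom\<^esub> g = (L, - (L *v y))"
      using inv_Isom[OF H_Isom[OF g(1)]] g(2) by (simp add: L_def)
    have "Ad (inv\<^bsub>Isom\<^esub> g) X \<in> lie H"
      using Ad_lie[OF subgroup_H closed_H subgroup.m_inv_closed[OF subgroup_H g(1)] X] .
    from C[OF this] have "norm (snd (Ad (L, - (L *v y)) X)) \<le> C * norm (L ** fst X ** transpose L)"
      unfolding ig by (simp add: Ad_def)
    moreover have "snd (Ad (L, - (L *v y)) X) = L *v (fst X *v y + snd X)"
    proof -
      have "transpose L *v (L *v y) = y"
        using L by (simp add: matrix_vector_mul_assoc orthogonal_matrix del: transpose_matrix_vector)
      then show ?thesis
        by (simp add: Ad_def linear_neg[OF matrix_vector_mul_linear] matrix_vector_right_distrib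
            flip: matrix_vector_mul_assoc del: transpose_matrix_vector)
    qed
    moreover have "norm (L *v (fst X *v y + snd X)) = norm (fst X *v y + snd X)"
      using L orthogonal_transformation_matrix orthogonal_transformation_norm
      by (metis matrix_of_matrix_vector_mul matrix_vector_mul_linear)
    ultimately show ?thesis by (simp add: norm_conj[OF L])
  qed
  show ?thesis
  proof (rule ccontr)
    assume n: "fst X *v x \<noteq> 0"
    obtain n :: nat where "real n * norm (fst X *v x) > C * norm (fst X) + norm (snd X)"
      using reals_Archimedean3[of "norm (fst X *v x)"] n by auto
    moreover have "norm (real n *\<^sub>R (fst X *v x) + snd X) \<le> C * norm (fst X)"
      using bound[OF subspace_scale[OF subspace_V x, of "real n"]] by (simp add: matrix_vector_mult_scaleR)
    moreover have "real n * norm (fst X *v x) \<le> norm (real n *\<^sub>R (fst X *v x) + snd X) + norm (snd X)"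
      using norm_triangle_ineq4[of "real n *\<^sub>R (fst X *v x) + snd X" "snd X"] by simp
    ultimately show False by linarith
  qed
qed

text \<open>A field that vanishes at the origin has a flow that fixes the origin.\<close>

lemma lie_snd_zero:
  assumes "X \<in> lie H" "snd X = 0"
  shows "X \<in> lie {g \<in> H. snd g = 0}"
  unfolding lie_def
proof (intro CollectI allI)
  fix t
  obtain g where g: "g \<in> H" "emb g = exp (t *\<^sub>R tang X)" using assms unfolding lie_def by blast
  have "app (emb g) (0, 1) = (0, 1)"
    unfolding g by (rule app_exp_fixed) (simp add: assms zero_prod_def)
  then have "snd g = 0" by simp
  then show "\<exists>g\<in>{g \<in> H. snd g = 0}. emb g = exp (t *\<^sub>R tang X)" using g by blast
qed

definition trivial_on_V :: "'m motion set" where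
  "trivial_on_V = {g \<in> H. \<forall>x\<in>V. fst g *v x = x}"

lemma lie_trivial_on_V: "lie H \<subseteq> lie trivial_on_V"
proof
  fix X assume X: "X \<in> lie H"
  show "X \<in> lie trivial_on_V"
    unfolding lie_def
  proof (intro CollectI allI)
    fix t
    obtain g where g: "g \<in> H" "emb g = exp (t *\<^sub>R tang X)" using X unfolding lie_def by blast
    have "fst g *v x = x" if "x \<in> V" for x
    proof -
      have "app (emb g) (x, 0) = (x, 0)"
        unfolding g by (rule app_exp_fixed) (simp add: lie_fst_zero[OF X that] zero_prod_def)
      then show ?thesis by simp
    qed
    then show "\<exists>g\<in>trivial_on_V. emb g = exp (t *\<^sub>R tang X)" using g by (intro bexI[of _ g]) (auto simp: trivial_on_V_def)
  qed
qed

lemma subgroup_H_restrict: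
  assumes "(mat 1, 0) \<in> {g \<in> H. P g}"
    and "\<And>g h. g \<in> H \<Longrightarrow> h \<in> H \<Longrightarrow> P g \<Longrightarrow> P h \<Longrightarrow> P (g \<otimes>\<^bsub>Isom\<^esub> h)"
    and "\<And>g. g \<in> H \<Longrightarrow> P g \<Longrightarrow> P (inv\<^bsub>Isom\<^esub> g)"
  shows "subgroup {g \<in> H. P g} Isom"
proof (rule subgroup.intro)
  show "{g \<in> H. P g} \<subseteq> carrier Isom" using H_Isom by blast
  show "\<one>\<^bsub>Isom\<^esub> \<in> {g \<in> H. P g}" using assms(1) by simp
qed (use assms(2,3) subgroup.m_closed[OF subgroup_H] subgroup.m_inv_closed[OF subgroup_H] in auto)

lemma one_H: "(mat 1, 0) \<in> H"
  using subgroup.one_closed[OF subgroup_H] by simp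

lemma transpose_cancel:
  assumes "g \<in> H" "fst g *v x = x"
  shows "transpose (fst g) *v x = x"
proof -
  have "transpose (fst g) *v (fst g *v x) = x"
    using orthogonal_H[OF assms(1)] by (simp add: matrix_vector_mul_assoc orthogonal_matrix del: transpose_matrix_vector)
  then show ?thesis using assms(2) by simp
qed

lemma subgroup_trivial_on_V: "subgroup trivial_on_V Isom"
  unfolding trivial_on_V_def
proof (rule subgroup_H_restrict)
  fix g assume g: "g \<in> H" "\<forall>x\<in>V. fst g *v x = x"
  then show "\<forall>x\<in>V. fst (inv\<^bsub>Isom\<^esub> g) *v x = x"
    using transpose_cancel[OF g(1)] by (simp add: inv_Isom[OF H_Isom[OF g(1)]] del: transpose_matrix_vector)
qed (use one_H in \<open>auto simp: Isom_mult simp flip: matrix_vector_mul_assoc\<close>)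

lemma closed_trivial_on_V: "closed trivial_on_V"
proof -
  have "closed {g :: 'm motion. fst g *v x = x}" for x
    by (intro closed_Collect_eq; unfold continuous_on_def; intro ballI tendsto_intros)
  then have "closed (H \<inter> (\<Inter>x\<in>V. {g. fst g *v x = x}))"
    using closed_H by blast
  moreover have "trivial_on_V = H \<inter> (\<Inter>x\<in>V. {g. fst g *v x = x})"
    by (auto simp: trivial_on_V_def)
  ultimately show ?thesis by simp
qed

text \<open>Otherwise \<open>normal_direction\<close> yields a nonzero element of the Lie algebra of \<open>H\<close> orthogonal to
  that of \<open>trivial_on_V\<close>. But the two Lie algebras coincide.\<close>

lemma near_identity:
  "\<exists>e>0. \<forall>g\<in>H. norm (g - (mat 1, 0)) < e \<longrightarrow> g \<in> trivial_on_V"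
proof (rule ccontr)
  assume "\<not> ?thesis"
  then have "\<forall>j. \<exists>g. g \<in> H \<and> norm (g - (mat 1, 0)) < inverse (real (Suc j)) \<and> g \<notin> trivial_on_V"
    by (metis inverse_positive_iff_positive of_nat_0_less_iff zero_less_Suc)
  then obtain g where g: "\<And>j. g j \<in> H" "\<And>j. norm (g j - (mat 1, 0)) < inverse (real (Suc j))"
    "\<And>j. g j \<notin> trivial_on_V" by metis
  have "(\<lambda>j. g j - (mat 1, 0)) \<longlonglongrightarrow> 0"
    by (rule Lim_null_comparison[OF always_eventually LIMSEQ_inverse_real_of_nat]) (use g(2) less_imp_le in blast)
  then have lim: "g \<longlonglongrightarrow> (mat 1, 0)" by (simp add: LIM_zero_iff)
  obtain X where X: "X \<in> lie H" "norm X = 1" "\<And>Z. Z \<in> lie trivial_on_V \<Longrightarrow> X \<bullet> Z = 0"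
    using normal_direction[OF subgroup_H closed_H subgroup_trivial_on_V closed_trivial_on_V _ g(1,3) lim]
    by (metis (no_types, lifting) mem_Collect_eq subsetI trivial_on_V_def)
  then have "X \<bullet> X = 0" using lie_trivial_on_V by blast
  then show False using X(2) by simp
qed

text \<open>By \<open>near_identity\<close> both \<open>G \<inter> trivial_on_V\<close> and its complement in \<open>G\<close> are open. The topology \<open>T\<close> of
  \<open>G\<close> may be finer than the one induced from the space of pairs.\<close>

lemma connected_subgroup_trivial_on_V:
  assumes G: "subgroup G Isom" "G \<subseteq> H"
    and T: "topspace T = G" "connected_space T" "continuous_map T euclidean (\<lambda>g. g)"
  shows "G \<subseteq> trivial_on_V"
proof -
  obtain e where e: "e > 0" "\<And>g. g \<in> H \<Longrightarrow> norm (g - (mat 1, 0)) < e \<Longrightarrow> g \<in> trivial_on_V"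
    using near_identity by blast
  note sM = subgroup_trivial_on_V
  define N where "N g = {h \<in> G. norm (inv\<^bsub>Isom\<^esub> g \<otimes>\<^bsub>Isom\<^esub> h - (mat 1, 0)) < e}" for g
  have GI: "g \<in> carrier Isom" if "g \<in> G" for g using that G(2) H_Isom by blast
  have N_open: "openin T (N g)" for g
  proof -
    have "open {h :: 'm motion. norm (inv\<^bsub>Isom\<^esub> g \<otimes>\<^bsub>Isom\<^esub> h - (mat 1, 0)) < e}"
      unfolding Isom_mult
      by (intro open_Collect_less continuous_intros; unfold continuous_on_def; intro ballI tendsto_intros)
    from openin_continuous_map_preimage[OF T(3) open_openin[THEN iffD1, OF this]] show ?thesis
      by (simp only: N_def T(1) mem_Collect_eq)
  qed
  have N_sub: "N g \<subseteq> G" for g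
    by (auto simp: N_def)
  have N_self: "g \<in> N g" if "g \<in> G" for g
    using that e(1) group.l_inv[OF group_Isom GI[OF that]] by (simp add: N_def)
  have N_iff: "g \<in> trivial_on_V \<longleftrightarrow> h \<in> trivial_on_V" if g: "g \<in> G" and h: "h \<in> N g" for g h
  proof -
    define k where "k = inv\<^bsub>Isom\<^esub> g \<otimes>\<^bsub>Isom\<^esub> h"
    have hG: "h \<in> G" using h by (simp add: N_def)
    have "k \<in> H" unfolding k_def
      using G subgroup.m_closed[OF subgroup_H] subgroup.m_inv_closed[OF subgroup_H] g hG by blast
    then have k: "k \<in> trivial_on_V" using e(2) h by (simp add: N_def k_def)
    have kI: "k \<in> carrier Isom" using \<open>k \<in> H\<close> H_Isom by blast
    have gk: "g \<otimes>\<^bsub>Isom\<^esub> k = h"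
      using emb_inv(2)[OF GI[OF g]] by (simp add: k_def emb_mult mult.assoc[symmetric] flip: emb_inject)
    have hk: "h \<otimes>\<^bsub>Isom\<^esub> inv\<^bsub>Isom\<^esub> k = g"
      unfolding gk[symmetric] using emb_inv(2)[OF kI] by (simp add: emb_mult mult.assoc flip: emb_inject)
    show ?thesis
      using subgroup.m_closed[OF sM _ k, of g] subgroup.m_closed[OF sM _ subgroup.m_inv_closed[OF sM k], of h] gk hk
      by auto
  qed
  have o1: "openin T (G \<inter> trivial_on_V)"
  proof (subst openin_subopen, intro ballI)
    fix g assume "g \<in> G \<inter> trivial_on_V"
    then show "\<exists>R. openin T R \<and> g \<in> R \<and> R \<subseteq> G \<inter> trivial_on_V"
      using N_open[of g] N_self[of g] N_iff[of g] N_sub[of g] by (intro exI[of _ "N g"]) blast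
  qed
  have o2: "openin T (G - trivial_on_V)"
  proof (subst openin_subopen, intro ballI)
    fix g assume "g \<in> G - trivial_on_V"
    then show "\<exists>R. openin T R \<and> g \<in> R \<and> R \<subseteq> G - trivial_on_V"
      using N_open[of g] N_self[of g] N_iff[of g] N_sub[of g] by (intro exI[of _ "N g"]) blast
  qed
  have "(mat 1, 0) \<in> G \<inter> trivial_on_V"
    using subgroup.one_closed[OF G(1)] subgroup.one_closed[OF sM] by simp
  then have "G - trivial_on_V = {}"
    using T(2) o1 o2 unfolding connected_space_def T(1) by blast
  then show ?thesis by blast
qed

text \<open>Infinitesimal transitivity. If \<open>u \<in> V\<close> were orthogonal to all translation parts, choose elements
  of \<open>H\<close> that take the origin to \<open>t\<^sub>j u\<close> with \<open>t\<^sub>j \<rightarrow> 0\<close>. By compactness a subsequence converges to an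
  isotropy element, and after division by it the limit is \<open>1\<close>. Then \<open>normal_direction\<close> for the
  isotropy group \<open>M\<close> gives \<open>X\<close> with translation part in \<open>\<real> u\<close>, hence zero. So \<open>X\<close> lies in the Lie
  algebra of \<open>M\<close> and is orthogonal to it, a contradiction.\<close>

lemma snd_lie_onto: "snd ` lie H = V"
proof (rule ccontr)
  assume neq: "snd ` lie H \<noteq> V"
  have sub: "snd ` lie H \<subseteq> V" using lie_snd_in by blast
  have ss: "subspace (snd ` lie H)"
    by (rule linear_subspace_image[OF _ subspace_lie_H]) (simp add: linear_snd)
  obtain v where v: "v \<in> V" "v \<notin> snd ` lie H" using neq sub by blast
  obtain y u where yu: "y \<in> span (snd ` lie H)" "\<And>w. w \<in> span (snd ` lie H) \<Longrightarrow> orthogonal u w" "v = y + u"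
    using orthogonal_subspace_decomp_exists[of "snd ` lie H" v] by blast
  have span: "span (snd ` lie H) = snd ` lie H" using ss by simp
  have u: "u \<in> V" "u \<noteq> 0"
  proof -
    have "y \<in> snd ` lie H" using yu(1) span by simp
    then show "u \<noteq> 0" using yu(3) v(2) by (metis add.right_neutral)
    show "u \<in> V"
      using yu(3) subspace_diff[OF subspace_V v(1), of y] sub \<open>y \<in> snd ` lie H\<close>
      by (metis add_diff_cancel_left' subsetD)
  qed
  define t where "t j = inverse (real (Suc j))" for j
  have "\<forall>j. \<exists>g. g \<in> H \<and> snd g = t j *\<^sub>R u"
    using transitive_snd subspace_scale[OF subspace_V u(1)] by blast
  then obtain g where g: "\<And>j. g j \<in> H" "\<And>j. snd (g j) = t j *\<^sub>R u" by metis
  have t: "t j > 0" "t \<longlonglongrightarrow> 0" for j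
    unfolding t_def by (simp, rule LIMSEQ_inverse_real_of_nat)
  have orth_bound: "norm A = norm (mat 1 :: real^'m^'m)" if "orthogonal_matrix A" for A :: "real^'m^'m"
  proof -
    have "(mat 1 ** transpose (transpose A)) \<bullet> (mat 1 ** transpose (transpose A)) = (mat 1 :: real^'m^'m) \<bullet> mat 1"
      using that by (intro inner_mult_orthogonal_right) (simp add: orthogonal_matrix_transpose)
    then show ?thesis by (simp add: norm_eq_sqrt_inner)
  qed
  let ?S = "H \<inter> cball 0 (norm (mat 1 :: real^'m^'m) + norm u)"
  have gS: "g j \<in> ?S" for j
  proof -
    have "norm (g j) \<le> norm (fst (g j)) + norm (snd (g j))"
      by (metis norm_Pair_le prod.collapse)
    also have "\<dots> \<le> norm (mat 1 :: real^'m^'m) + norm u"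
    proof (rule add_mono)
      show "norm (fst (g j)) \<le> norm (mat 1 :: real^'m^'m)" using orth_bound orthogonal_H g(1) by simp
      have "t j \<le> 1" unfolding t_def by (simp add: inverse_le_1_iff)
      then show "norm (snd (g j)) \<le> norm u"
        using g(2)[of j] t(1)[of j] by (simp add: mult_left_le_one_le)
    qed
    finally show ?thesis using g by simp
  qed
  have "compact ?S" using closed_H by (simp add: closed_Int_compact)
  then obtain k r where k: "k \<in> ?S" "strict_mono (r :: nat \<Rightarrow> nat)" "(g \<circ> r) \<longlonglongrightarrow> k"
    using gS unfolding compact_def by metis
  have tr: "(t \<circ> r) \<longlonglongrightarrow> 0" using LIMSEQ_subseq_LIMSEQ[OF t(2) k(2)] .
  have "(\<lambda>j. snd (g (r j))) \<longlonglongrightarrow> snd k" using tendsto_snd[OF k(3)] by (simp add: o_def)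
  moreover have "(\<lambda>j. snd (g (r j))) \<longlonglongrightarrow> 0 *\<^sub>R u"
    unfolding g by (intro tendsto_intros tr[unfolded o_def])
  ultimately have k0: "snd k = 0" using LIMSEQ_unique by fastforce
  have kH: "k \<in> H" using k(1) by blast
  \<comment> \<open>The limit \<open>k\<close> fixes the origin. Dividing by it gives a sequence that tends to \<open>1\<close>.\<close>
  define k' where "k' = inv\<^bsub>Isom\<^esub> k"
  have k': "k' \<in> H" "snd k' = 0"
    using subgroup.m_inv_closed[OF subgroup_H kH] by (simp_all add: k'_def inv_Isom[OF H_Isom[OF kH]] k0)
  define h where "h j = g (r j) \<otimes>\<^bsub>Isom\<^esub> k'" for j
  define M where "M = {g \<in> H. snd g = 0}"
  have hH: "h j \<in> H" for j unfolding h_def using subgroup.m_closed[OF subgroup_H g(1) k'(1)] .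
  have snd_h: "snd (h j) = t (r j) *\<^sub>R u" for j
    by (simp add: h_def Isom_mult k' g)
  have hM: "h j \<notin> M" for j
    using snd_h[of j] u(2) t(1)[of "r j"] by (simp add: M_def)
  have "(\<lambda>j. g (r j) \<otimes>\<^bsub>Isom\<^esub> k') \<longlonglongrightarrow> k \<otimes>\<^bsub>Isom\<^esub> k'"
    unfolding Isom_mult using k(3) by (intro tendsto_intros) (auto simp: o_def)
  moreover have "k \<otimes>\<^bsub>Isom\<^esub> k' = (mat 1, 0)"
    using group.r_inv[OF group_Isom H_Isom[OF kH]] by (simp add: k'_def)
  ultimately have lim: "h \<longlonglongrightarrow> (mat 1, 0)" by (simp add: h_def[abs_def])
  have sM: "subgroup M Isom"
    unfolding M_def using one_H by (intro subgroup_H_restrict) (auto simp: Isom_mult inv_Isom[OF H_Isom])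
  have cM: "closed M"
  proof -
    have "closed {g :: 'm motion. snd g = 0}"
      by (intro closed_Collect_eq continuous_intros)
    then have "closed (H \<inter> {g. snd g = 0})" using closed_H by blast
    moreover have "M = H \<inter> {g. snd g = 0}" by (auto simp: M_def)
    ultimately show ?thesis by simp
  qed
  have MH: "M \<subseteq> H" by (auto simp: M_def)
  obtain X r' s m where X: "X \<in> lie H" "norm X = 1" "\<And>Z. Z \<in> lie M \<Longrightarrow> X \<bullet> Z = 0"
    "\<And>j. m j \<in> M" "\<And>j::nat. s j > 0"
    and Xlim: "(\<lambda>j. (h (r' j) \<otimes>\<^bsub>Isom\<^esub> m j - (mat 1, 0)) /\<^sub>R s j) \<longlonglongrightarrow> X"
    by (rule normal_direction[OF subgroup_H closed_H sM cM MH hH hM lim]) (rule that; assumption)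
  have "(\<lambda>j. snd ((h (r' j) \<otimes>\<^bsub>Isom\<^esub> m j - (mat 1, 0)) /\<^sub>R s j)) \<longlonglongrightarrow> snd X"
    by (rule tendsto_snd[OF Xlim])
  moreover have "snd ((h (r' j) \<otimes>\<^bsub>Isom\<^esub> m j - (mat 1, 0)) /\<^sub>R s j) \<in> span {u}" for j
  proof -
    have "snd (m j) = 0" using X(4)[of j] by (simp add: M_def)
    then have "snd ((h (r' j) \<otimes>\<^bsub>Isom\<^esub> m j - (mat 1, 0)) /\<^sub>R s j) = (t (r (r' j)) / s j) *\<^sub>R u"
      by (simp add: Isom_mult snd_h divide_inverse_commute)
    then show ?thesis by (simp add: span_base span_scale)
  qed
  ultimately have "snd X \<in> span {u}"
    by (rule closed_sequentially[OF closed_span, rotated])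
  then obtain c where c: "snd X = c *\<^sub>R u" by (auto simp: span_singleton)
  have "orthogonal u (snd X)" using yu(2) X(1) span by blast
  then have "snd X = 0" using u(2) c by (simp add: orthogonal_def)
  then have "X \<bullet> X = 0" using lie_snd_zero[OF X(1)] X(3) by (simp add: M_def)
  then show False using X(2) by simp
qed


section \<open>Horizontal lifts\<close>

text \<open>The orthogonal complement of the isotropy algebra. Its elements are determined by their
  translation parts, and \<open>lift v\<close> is the one with translation part \<open>v\<close>.\<close>

definition horizontal :: "'m motion set" where
  "horizontal = {X \<in> lie H. \<forall>Z\<in>lie H. snd Z = 0 \<longrightarrow> fst X \<bullet> fst Z = 0}"

lemma subspace_horizontal: "subspace horizontal"
  unfolding horizontal_def using subspace_lie_H
  by (auto simp: subspace_def inner_add_left)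

lemma horizontal_unique:
  assumes "X \<in> horizontal" "Y \<in> horizontal" "snd X = snd Y"
  shows "X = Y"
proof -
  let ?D = "X - Y"
  have D: "?D \<in> horizontal" by (rule subspace_diff[OF subspace_horizontal assms(1,2)])
  then have lieD: "?D \<in> lie H" and "fst ?D \<bullet> fst ?D = 0"
    using assms(3) unfolding horizontal_def by auto
  then have "?D = (0, 0)" using assms(3) by (simp add: prod_eq_iff)
  then show ?thesis by (simp add: prod_eq_iff)
qed

lemma horizontal_exists:
  assumes "v \<in> V"
  shows "\<exists>X\<in>horizontal. snd X = v"
proof -
  obtain X where X: "X \<in> lie H" "snd X = v" using assms snd_lie_onto by blast
  let ?N = "fst ` (lie H \<inter> {X. snd X = 0})"
  have "subspace (lie H \<inter> {X. snd X = 0})"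
    using subspace_lie_H by (intro subspace_inter) (auto simp: subspace_def)
  then have N: "subspace ?N" by (intro linear_subspace_image linear_fst)
  obtain y z where yz: "y \<in> span ?N" "\<And>w. w \<in> span ?N \<Longrightarrow> orthogonal z w" "fst X = y + z"
    using orthogonal_subspace_decomp_exists[of ?N "fst X"] by blast
  have span: "span ?N = ?N" using N by simp
  have "y \<in> ?N" using yz(1) unfolding span .
  then obtain Y where Y: "Y \<in> lie H" "snd Y = 0" "fst Y = y" by blast
  have z: "fst (X - Y) = z" using yz(3) Y by simp
  have "X - Y \<in> lie H" by (rule subspace_diff[OF subspace_lie_H X(1) Y(1)])
  moreover have "fst (X - Y) \<bullet> fst Z = 0" if "Z \<in> lie H" "snd Z = 0" for Z
    using yz(2)[of "fst Z"] that unfolding span z orthogonal_def by blast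
  ultimately have "X - Y \<in> horizontal" by (simp add: horizontal_def)
  then show ?thesis using X Y by (intro bexI[of _ "X - Y"]) auto
qed

definition lift :: "real^'m \<Rightarrow> 'm motion" where
  "lift v = (THE X. X \<in> horizontal \<and> snd X = v)"

lemma lift:
  assumes "v \<in> V"
  shows "lift v \<in> horizontal" "snd (lift v) = v"
proof -
  have "\<exists>!X. X \<in> horizontal \<and> snd X = v"
    using horizontal_exists[OF assms] horizontal_unique by blast
  from theI'[OF this] show "lift v \<in> horizontal" "snd (lift v) = v"
    unfolding lift_def by auto
qed

lemma lift_eq: "X \<in> horizontal \<Longrightarrow> lift (snd X) = X"
  using lift[of "snd X"] lie_snd_in horizontal_unique unfolding horizontal_def by blast

lemma lift_linear:
  "v \<in> V \<Longrightarrow> w \<in> V \<Longrightarrow> lift (v + w) = lift v + lift w"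
  "v \<in> V \<Longrightarrow> lift (r *\<^sub>R v) = r *\<^sub>R lift v"
  using lift_eq[OF subspace_add[OF subspace_horizontal lift(1) lift(1)], of v w]
    lift_eq[OF subspace_scale[OF subspace_horizontal lift(1)], of v r] lift(2)
  by simp_all

text \<open>Conjugation with \<open>g\<close> preserves horizontality, because it preserves the isotropy algebra and the
  inner product, and it preserves translation parts, because \<open>fst g\<close> is trivial on \<open>V\<close>.\<close>

lemma Ad_lift:
  assumes g: "g \<in> trivial_on_V" and v: "v \<in> V"
  shows "Ad g (lift v) = lift v"
proof -
  have gH: "g \<in> H" and gV: "\<And>x. x \<in> V \<Longrightarrow> fst g *v x = x" using g by (auto simp: trivial_on_V_def)
  have igH: "inv\<^bsub>Isom\<^esub> g \<in> H" by (rule subgroup.m_inv_closed[OF subgroup_H gH])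
  have X: "lift v \<in> lie H" using lift(1)[OF v] by (simp add: horizontal_def)
  have AX: "Ad g (lift v) \<in> lie H" by (rule Ad_lie[OF subgroup_H closed_H gH X])
  have TT: "transpose (fst g) ** fst g = mat 1" "fst g ** transpose (fst g) = mat 1"
    using orthogonal_H[OF gH] by (simp_all add: orthogonal_matrix_def)
  have snd_Ad: "snd (Ad g (lift v)) = v"
  proof -
    have "transpose (fst g) *v snd g = snd g"
      by (rule transpose_cancel[OF gH gV[OF snd_in[OF gH]]])
    then have "(fst g ** fst (lift v) ** transpose (fst g)) *v snd g = 0"
      by (simp add: lie_fst_zero[OF X snd_in[OF gH]] flip: matrix_vector_mul_assoc del: transpose_matrix_vector)
    then show ?thesis by (simp add: Ad_def lift(2)[OF v] gV[OF v])
  qed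
  have "fst (Ad g (lift v)) \<bullet> fst Z = 0" if Z: "Z \<in> lie H" "snd Z = 0" for Z
  proof -
    \<comment> \<open>Moving \<open>g\<close> to the other side of the inner product turns \<open>Z\<close> into \<open>Ad (inv g) Z\<close>, which is
        again in the isotropy algebra.\<close>
    define W where "W = Ad (inv\<^bsub>Isom\<^esub> g) Z"
    have W: "W \<in> lie H" unfolding W_def by (rule Ad_lie[OF subgroup_H closed_H igH Z(1)])
    have fW: "fst W = transpose (fst g) ** fst Z ** fst g"
      by (simp add: W_def Ad_def inv_Isom[OF H_Isom[OF gH]])
    have "snd (inv\<^bsub>Isom\<^esub> g) \<in> V" by (rule snd_in[OF igH])
    moreover have "fst (inv\<^bsub>Isom\<^esub> g) *v x = x" if "x \<in> V" for x
      using transpose_cancel[OF gH gV[OF that]] by (simp add: inv_Isom[OF H_Isom[OF gH]] del: transpose_matrix_vector)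
    ultimately have "snd W = 0"
    proof -
      define L where "L = fst (inv\<^bsub>Isom\<^esub> g)"
      define a where "a = snd (inv\<^bsub>Isom\<^esub> g)"
      have a: "a \<in> V" "transpose L *v a = a"
        using snd_in[OF igH] gV unfolding a_def L_def by (simp_all add: inv_Isom[OF H_Isom[OF gH]] del: transpose_matrix_vector)
      have "(L ** fst Z ** transpose L) *v a = 0"
        by (simp add: a lie_fst_zero[OF Z(1) a(1)] flip: matrix_vector_mul_assoc del: transpose_matrix_vector)
      then show ?thesis by (simp add: W_def Ad_def Z(2) flip: L_def a_def)
    qed
    then have "fst (lift v) \<bullet> fst W = 0" using lift(1)[OF v] W by (simp add: horizontal_def)
    moreover have "fst g ** fst W ** transpose (fst g) = fst Z"
    proof -
      have "fst g ** fst W ** transpose (fst g) = (fst g ** transpose (fst g)) ** fst Z ** (fst g ** transpose (fst g))"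
        by (simp only: fW matrix_mul_assoc)
      then show ?thesis by (simp add: TT)
    qed
    ultimately show ?thesis
      using inner_conj[OF orthogonal_H[OF gH], of "fst (lift v)" "fst W"] by (simp add: Ad_def)
  qed
  then have "Ad g (lift v) \<in> horizontal" using AX by (simp add: horizontal_def)
  then show ?thesis
    using horizontal_unique lift[OF v] snd_Ad by metis
qed

lemma emb_lift_commute:
  assumes g: "g \<in> trivial_on_V" and v: "v \<in> V"
  shows "emb g * tang (lift v) = tang (lift v) * emb g"
proof -
  have gI: "g \<in> carrier Isom" using g H_Isom by (simp add: trivial_on_V_def)
  have "tang (lift v) = emb g * tang (lift v) * emb (inv\<^bsub>Isom\<^esub> g)"
    using tang_Ad[OF gI] Ad_lift[OF g v] by metis
  then have "tang (lift v) * emb g = emb g * tang (lift v) * (emb (inv\<^bsub>Isom\<^esub> g) * emb g)"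
    by (metis mult.assoc)
  then show ?thesis by (simp add: emb_inv[OF gI])
qed

lemma lift_flow:
  assumes v: "v \<in> V"
  shows "\<exists>g\<in>trivial_on_V. snd g = t *\<^sub>R v \<and> emb g = exp (t *\<^sub>R tang (lift v))"
proof -
  have X: "lift v \<in> lie H" using lift(1)[OF v] by (simp add: horizontal_def)
  then obtain g where g: "g \<in> trivial_on_V" "emb g = exp (t *\<^sub>R tang (lift v))"
    using lie_trivial_on_V unfolding lie_def by blast
  have "app (emb g) (0, 1) = (0, 1) + t *\<^sub>R (v, 0)"
    unfolding g by (rule app_exp_line) (simp_all add: lift(2)[OF v] lie_fst_zero[OF X v] zero_prod_def)
  then have "snd g = t *\<^sub>R v" by simp
  then show ?thesis using g by blast
qed

lemma lift_commute:
  assumes v: "v \<in> V" and w: "w \<in> V"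
  shows "tang (lift v) * tang (lift w) = tang (lift w) * tang (lift v)"
proof -
  let ?A = "tang (lift v)" and ?B = "tang (lift w)"
  have eq: "exp (t *\<^sub>R ?A) * ?B = ?B * exp (t *\<^sub>R ?A)" for t
    using lift_flow[OF v, of t] emb_lift_commute[OF _ w] by metis
  have "((\<lambda>t. exp (t *\<^sub>R ?A) * ?B) has_vector_derivative ?A * ?B) (at 0)"
    by (rule bounded_linear.has_vector_derivative[OF bounded_linear_mult_left exp_curve_derivative])
  moreover have "((\<lambda>t. ?B * exp (t *\<^sub>R ?A)) has_vector_derivative ?B * ?A) (at 0)"
    by (rule bounded_linear.has_vector_derivative[OF bounded_linear_mult_right exp_curve_derivative])
  ultimately show ?thesis
    unfolding eq by (rule vector_derivative_unique_at)
qed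

text \<open>\<open>\<Phi> v\<close> is the linear part of the exponential of the horizontal lift of \<open>v\<close>, and \<open>\<beta> h\<close> that of the
  lift of \<open>h\<close>. To have derivatives at all points of the space, \<open>\<Phi>\<close> is extended by a linear
  projection onto \<open>V\<close>.\<close>

theorem transvection_homomorphism:
  obtains \<Phi> :: "real^'m \<Rightarrow> real^'m^'m" and \<beta> :: "real^'m \<Rightarrow> real^'m^'m"
  where "\<And>v. v \<in> V \<Longrightarrow> (\<Phi> v, v) \<in> trivial_on_V"
    "\<And>v w. v \<in> V \<Longrightarrow> w \<in> V \<Longrightarrow> \<Phi> (v + w) = \<Phi> v ** \<Phi> w"
    "\<And>v g. v \<in> V \<Longrightarrow> g \<in> trivial_on_V \<Longrightarrow> \<Phi> v ** fst g = fst g ** \<Phi> v"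
    "\<And>v. (\<Phi> has_derivative (\<lambda>h. \<Phi> v ** \<beta> h)) (at v)"
proof -
  have "\<exists>P. P ` UNIV \<subseteq> V \<and> linear P \<and> (\<forall>v\<in>V. P (id v) = v)"
    by (rule linear_exists_left_inverse_on[OF linear_id subspace_V]) simp
  then obtain P where P: "\<And>x. P x \<in> V" "linear P" "\<And>v. v \<in> V \<Longrightarrow> P v = v" by auto
  define Z where "Z x = tang (lift (P x))" for x
  \<comment> \<open>The linear part of the motion with homogeneous matrix \<open>exp (Z x)\<close>.\<close>
  define \<Phi> where "\<Phi> x = fst ((mat 1, 0) + untang (exp (Z x) - 1))" for x
  have "linear Z"
    unfolding Z_def
    by (rule linearI) (simp_all add: linear_add[OF P(2)] linear_scale[OF P(2)] lift_linear P(1) tang_simps)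
  then have bZ: "bounded_linear Z" using linear_conv_bounded_linear by blast
  have comm: "Z v * Z w = Z w * Z v" for v w
    unfolding Z_def by (rule lift_commute[OF P(1) P(1)])
  have flow: "(\<Phi> x, P x) \<in> trivial_on_V \<and> emb (\<Phi> x, P x) = exp (Z x)" for x
  proof -
    obtain g where g: "g \<in> trivial_on_V" "snd g = P x" "emb g = exp (Z x)"
      using lift_flow[OF P(1), of 1 x] by (auto simp: Z_def)
    have "fst g = \<Phi> x" unfolding \<Phi>_def using emb_untang[of g] g by simp
    then have "g = (\<Phi> x, P x)" using g by (simp add: prod_eq_iff)
    then show ?thesis using g by simp
  qed
  show ?thesis
  proof
    fix v assume v: "v \<in> V"
    show "(\<Phi> v, v) \<in> trivial_on_V" using flow[of v] P(3)[OF v] by simp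
  next
    fix v w assume v: "v \<in> V" and w: "w \<in> V"
    have "emb (\<Phi> (v + w), v + w) = emb (\<Phi> v, v) * emb (\<Phi> w, w)"
      using flow[of v] flow[of w] flow[of "v + w"] P(3) v w subspace_add[OF subspace_V v w]
        exp_add_commuting[OF comm, of v w] linear_add[OF \<open>linear Z\<close>] by simp
    then show "\<Phi> (v + w) = \<Phi> v ** \<Phi> w"
      by (simp add: Isom_mult flip: emb_mult)
  next
    fix v g assume v: "v \<in> V" and g: "g \<in> trivial_on_V"
    have "emb g * emb (\<Phi> v, v) = emb (\<Phi> v, v) * emb g"
      using flow[of v] P(3)[OF v] exp_commute[OF emb_lift_commute[OF g v]] by (simp add: Z_def)
    then show "\<Phi> v ** fst g = fst g ** \<Phi> v"
      by (simp add: Isom_mult flip: emb_mult)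
  next
    fix v
    have "bounded_linear (\<lambda>f. fst (untang f))"
      by (rule bounded_linear_compose[OF bounded_linear_fst bounded_linear_untang])
    from bounded_linear.has_derivative[OF this exp_linear_has_derivative[OF bZ comm, of v]]
    have 1: "((\<lambda>x. fst (untang (exp (Z x)))) has_derivative (\<lambda>h. fst (untang (exp (Z v) * Z h)))) (at v)" .
    have "fst (untang (exp (Z v) * Z h)) = \<Phi> v ** fst (lift (P h))" for h
    proof -
      have "emb (\<Phi> v, P v) * tang (lift (P h)) = tang (\<Phi> v ** fst (lift (P h)), \<Phi> v *v snd (lift (P h)))"
        by (rule endo_eqI) (simp add: matrix_vector_mul_assoc matrix_vector_right_distrib matrix_vector_mult_scaleR)
      then show ?thesis using flow[of v] by (simp add: Z_def)
    qed
    with 1 have "((\<lambda>x. fst (untang (exp (Z x)))) has_derivative (\<lambda>h. \<Phi> v ** fst (lift (P h)))) (at v)" by simp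
    from has_derivative_add[OF has_derivative_const[of "mat 1 - fst (untang 1)"] this]
    show "(\<Phi> has_derivative (\<lambda>h. \<Phi> v ** fst (lift (P h)))) (at v)"
      unfolding \<Phi>_def[abs_def] linear_diff[OF bounded_linear.linear[OF bounded_linear_untang]]
      by (simp add: algebra_simps)
  qed
qed

end

text \<open>The derivative of \<open>v \<mapsto> \<Phi> v ** M\<close> in a fixed direction is again of this form, which makes the
  induction over the order of differentiability work.\<close>

lemma smooth_of_multiplicative_derivative:
  fixes \<Phi> :: "'a::euclidean_space \<Rightarrow> real^'m^'m"
  assumes "\<And>v. (\<Phi> has_derivative (\<lambda>h. \<Phi> v ** \<beta> h)) (at v)"
  shows "smooth_on S \<Phi>"
proof -
  have "C_k_on n UNIV (\<lambda>v. \<Phi> v ** M)" for n and M :: "real^'m^'m"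
  proof (induction n arbitrary: M)
    case 0
    have "isCont \<Phi> v" for v using has_derivative_continuous[OF assms] .
    then have "continuous_on UNIV \<Phi>" by (simp add: continuous_on_eq_continuous_at)
    then have "continuous_on UNIV (\<lambda>v. \<Phi> v ** M)"
      unfolding continuous_on_def by (intro ballI tendsto_intros) blast
    then show ?case by simp
  next
    case (Suc n)
    have "linear (\<lambda>X :: real^'m^'m. X ** M)"
      by (rule linearI)
         (simp_all add: matrix_matrix_mult_def vec_eq_iff sum.distrib distrib_right sum_distrib_left mult.assoc)
    then have "bounded_linear (\<lambda>X :: real^'m^'m. X ** M)" using linear_conv_bounded_linear by blast
    from bounded_linear.has_derivative[OF this assms]
    have "((\<lambda>v. \<Phi> v ** M) has_derivative (\<lambda>h. \<Phi> v ** (\<beta> h ** M))) (at v)" for v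
      by (simp add: matrix_mul_assoc)
    then show ?case
      by (rule C_k_on_SucI[where D = "\<lambda>v h. \<Phi> v ** (\<beta> h ** M)", OF open_UNIV]) (rule Suc.IH)
  qed
  from this[of _ "mat 1"] show ?thesis
    by (intro smooth_on_C_k[OF open_UNIV]) auto
qed


section \<open>The isometries that preserve every leaf\<close>

text \<open>On a chart domain the inclusion is the composition of the chart with its smooth inverse, hence
  continuous.\<close>

lemma Lie_group_inclusion_continuous:
  assumes "connected_Lie_group_of_isometries G"
  obtains T where "topspace T = G" "connected_space T" "continuous_map T euclidean (\<lambda>g. g)"
proof -
  obtain T and L :: "'a motion set" and C where TLC: "Lie_group (Isom\<lparr>carrier := G\<rparr>) T L C" "connected_space T"
    "\<forall>(U, \<phi>)\<in>C. smooth_on (\<phi> ` U) (inv_into U \<phi>)"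
    using assms unfolding connected_Lie_group_of_isometries_def by blast
  have top: "topspace T = G" and man: "smooth_manifold T L C"
    using TLC(1) by (auto simp: Lie_group_def)
  have cover: "(\<Union>(U, \<phi>)\<in>C. U) = topspace T"
    and chart: "\<And>U \<phi>. (U, \<phi>) \<in> C \<Longrightarrow> openin T U \<and> homeomorphic_map (subtopology T U) (top_of_set (\<phi> ` U)) \<phi>"
    using man unfolding smooth_manifold_def by auto
  have "continuous_map T euclidean (\<lambda>g. g)"
    unfolding continuous_map_def
  proof (intro conjI allI impI)
    fix S :: "'a motion set" assume S: "openin euclidean S"
    show "openin T {x \<in> topspace T. x \<in> S}"
    proof (subst openin_subopen, intro ballI)
      fix x assume x: "x \<in> {x \<in> topspace T. x \<in> S}"
      then obtain U \<phi> where U: "(U, \<phi>) \<in> C" "x \<in> U" using cover by blast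
      have oU: "openin T U" and hom: "homeomorphic_map (subtopology T U) (top_of_set (\<phi> ` U)) \<phi>"
        using chart[OF U(1)] by auto
      have topU: "topspace (subtopology T U) = U" using openin_subset[OF oU] by auto
      have "continuous_on (\<phi> ` U) (inv_into U \<phi>)"
        using TLC(3) U(1) smooth_on_imp_continuous_on by blast
      then have "continuous_map (subtopology T U) euclidean (inv_into U \<phi> \<circ> \<phi>)"
        by (intro continuous_map_compose[OF homeomorphic_imp_continuous_map[OF hom]]) simp
      moreover have "inj_on \<phi> U" using homeomorphic_imp_injective_map[OF hom] topU by simp
      ultimately have "continuous_map (subtopology T U) euclidean (\<lambda>g. g)"
        by (elim continuous_map_eq) (simp add: topU)
      from openin_continuous_map_preimage[OF this S]
      have "openin (subtopology T U) {x \<in> U. x \<in> S}"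
        by (simp only: topU)
      then have "openin T {x \<in> U. x \<in> S}" using oU openin_trans_full by blast
      then show "\<exists>R. openin T R \<and> x \<in> R \<and> R \<subseteq> {x \<in> topspace T. x \<in> S}"
        using U(2) x openin_subset[OF oU] by blast
    qed
  qed simp
  then show ?thesis using that top TLC(2) by blast
qed

lemma subspace_coord_space: "subspace (coord_space K)"
  by (auto simp: coord_space_def subspace_def)

lemma closed_orthogonal_matrix: "closed {A :: real^'m^'m. orthogonal_matrix A}"
proof -
  have "continuous_on UNIV (\<lambda>A :: real^'m^'m. transpose A ** A)"
    unfolding transpose_def continuous_on_def by (intro ballI tendsto_intros)
  then show ?thesis
    unfolding orthogonal_matrix by (intro closed_Collect_eq continuous_on_const)
qed

lemma act_inv:
  assumes "g \<in> carrier Isom"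
  shows "act (inv\<^bsub>Isom\<^esub> g) (act g z) = z"
  unfolding act_mult[symmetric] group.l_inv[OF group_Isom assms] by simp

lemma orbit_trans:
  assumes G: "subgroup G Isom" and "y \<in> orbit G x" "z \<in> orbit G y"
  shows "z \<in> orbit G x"
proof -
  obtain g h where "g \<in> G" "y = act g x" "h \<in> G" "z = act h y"
    using assms(2,3) unfolding orbit_def by blast
  then have "h \<otimes>\<^bsub>Isom\<^esub> g \<in> G" "z = act (h \<otimes>\<^bsub>Isom\<^esub> g) x"
    using subgroup.m_closed[OF G] by (simp_all add: act_mult)
  then show ?thesis unfolding orbit_def by blast
qed

lemma orbit_sym:
  assumes G: "subgroup G Isom" and y: "y \<in> orbit G x"
  shows "x \<in> orbit G y"
proof -
  obtain g where g: "g \<in> G" "y = act g x" using y unfolding orbit_def by blast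
  then have "x = act (inv\<^bsub>Isom\<^esub> g) y"
    using act_inv[OF subsetD[OF subgroup.subset[OF G] g(1)], of x] by simp
  then show ?thesis using subgroup.m_inv_closed[OF G g(1)] unfolding orbit_def by blast
qed

text \<open>\<open>G\<close> need not be closed in the isometry group; this group is, and has the same orbits.\<close>

definition leaf_stabilizer :: "'m::finite motion set \<Rightarrow> 'm motion set" where
  "leaf_stabilizer G = {h \<in> carrier Isom. \<forall>z. act h z \<in> orbit G z}"

lemma subset_leaf_stabilizer: "subgroup G Isom \<Longrightarrow> G \<subseteq> leaf_stabilizer G"
  unfolding leaf_stabilizer_def orbit_def using subgroup.subset by blast

lemma subgroup_leaf_stabilizer:
  assumes G: "subgroup G Isom"
  shows "subgroup (leaf_stabilizer G) Isom"
proof (rule subgroup.intro)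
  show "\<one>\<^bsub>Isom\<^esub> \<in> leaf_stabilizer G"
    using subset_leaf_stabilizer[OF G] subgroup.one_closed[OF G] by blast
next
  fix g h assume "g \<in> leaf_stabilizer G" "h \<in> leaf_stabilizer G"
  then have gh: "g \<in> carrier Isom" "h \<in> carrier Isom" "\<And>z. act g z \<in> orbit G z" "\<And>z. act h z \<in> orbit G z"
    by (simp_all add: leaf_stabilizer_def)
  have "act (g \<otimes>\<^bsub>Isom\<^esub> h) z \<in> orbit G z" for z
    unfolding act_mult by (rule orbit_trans[OF G gh(4) gh(3)])
  moreover have "g \<otimes>\<^bsub>Isom\<^esub> h \<in> carrier Isom"
    by (rule monoid.m_closed[OF group.is_monoid[OF group_Isom] gh(1,2)])
  ultimately show "g \<otimes>\<^bsub>Isom\<^esub> h \<in> leaf_stabilizer G"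
    by (simp add: leaf_stabilizer_def)
next
  fix g assume g: "g \<in> leaf_stabilizer G"
  then have gI: "g \<in> carrier Isom" by (simp add: leaf_stabilizer_def)
  have "act (inv\<^bsub>Isom\<^esub> g) z \<in> orbit G z" for z
  proof -
    have "act g (act (inv\<^bsub>Isom\<^esub> g) z) = z"
      unfolding act_mult[symmetric] group.r_inv[OF group_Isom gI] by simp
    moreover have "act g (act (inv\<^bsub>Isom\<^esub> g) z) \<in> orbit G (act (inv\<^bsub>Isom\<^esub> g) z)"
      using g by (simp add: leaf_stabilizer_def)
    ultimately show ?thesis using orbit_sym[OF G] by simp
  qed
  then show "inv\<^bsub>Isom\<^esub> g \<in> leaf_stabilizer G"
    using group.inv_closed[OF group_Isom gI] by (simp add: leaf_stabilizer_def)
qed (auto simp: leaf_stabilizer_def)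

lemma closed_leaf_stabilizer:
  assumes "\<And>z. closed (orbit G z)"
  shows "closed (leaf_stabilizer G)"
proof -
  have "closed {h. act h z \<in> orbit G z}" for z
  proof -
    have "continuous_on UNIV (\<lambda>h. act h z)"
      unfolding act_eq continuous_on_def by (intro ballI tendsto_intros)
    from closed_vimage[OF assms this] show ?thesis by (simp add: vimage_def)
  qed
  moreover have "closed {h :: 'a motion. orthogonal_matrix (fst h)}"
    using closed_vimage[OF closed_orthogonal_matrix continuous_on_fst[OF continuous_on_id]] by (simp add: vimage_def)
  ultimately have "closed ({h. orthogonal_matrix (fst h)} \<inter> (\<Inter>z. {h. act h z \<in> orbit G z}))"
    by blast
  moreover have "leaf_stabilizer G = {h. orthogonal_matrix (fst h)} \<inter> (\<Inter>z. {h. act h z \<in> orbit G z})"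
    by (auto simp: leaf_stabilizer_def carrier_Isom)
  ultimately show ?thesis by simp
qed

lemma lie_translation_orbit:
  assumes b: "(0, b) \<in> lie (leaf_stabilizer G)"
  shows "x + t *\<^sub>R b \<in> orbit G x"
proof -
  obtain g where g: "g \<in> leaf_stabilizer G" "emb g = exp (t *\<^sub>R tang (0, b))"
    using b unfolding lie_def by blast
  have "app (emb g) (x, 1) = (x, 1) + t *\<^sub>R (b, 0)"
    unfolding g by (rule app_exp_line) (simp_all add: zero_prod_def)
  then have "act g x = x + t *\<^sub>R b" by (simp add: act_eq)
  then show ?thesis using g(1) unfolding leaf_stabilizer_def by (metis (no_types, lifting) mem_Collect_eq)
qed


section \<open>Orthogonal matrices that are trivial on a coordinate space\<close>

text \<open>An orthogonal matrix whose columns in \<open>K\<close> are trivial has trivial rows in \<open>K\<close>, too.\<close>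

lemma fixes_coord_space_rows:
  fixes A :: "real^'m^'m"
  assumes A: "orthogonal_matrix A" and fixed: "\<And>x. x \<in> coord_space K \<Longrightarrow> A *v x = x"
  shows "i \<in> K \<Longrightarrow> A $ i = axis i 1" "j \<in> K \<Longrightarrow> A $ i $ j = mat 1 $ i $ j"
proof -
  have ax: "axis i 1 \<in> coord_space K" if "i \<in> K" for i
    using that by (auto simp: coord_space_def axis_def)
  show "A $ i $ j = mat 1 $ i $ j" if "j \<in> K"
  proof -
    have "A $ i $ j = (A *v axis j 1) $ i" by (simp add: matrix_vector_mult_basis column_def)
    also have "\<dots> = axis j 1 $ i" using fixed[OF ax[OF that]] by simp
    also have "\<dots> = mat 1 $ i $ j" by (simp add: axis_def mat_def)
    finally show ?thesis .
  qed
  show "A $ i = axis i 1" if "i \<in> K"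
  proof -
    have "transpose A *v (A *v axis i 1) = axis i 1"
      using A by (simp add: matrix_vector_mul_assoc orthogonal_matrix del: transpose_matrix_vector)
    then have "transpose A *v axis i 1 = axis i 1" using fixed[OF ax[OF that]] by simp
    then show ?thesis
      by (simp add: matrix_vector_mult_basis column_def transpose_def vec_eq_iff del: transpose_matrix_vector)
  qed
qed

lemma fixes_coord_space_complement:
  fixes A :: "real^'m^'m"
  assumes A: "orthogonal_matrix A" and fixed: "\<And>x. x \<in> coord_space K \<Longrightarrow> A *v x = x"
    and y: "y \<in> coord_space (- K)"
  shows "A *v y \<in> coord_space (- K)"
  unfolding coord_space_def
proof (intro CollectI allI impI)
  fix i assume i: "i \<notin> - K"
  have "(A *v y) $ i = axis i 1 \<bullet> y"
    using fixes_coord_space_rows(1)[OF A fixed] i by (simp add: matrix_vector_mul_component)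
  also have "\<dots> = y $ i" by (simp add: inner_axis')
  also have "\<dots> = 0" using y i by (simp add: coord_space_def)
  finally show "(A *v y) $ i = 0" .
qed

text \<open>On motions with a linear part trivial on \<open>\<real>\<^sup>k\<close>, in particular on \<open>G\<close>, the projection to \<open>SO(n)\<close>
  is just the linear part.\<close>

lemma P2_eq_fst:
  assumes "orthogonal_matrix (fst g)" and "\<And>x. x \<in> coord_space K \<Longrightarrow> fst g *v x = x"
  shows "P2 K g = fst g"
proof -
  have "fst g $ i $ j = mat 1 $ i $ j" if "i \<in> K \<or> j \<in> K" for i j
    using that
  proof
    assume "i \<in> K"
    then have "fst g $ i = axis i 1"
      using fixes_coord_space_rows(1)[OF assms(1), of K i] assms(2) by blast
    then show ?thesis by (simp add: axis_def mat_def)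
  next
    assume "j \<in> K"
    then show ?thesis
      using fixes_coord_space_rows(2)[OF assms(1), of K j i] assms(2) by blast
  qed
  then show ?thesis
    by (cases g) (auto simp: vec_eq_iff)
qed


section \<open>The orbits\<close>

theorem proposition3p11:
  fixes K :: "'m::finite set"
    and G :: "'m motion set"
    and \<F> :: "(real^'m) set set"
  assumes "connected_Lie_group_of_isometries G"
    and "equidistant_foliation UNIV \<F>"
    and "\<F> = range (orbit G)"
    and "most_singular_leaf \<F> (coord_space K)"
    and "\<not> splits_off_Euclidean_factor \<F>"
  defines "G\<^sub>0 \<equiv> isotropy_group G 0"
  defines "G\<^sub>0' \<equiv> P2 K ` G\<^sub>0"
  shows "\<exists>\<Phi>. \<Phi> \<in> hom (vector_group K) (SO (- K)\<lparr>carrier := centralizer (SO (- K)) G\<^sub>0'\<rparr>) \<and>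
           smooth_on (coord_space K) \<Phi> \<and>
           (\<forall>x\<in>coord_space K. \<forall>y\<in>coord_space (- K).
              orbit G (x + y) = {x + v + \<Phi> v *v (h *v y) | v h. v \<in> coord_space K \<and> h \<in> G\<^sub>0'})"
proof -
  let ?V = "coord_space K"
  have G: "subgroup G Isom"
    using assms(1) by (simp add: connected_Lie_group_of_isometries_def)
  define H where "H = leaf_stabilizer G"
  have GH: "G \<subseteq> H" unfolding H_def by (rule subset_leaf_stabilizer[OF G])
  have H_orbit: "act h z \<in> orbit G z" if "h \<in> H" for h z
    using that by (simp add: H_def leaf_stabilizer_def)
  have leaf: "orbit G z \<in> \<F>" for z using assms(3) by blast
  have leaf_closed: "closed (orbit G z)" for z
    using assms(2) leaf[of z] by (auto simp: equidistant_foliation_def foliation_leaf_def complete_eq_closed)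
  \<comment> \<open>The given leaf contains the origin and so is the orbit of the origin.\<close>
  have "?V \<in> \<F>" using assms(4) by (simp add: most_singular_leaf_def)
  then obtain z where z: "?V = orbit G z" using assms(3) by blast
  have V0: "0 \<in> ?V" by (rule subspace_0[OF subspace_coord_space])
  have V_orbit: "?V = orbit G 0"
  proof (intro equalityI subsetI)
    fix x assume "x \<in> ?V"
    then show "x \<in> orbit G 0" using V0 z orbit_sym[OF G] orbit_trans[OF G] by metis
  next
    fix x assume "x \<in> orbit G 0"
    then show "x \<in> ?V" using V0 z orbit_trans[OF G] by metis
  qed
  interpret transitive_motions H ?V
  proof (rule transitive_motions.intro)
    show "subgroup H Isom" unfolding H_def by (rule subgroup_leaf_stabilizer[OF G])
    show "closed H" unfolding H_def by (rule closed_leaf_stabilizer[OF leaf_closed])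
    show "subspace ?V" by (rule subspace_coord_space)
    show "act g x \<in> ?V" if "g \<in> H" "x \<in> ?V" for g x
      using H_orbit[OF that(1), of x] that(2) orbit_trans[OF G] unfolding V_orbit by blast
    show "\<exists>g\<in>H. act g 0 = v" if "v \<in> ?V" for v
      using that GH unfolding V_orbit orbit_def by auto
    show "b = 0" if b: "(0, b) \<in> lie H" for b
    proof (rule ccontr)
      assume "b \<noteq> 0"
      moreover have "q + t *\<^sub>R b \<in> L" if L: "L \<in> \<F>" and q: "q \<in> L" for L q t
      proof -
        obtain z where "L = orbit G z" using L assms(3) by blast
        then show ?thesis
          using lie_translation_orbit[OF b[unfolded H_def]] q orbit_trans[OF G] by blast
      qed
      ultimately have "splits_off_Euclidean_factor \<F>"
        using translation_invariant_imp_splits_off[OF assms(2)] by blast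
      then show False using assms(5) by simp
    qed
  qed
  obtain T where T: "topspace T = G" "connected_space T" "continuous_map T euclidean (\<lambda>g. g)"
    using Lie_group_inclusion_continuous[OF assms(1)] by metis
  have G_trivial: "G \<subseteq> trivial_on_V"
    by (rule connected_subgroup_trivial_on_V[OF G GH T])
  obtain \<Phi> \<beta> where \<Phi>: "\<And>v. v \<in> ?V \<Longrightarrow> (\<Phi> v, v) \<in> trivial_on_V"
    and \<Phi>_add: "\<And>v w. v \<in> ?V \<Longrightarrow> w \<in> ?V \<Longrightarrow> \<Phi> (v + w) = \<Phi> v ** \<Phi> w"
    and \<Phi>_comm: "\<And>v g. v \<in> ?V \<Longrightarrow> g \<in> trivial_on_V \<Longrightarrow> \<Phi> v ** fst g = fst g ** \<Phi> v"
    and \<Phi>_der: "\<And>v. (\<Phi> has_derivative (\<lambda>h. \<Phi> v ** \<beta> h)) (at v)"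
    using transvection_homomorphism by metis
  have orth: "orthogonal_matrix (fst g)" and fixed: "\<And>x. x \<in> ?V \<Longrightarrow> fst g *v x = x"
    if "g \<in> trivial_on_V" for g
    using that orthogonal_H by (auto simp: trivial_on_V_def)
  have \<Phi>_orth: "orthogonal_matrix (\<Phi> v)" and \<Phi>_fix: "\<And>x. x \<in> ?V \<Longrightarrow> \<Phi> v *v x = x" if "v \<in> ?V" for v
    using orth[OF \<Phi>[OF that]] fixed[OF \<Phi>[OF that]] by simp_all
  have \<Phi>_act: "\<Phi> v *v z + v \<in> orbit G z" if "v \<in> ?V" for v z
    using H_orbit[of "(\<Phi> v, v)" z] \<Phi>[OF that] by (simp add: trivial_on_V_def)
  have \<Phi>_0: "\<Phi> 0 = mat 1"
  proof -
    have "transpose (\<Phi> 0) ** (\<Phi> 0 ** \<Phi> 0) = transpose (\<Phi> 0) ** \<Phi> 0"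
      using \<Phi>_add[OF V0 V0] by simp
    then show ?thesis using \<Phi>_orth[OF V0] by (simp add: matrix_mul_assoc orthogonal_matrix)
  qed
  have neg: "- v \<in> ?V" if "v \<in> ?V" for v using subspace_neg[OF subspace_coord_space that] .
  have G0: "g \<in> G\<^sub>0 \<longleftrightarrow> g \<in> G \<and> snd g = 0" for g
    by (auto simp: G\<^sub>0_def isotropy_group_def act_eq)
  have P2_fst: "P2 K g = fst g" if "g \<in> G" for g
    using P2_eq_fst[of g K] orth[of g] fixed[of g] that G_trivial by blast
  have G0': "G\<^sub>0' = fst ` G\<^sub>0"
    unfolding G\<^sub>0'_def using P2_fst G0 by (intro image_cong) auto
  have "\<Phi> \<in> hom (vector_group K) (SO (- K)\<lparr>carrier := centralizer (SO (- K)) G\<^sub>0'\<rparr>)"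
  proof (rule homI)
    fix v assume "v \<in> carrier (vector_group K)"
    then have v: "v \<in> ?V" by (simp add: vector_group_def)
    \<comment> \<open>\<open>\<Phi> v\<close> is the square of \<open>\<Phi> (v / 2)\<close>, so its determinant is \<open>1\<close>.\<close>
    have half: "(1/2) *\<^sub>R v \<in> ?V" by (rule subspace_scale[OF subspace_coord_space v])
    have "\<Phi> v = \<Phi> ((1/2) *\<^sub>R v) ** \<Phi> ((1/2) *\<^sub>R v)"
      using \<Phi>_add[OF half half] by (simp flip: scaleR_add_left)
    then have "det (\<Phi> v) = det (\<Phi> ((1/2) *\<^sub>R v)) * det (\<Phi> ((1/2) *\<^sub>R v))"
      by (simp add: det_mul)
    also have "\<dots> = 1" using det_orthogonal_matrix[OF \<Phi>_orth[OF half]] by auto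
    finally have "\<Phi> v \<in> carrier (SO (- K))"
      using \<Phi>_orth[OF v] \<Phi>_fix[OF v] by (simp add: SO_def)
    moreover have "\<Phi> v ** s = s ** \<Phi> v" if "s \<in> G\<^sub>0'" for s
      using that \<Phi>_comm[OF v] G_trivial G0 unfolding G0' by blast
    ultimately show "\<Phi> v \<in> carrier (SO (- K)\<lparr>carrier := centralizer (SO (- K)) G\<^sub>0'\<rparr>)"
      by (simp add: centralizer_def SO_def)
  next
    fix v w assume "v \<in> carrier (vector_group K)" "w \<in> carrier (vector_group K)"
    then show "\<Phi> (v \<otimes>\<^bsub>vector_group K\<^esub> w) = \<Phi> v \<otimes>\<^bsub>SO (- K)\<lparr>carrier := centralizer (SO (- K)) G\<^sub>0'\<rparr>\<^esub> \<Phi> w"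
      using \<Phi>_add by (simp add: vector_group_def SO_def)
  qed
  moreover have "smooth_on ?V \<Phi>"
    by (rule smooth_of_multiplicative_derivative[OF \<Phi>_der])
  moreover have "orbit G (x + y) = {x + v + \<Phi> v *v (h *v y) | v h. v \<in> ?V \<and> h \<in> G\<^sub>0'}"
    if x: "x \<in> ?V" and y: "y \<in> coord_space (- K)" for x y
  proof -
    \<comment> \<open>Moving \<open>x + y\<close> to the fibre over the origin.\<close>
    have move: "\<Phi> (- x) *v y \<in> orbit G (x + y)" if "x \<in> ?V" for x y
      using \<Phi>_act[OF neg[OF that], of "x + y"] \<Phi>_fix[OF neg[OF that] that]
      by (simp add: matrix_vector_right_distrib)
    \<comment> \<open>The result is independent of the base point \<open>x\<close>, because \<open>\<Phi> (- x)\<close> commutes with the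
        isotropy group.\<close>
    have slide: "\<Phi> (x + v) *v (fst g *v (\<Phi> (- x) *v y)) = \<Phi> v *v (fst g *v y)"
      if v: "v \<in> ?V" and g: "g \<in> trivial_on_V" for v g
    proof -
      have xv: "x + v \<in> ?V" by (rule subspace_add[OF subspace_coord_space x v])
      have "\<Phi> (x + v) ** (fst g ** \<Phi> (- x)) = (\<Phi> (x + v) ** \<Phi> (- x)) ** fst g"
        unfolding \<Phi>_comm[OF neg[OF x] g, symmetric] by (rule matrix_mul_assoc)
      also have "\<dots> = \<Phi> v ** fst g"
        using \<Phi>_add[OF xv neg[OF x]] by simp
      finally show ?thesis by (simp add: matrix_vector_mul_assoc matrix_mul_assoc)
    qed
    show ?thesis
    proof (intro equalityI subsetI)
      fix z assume "z \<in> {x + v + \<Phi> v *v (h *v y) | v h. v \<in> ?V \<and> h \<in> G\<^sub>0'}"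
      then obtain v g where v: "v \<in> ?V" and g: "g \<in> G\<^sub>0" and zeq: "z = x + v + \<Phi> v *v (fst g *v y)"
        unfolding G0' by blast
      have gG: "g \<in> G" "snd g = 0" using g G0 by auto
      have "fst g *v (\<Phi> (- x) *v y) \<in> orbit G (\<Phi> (- x) *v y)"
        using gG H_orbit[of g "\<Phi> (- x) *v y"] GH by (auto simp: act_eq)
      moreover have "z \<in> orbit G (fst g *v (\<Phi> (- x) *v y))"
        using \<Phi>_act[OF subspace_add[OF subspace_coord_space x v], of "fst g *v (\<Phi> (- x) *v y)"]
        unfolding slide[OF v subsetD[OF G_trivial gG(1)]] by (simp add: zeq add_ac)
      ultimately show "z \<in> orbit G (x + y)"
        using move[OF x] orbit_trans[OF G] by blast
    next
      fix z assume z: "z \<in> orbit G (x + y)"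
      \<comment> \<open>\<open>z = x' + y'\<close> is the decomposition into the components in \<open>\<real>\<^sup>k\<close> and \<open>\<real>\<^sup>n\<close>.\<close>
      define x' :: "real^'m" where "x' = (\<chi> i. if i \<in> K then z $ i else 0)"
      define y' where "y' = z - x'"
      have x': "x' \<in> ?V" by (simp add: x'_def coord_space_def)
      have y': "y' \<in> coord_space (- K)" by (simp add: y'_def x'_def coord_space_def)
      define v where "v = x' - x"
      have v: "v \<in> ?V" unfolding v_def by (rule subspace_diff[OF subspace_coord_space x' x])
      have "\<Phi> (- x') *v y' \<in> orbit G z" using move[OF x', of y'] by (simp add: y'_def)
      then have "\<Phi> (- x') *v y' \<in> orbit G (\<Phi> (- x) *v y)"
        using z orbit_trans[OF G] orbit_sym[OF G move[OF x]] by blast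
      then obtain g where g: "g \<in> G" "fst g *v (\<Phi> (- x) *v y) + snd g = \<Phi> (- x') *v y'"
        unfolding orbit_def act_eq by force
      have gT: "g \<in> trivial_on_V" using g G_trivial by blast
      have comp: "A *v u \<in> coord_space (- K)" if "orthogonal_matrix A" "\<And>x. x \<in> ?V \<Longrightarrow> A *v x = x" "u \<in> coord_space (- K)"
        for A :: "real^'m^'m" and u
        using fixes_coord_space_complement that by blast
      have 1: "fst g *v (\<Phi> (- x) *v y) \<in> coord_space (- K)"
        by (intro comp orth[OF gT] fixed[OF gT] \<Phi>_orth \<Phi>_fix neg x y)
      have 2: "\<Phi> (- x') *v y' \<in> coord_space (- K)"
        by (intro comp \<Phi>_orth \<Phi>_fix neg x' y')
      have "snd g \<in> ?V" using snd_in GH g(1) by blast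
      moreover have "snd g \<in> coord_space (- K)"
        using subspace_diff[OF subspace_coord_space 2 1] g(2) by (metis add_diff_cancel_left')
      ultimately have "snd g = 0" by (auto simp: coord_space_def vec_eq_iff)
      then have gG0: "g \<in> G\<^sub>0" using G0 g by blast
      have "\<Phi> x' *v (\<Phi> (- x') *v y') = y'"
        using \<Phi>_add[OF x' neg[OF x'], symmetric] \<Phi>_0 by (simp add: matrix_vector_mul_assoc)
      then have "y' = \<Phi> (x + v) *v (fst g *v (\<Phi> (- x) *v y))"
        using g(2) \<open>snd g = 0\<close> by (simp add: v_def)
      moreover have "z = x + v + y'"
        by (simp add: y'_def v_def)
      ultimately have "z = x + v + \<Phi> v *v (fst g *v y)"
        using slide[OF v gT] by simp
      then show "z \<in> {x + v + \<Phi> v *v (h *v y) | v h. v \<in> ?V \<and> h \<in> G\<^sub>0'}"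
        using v gG0 unfolding G0' by blast
    qed
  qed
  ultimately show ?thesis by blast
qed

end
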